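(* Let $N$ be a lattice of finite rank, $\Delta$ a fan in $N_{\mathbb R}=N\otimes_{\mathbb Z}\mathbb R$, and $X=X(\Delta)$ the associated toric variety over an algebraically closed field $k$, with torus $T$. If $X$ has a structure of a toric semigroup, then the fan $\Delta$ is generated by a single cone $\sigma\in\Delta$ (that is, $\Delta$ consists of $\sigma$ together with all of its faces). In particular, $X$ is affine.
   Context: $k$ is an arbitrary algebraically closed field. Algebraic varieties over $k$ have a finite open cover by affine varieties and are not assumed irreducible or separated. A toric variety is a pair $(X,T)$ (written $X\supset T$) where $X$ is a normal algebraic variety and $T\subset X$ is an open dense subset isomorphic to an algebraic torus, such that the multiplication $T\times T\to T$ extends to an action $T\times X\to X$. An algebraic semigroup is an algebraic variety $S$ with an associative morphism $S\times S\to S$. A toric semigroup is a toric variety $X\supset T$ with a structure of an algebraic semigroup whose multiplication extends that of $T$. Let $N\cong\mathbb Z^n$, $M=\operatorname{Hom}(N,\mathbb Z)$, $N_{\mathbb R}=N\otimes\mathbb R$, $M_{\mathbb R}=M\otimes\mathbb R$, with canonical pairing $(\cdot,\cdot)$. A cone in $N_{\mathbb R}$ is a subset closed under multiplication by nonnegative reals; it is strongly convex if it contains no real line, polyhedral if it is an intersection of finitely many closed half-spaces, rational if it is the set of nonnegative real combinations of finitely many elements of $N$. The dual cone is $\sigma^*=\{u\in M_{\mathbb R}\mid (u,v)\ge 0\ \forall v\in\sigma\}$. A face of $\sigma$ is a subset $\sigma\cap u^\perp$ with $u\in\sigma^*$, where $u^\perp=\{v\in N_{\mathbb R}\mid (u,v)=0\}$.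 A fan in $N_{\mathbb R}$ is a nonempty finite collection $\Delta$ of strongly convex rational polyhedral cones such that (1) every face of a cone in $\Delta$ is in $\Delta$; (2) the intersection of two cones in $\Delta$ is a face of both. For $\sigma\in\Delta$ put $S_\sigma=\sigma^*\cap M$, $U_\sigma=\operatorname{Spec}k[S_\sigma]$ (closed points; $k[S_\sigma]$ is the semigroup ring). For $\sigma,\tau\in\Delta$ the inclusions $S_\sigma,S_\tau\subset S_{\sigma\cap\tau}$ induce open embeddings $U_{\sigma\cap\tau}\to U_\sigma$ and $U_{\sigma\cap\tau}\to U_\tau$; $X(\Delta)$ is the variety obtained by gluing the $U_\sigma$ along these. It is a toric variety with torus $T=U_{\{0\}}=\operatorname{Spec}k[M]$. *)

theory Defs
  imports
    "HOL-Analysis.Analysis"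
    "HOL-Algebra.Ideal"
    "HOL-Computational_Algebra.Polynomial"
    "HOL-Library.Poly_Mapping"
    "HOL-Library.Function_Algebras"
begin

section \<open>Lattices, cones and fans\<close>

text \<open>
  A lattice is given inside the real vector space that it spans: \<open>N\<close> is the set of integer
  combinations of a finite basis of the whole space \<open>'v\<close>, so that \<open>'v\<close> is
  \<open>N \<otimes> \<real>\<close>.  The rank is arbitrary (it is \<open>0\<close> when \<open>'v\<close> has one element).
\<close>

definition lattice_in :: "'v::real_vector set \<Rightarrow> bool" where
  "lattice_in N \<longleftrightarrow>
     (\<exists>B. finite B \<and> independent B \<and> span B = UNIV \<and>
          N = {\<Sum>b\<in>B. of_int (c b) *\<^sub>R b |c :: 'v \<Rightarrow> int. True})"

text \<open>
  Elements of the dual space \<open>M\<^sub>\<real>\<close> are linear functionals on \<open>'v\<close>, the pairing is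
  evaluation, and \<open>M = Hom(N, \<int>)\<close> consists of those that are integral on \<open>N\<close>.
\<close>

definition dual_lattice :: "'v::real_vector set \<Rightarrow> ('v \<Rightarrow> real) set" where
  "dual_lattice N = {u. linear u \<and> (\<forall>v\<in>N. u v \<in> \<int>)}"

definition dual_cone :: "'v::real_vector set \<Rightarrow> ('v \<Rightarrow> real) set" where
  "dual_cone \<sigma> = {u. linear u \<and> (\<forall>v\<in>\<sigma>. 0 \<le> u v)}"

definition strongly_convex :: "'v::real_vector set \<Rightarrow> bool" where
  "strongly_convex \<sigma> \<longleftrightarrow> \<not> (\<exists>p d. d \<noteq> 0 \<and> (\<forall>t. p + t *\<^sub>R d \<in> \<sigma>))"

definition closed_half_space :: "'v::real_vector set \<Rightarrow> bool" where
  "closed_half_space H \<longleftrightarrow>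
     (\<exists>u c. linear u \<and> u \<noteq> (\<lambda>_. 0) \<and> H = {v. c \<le> (u v :: real)})"

definition polyhedral :: "'v::real_vector set \<Rightarrow> bool" where
  "polyhedral \<sigma> \<longleftrightarrow> (\<exists>\<H>. finite \<H> \<and> (\<forall>H\<in>\<H>. closed_half_space H) \<and> \<sigma> = \<Inter>\<H>)"

definition rational_cone :: "'v::real_vector set \<Rightarrow> 'v set \<Rightarrow> bool" where
  "rational_cone N \<sigma> \<longleftrightarrow>
     (\<exists>F. finite F \<and> F \<subseteq> N \<and> \<sigma> = {\<Sum>v\<in>F. c v *\<^sub>R v |c. \<forall>v\<in>F. (0::real) \<le> c v})"

definition face_of_cone :: "'v::real_vector set \<Rightarrow> 'v set \<Rightarrow> bool" where
  "face_of_cone \<tau> \<sigma> \<longleftrightarrow> (\<exists>u\<in>dual_cone \<sigma>. \<tau> = \<sigma> \<inter> {v. u v = 0})"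

definition fan :: "'v::real_vector set \<Rightarrow> 'v set set \<Rightarrow> bool" where
  "fan N \<Delta> \<longleftrightarrow>
     finite \<Delta> \<and> \<Delta> \<noteq> {} \<and>
     (\<forall>\<sigma>\<in>\<Delta>. cone \<sigma> \<and> strongly_convex \<sigma> \<and> polyhedral \<sigma> \<and> rational_cone N \<sigma>) \<and>
     (\<forall>\<sigma>\<in>\<Delta>. \<forall>\<tau>. face_of_cone \<tau> \<sigma> \<longrightarrow> \<tau> \<in> \<Delta>) \<and>
     (\<forall>\<sigma>\<in>\<Delta>. \<forall>\<tau>\<in>\<Delta>. face_of_cone (\<sigma> \<inter> \<tau>) \<sigma> \<and> face_of_cone (\<sigma> \<inter> \<tau>) \<tau>)"


section \<open>Spaces with functions\<close>

text \<open>
  Varieties over \<open>k\<close> are treated as topological spaces carrying a sheaf of \<open>k\<close>-valued functions.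
  \<open>regular X U\<close> is the set of regular functions on the open set \<open>U\<close>; they are total
  functions of which only the values on \<open>U\<close> matter.
\<close>

record ('x, 'k) fspace =
  top_of :: "'x topology"
  regular :: "'x set \<Rightarrow> ('x \<Rightarrow> 'k) set"

abbreviation points :: "('x, 'k) fspace \<Rightarrow> 'x set" where
  "points X \<equiv> topspace (top_of X)"

definition morphism :: "('x, 'k) fspace \<Rightarrow> ('y, 'k) fspace \<Rightarrow> ('x \<Rightarrow> 'y) \<Rightarrow> bool" where
  "morphism X Y \<phi> \<longleftrightarrow>
     continuous_map (top_of X) (top_of Y) \<phi> \<and>
     (\<forall>V f. openin (top_of Y) V \<longrightarrow> f \<in> regular Y V \<longrightarrow>
            f \<circ> \<phi> \<in> regular X {x \<in> points X. \<phi> x \<in> V})"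

definition isomorphic_fspace :: "('x, 'k) fspace \<Rightarrow> ('y, 'k) fspace \<Rightarrow> bool" where
  "isomorphic_fspace X Y \<longleftrightarrow>
     (\<exists>\<phi> \<psi>. morphism X Y \<phi> \<and> morphism Y X \<psi> \<and>
            (\<forall>x\<in>points X. \<psi> (\<phi> x) = x) \<and> (\<forall>y\<in>points Y. \<phi> (\<psi> y) = y))"

text \<open>
  A set \<open>X\<close> with an algebra \<open>A\<close> of \<open>k\<close>-valued functions on it: the Zariski topology has
  the loci \<open>b \<noteq> 0\<close> as a basis, and regular functions are locally quotients of elements
  of \<open>A\<close>.
\<close>

definition fspace_of :: "'x set \<Rightarrow> ('x \<Rightarrow> 'k::field) set \<Rightarrow> ('x, 'k) fspace" where
  "fspace_of X A =
     (let Z = topology_generated_by {{x \<in> X. b x \<noteq> 0} |b. b \<in> A}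
      in \<lparr> top_of = Z,
           regular = (\<lambda>U. {f. \<forall>x\<in>U. \<exists>V. openin Z V \<and> x \<in> V \<and> V \<subseteq> U \<and>
                        (\<exists>a\<in>A. \<exists>b\<in>A. \<forall>y\<in>V. b y \<noteq> 0 \<and> f y = a y / b y)}) \<rparr>)"

text \<open>Points of affine \<open>m\<close>-space are the functions \<open>{..<m} \<rightarrow> k\<close>.\<close>

inductive_set poly_fun :: "nat \<Rightarrow> ((nat \<Rightarrow> 'k) \<Rightarrow> 'k::field) set" for m where
  poly_const: "(\<lambda>_. c) \<in> poly_fun m"
| poly_coord: "i < m \<Longrightarrow> (\<lambda>x. x i) \<in> poly_fun m"
| poly_add: "p \<in> poly_fun m \<Longrightarrow> q \<in> poly_fun m \<Longrightarrow> (\<lambda>x. p x + q x) \<in> poly_fun m"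
| poly_mult: "p \<in> poly_fun m \<Longrightarrow> q \<in> poly_fun m \<Longrightarrow> (\<lambda>x. p x * q x) \<in> poly_fun m"

definition zero_locus :: "nat \<Rightarrow> ((nat \<Rightarrow> 'k) \<Rightarrow> 'k::field) set \<Rightarrow> (nat \<Rightarrow> 'k) set" where
  "zero_locus m F = {x \<in> {..<m} \<rightarrow>\<^sub>E UNIV. \<forall>p\<in>F. p x = 0}"

definition affine_variety :: "('x, 'k::field) fspace \<Rightarrow> bool" where
  "affine_variety X \<longleftrightarrow>
     (\<exists>m F. F \<subseteq> poly_fun m \<and> isomorphic_fspace X (fspace_of (zero_locus m F) (poly_fun m)))"

text \<open>
  The product in the category of spaces with functions.  On a product of affine varieties it
  is the Zariski topology and structure sheaf belonging to \<open>k[X] \<otimes> k[Y]\<close> (not the product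
  topology), and it is compatible with passing to open subsets of the factors.
\<close>

definition tensor_fun ::
  "('x, 'k::field) fspace \<Rightarrow> ('y, 'k) fspace \<Rightarrow> 'x set \<Rightarrow> 'y set \<Rightarrow> ('x \<times> 'y \<Rightarrow> 'k) set" where
  "tensor_fun X Y U V =
     {\<lambda>p. \<Sum>i<n. a i (fst p) * b i (snd p) |(n::nat) a b.
        \<forall>i<n. a i \<in> regular X U \<and> b i \<in> regular Y V}"

definition basic_open :: "'x set \<Rightarrow> 'y set \<Rightarrow> ('x \<times> 'y \<Rightarrow> 'k::field) \<Rightarrow> ('x \<times> 'y) set" where
  "basic_open U V h = {p \<in> U \<times> V. h p \<noteq> 0}"

definition prod_fspace ::
  "('x, 'k::field) fspace \<Rightarrow> ('y, 'k) fspace \<Rightarrow> ('x \<times> 'y, 'k) fspace" where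
  "prod_fspace X Y =
     \<lparr> top_of = topology_generated_by
         {basic_open U V h |U V h.
            openin (top_of X) U \<and> openin (top_of Y) V \<and> h \<in> tensor_fun X Y U V},
       regular = (\<lambda>W. {f. \<forall>p\<in>W. \<exists>U V.
         openin (top_of X) U \<and> openin (top_of Y) V \<and>
         (\<exists>g\<in>tensor_fun X Y U V. \<exists>h\<in>tensor_fun X Y U V.
            p \<in> basic_open U V h \<and> basic_open U V h \<subseteq> W \<and>
            (\<forall>q\<in>basic_open U V h. f q = g q / h q))}) \<rparr>"

definition semigroup_morphism :: "('x, 'k::field) fspace \<Rightarrow> ('x \<times> 'x \<Rightarrow> 'x) \<Rightarrow> bool" where
  "semigroup_morphism X \<mu> \<longleftrightarrow>
     morphism (prod_fspace X X) X \<mu> \<and>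
     (\<forall>x\<in>points X. \<forall>y\<in>points X. \<forall>z\<in>points X. \<mu> (\<mu> (x, y), z) = \<mu> (x, \<mu> (y, z)))"


section \<open>The toric variety of a fan\<close>

definition cone_semigroup :: "'v::real_vector set \<Rightarrow> 'v set \<Rightarrow> ('v \<Rightarrow> real) set" where
  "cone_semigroup N \<sigma> = dual_cone \<sigma> \<inter> dual_lattice N"

text \<open>
  The semigroup ring \<open>k[S]\<close>: finitely supported functions \<open>S \<rightarrow> k\<close> with convolution.  The
  monomial \<open>\<chi>\<^sup>u\<close> is \<open>Poly_Mapping.single u 1\<close>, and the scalar \<open>c\<close> is
  \<open>Poly_Mapping.single 0 c\<close>.
\<close>

definition semigroup_ring ::
  "('v \<Rightarrow> real) set \<Rightarrow> (('v \<Rightarrow> real) \<Rightarrow>\<^sub>0 'k::field) ring" where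
  "semigroup_ring S =
     \<lparr> carrier = {f. Poly_Mapping.keys f \<subseteq> S}, mult = (*), one = 1, zero = 0, add = (+) \<rparr>"

text \<open>
  The closed points of \<open>Spec k[S]\<close> are the maximal ideals.  As \<open>k\<close> is algebraically closed,
  the value of \<open>f\<close> at \<open>\<mm>\<close> is the scalar congruent to \<open>f\<close> modulo \<open>\<mm>\<close>.
\<close>

definition closed_points ::
  "('v \<Rightarrow> real) set \<Rightarrow> (('v \<Rightarrow> real) \<Rightarrow>\<^sub>0 'k::field) set set" where
  "closed_points S = {\<mm>. maximalideal \<mm> (semigroup_ring S)}"

definition value_at ::
  "(('v \<Rightarrow> real) \<Rightarrow>\<^sub>0 'k::field) \<Rightarrow> (('v \<Rightarrow> real) \<Rightarrow>\<^sub>0 'k) set \<Rightarrow> 'k" where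
  "value_at f \<mm> = (THE c. f - Poly_Mapping.single 0 c \<in> \<mm>)"

definition Spec ::
  "('v \<Rightarrow> real) set \<Rightarrow> ((('v \<Rightarrow> real) \<Rightarrow>\<^sub>0 'k::field) set, 'k) fspace" where
  "Spec S = fspace_of (closed_points S) (value_at ` carrier (semigroup_ring S))"

definition affine_chart ::
  "'v::real_vector set \<Rightarrow> 'v set \<Rightarrow> ((('v \<Rightarrow> real) \<Rightarrow>\<^sub>0 'k::field) set, 'k) fspace" where
  "affine_chart N \<sigma> = Spec (cone_semigroup N \<sigma>)"

text \<open>The map \<open>Spec k[S'] \<rightarrow> Spec k[S]\<close> induced by an inclusion \<open>S \<subseteq> S'\<close>.\<close>

definition contract ::
  "('v \<Rightarrow> real) set \<Rightarrow> (('v \<Rightarrow> real) \<Rightarrow>\<^sub>0 'k::field) set \<Rightarrow> (('v \<Rightarrow> real) \<Rightarrow>\<^sub>0 'k) set" where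
  "contract S \<mm> = \<mm> \<inter> carrier (semigroup_ring S)"

type_synonym ('v, 'k) chart_point = "'v set \<times> (('v \<Rightarrow> real) \<Rightarrow>\<^sub>0 'k) set"
type_synonym ('v, 'k) toric_point = "('v, 'k) chart_point set"

definition chart_points ::
  "'v::real_vector set \<Rightarrow> 'v set set \<Rightarrow> ('v, 'k::field) chart_point set" where
  "chart_points N \<Delta> = (SIGMA \<sigma>:\<Delta>. closed_points (cone_semigroup N \<sigma>))"

definition gluing ::
  "'v::real_vector set \<Rightarrow> 'v set set \<Rightarrow> ('v, 'k::field) chart_point rel" where
  "gluing N \<Delta> =
     {((\<sigma>, x), (\<tau>, y)) |\<sigma> x \<tau> y.
        (\<sigma>, x) \<in> chart_points N \<Delta> \<and> (\<tau>, y) \<in> chart_points N \<Delta> \<and>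
        (\<exists>z\<in>closed_points (cone_semigroup N (\<sigma> \<inter> \<tau>)).
           x = contract (cone_semigroup N \<sigma>) z \<and> y = contract (cone_semigroup N \<tau>) z)}"

definition chart_map ::
  "'v::real_vector set \<Rightarrow> 'v set set \<Rightarrow> 'v set \<Rightarrow> (('v \<Rightarrow> real) \<Rightarrow>\<^sub>0 'k::field) set
     \<Rightarrow> ('v, 'k) toric_point" where
  "chart_map N \<Delta> \<sigma> x = gluing N \<Delta> `` {(\<sigma>, x)}"

text \<open>
  \<open>X(\<Delta>)\<close> is the quotient of the disjoint union of the charts by the gluing relation, with the
  quotient topology; a function is regular iff its pull-backs to all charts are.
\<close>

definition chart_preimage ::
  "'v::real_vector set \<Rightarrow> 'v set set \<Rightarrow> ('v, 'k::field) toric_point set \<Rightarrow> 'v set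
     \<Rightarrow> (('v \<Rightarrow> real) \<Rightarrow>\<^sub>0 'k) set set" where
  "chart_preimage N \<Delta> W \<sigma> =
     {x \<in> closed_points (cone_semigroup N \<sigma>). chart_map N \<Delta> \<sigma> x \<in> W}"

definition toric_variety ::
  "'v::real_vector set \<Rightarrow> 'v set set \<Rightarrow> (('v, 'k::field) toric_point, 'k) fspace" where
  "toric_variety N \<Delta> =
     \<lparr> top_of = topology (\<lambda>W. W \<subseteq> chart_points N \<Delta> // gluing N \<Delta> \<and>
         (\<forall>\<sigma>\<in>\<Delta>. openin (top_of (affine_chart N \<sigma>)) (chart_preimage N \<Delta> W \<sigma>))),
       regular = (\<lambda>W. {f. \<forall>\<sigma>\<in>\<Delta>.
         f \<circ> chart_map N \<Delta> \<sigma> \<in> regular (affine_chart N \<sigma>) (chart_preimage N \<Delta> W \<sigma>)}) \<rparr>"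

lemma istopology_toric:
  "istopology (\<lambda>W. W \<subseteq> chart_points N \<Delta> // gluing N \<Delta> \<and>
     (\<forall>\<sigma>\<in>\<Delta>. openin (top_of (affine_chart N \<sigma>)) (chart_preimage N \<Delta> W \<sigma>)))"
proof -
  have "chart_preimage N \<Delta> (S \<inter> T) \<sigma> = chart_preimage N \<Delta> S \<sigma> \<inter> chart_preimage N \<Delta> T \<sigma>"
    for S T :: "('a, 'b) toric_point set" and \<sigma>
    by (auto simp: chart_preimage_def)
  moreover have "chart_preimage N \<Delta> (\<Union>\<K>) \<sigma> = (\<Union>W\<in>\<K>. chart_preimage N \<Delta> W \<sigma>)"
    for \<K> :: "('a, 'b) toric_point set set" and \<sigma>
    by (auto simp: chart_preimage_def)
  ultimately show ?thesis
    unfolding istopology_def by (auto intro!: openin_Int openin_Union)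
qed

text \<open>
  The group law of the torus \<open>T = Spec k[M]\<close>, where \<open>M\<close> is the semigroup of the cone \<open>{0}\<close>:
  it is dual to \<open>\<chi>\<^sup>u \<mapsto> \<chi>\<^sup>u \<otimes> \<chi>\<^sup>u\<close>, so the product of \<open>s\<close> and \<open>t\<close> is the kernel of
  the evaluation \<open>\<chi>\<^sup>u \<mapsto> \<chi>\<^sup>u(s) \<chi>\<^sup>u(t)\<close>.
\<close>

definition torus_mult ::
  "'v::real_vector set \<Rightarrow> (('v \<Rightarrow> real) \<Rightarrow>\<^sub>0 'k::field) set \<Rightarrow> (('v \<Rightarrow> real) \<Rightarrow>\<^sub>0 'k) set
     \<Rightarrow> (('v \<Rightarrow> real) \<Rightarrow>\<^sub>0 'k) set" where
  "torus_mult N s t =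
     {f \<in> carrier (semigroup_ring (dual_lattice N)).
        (\<Sum>u\<in>Poly_Mapping.keys f. Poly_Mapping.lookup f u *
           (value_at (Poly_Mapping.single u 1) s * value_at (Poly_Mapping.single u 1) t)) = 0}"

text \<open>
  A structure of toric semigroup on \<open>X(\<Delta>) \<supset> T\<close>, where \<open>T\<close> is embedded as the chart of the
  cone \<open>{0}\<close>.  That \<open>X(\<Delta>)\<close> is a toric variety is not part of this condition.
\<close>

definition toric_semigroup ::
  "'v::real_vector set \<Rightarrow> 'v set set \<Rightarrow>
   (('v, 'k::field) toric_point \<times> ('v, 'k) toric_point \<Rightarrow> ('v, 'k) toric_point) \<Rightarrow> bool" where
  "toric_semigroup N \<Delta> \<mu> \<longleftrightarrow>
     semigroup_morphism (toric_variety N \<Delta>) \<mu> \<and>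
     (\<forall>s\<in>closed_points (cone_semigroup N {0}). \<forall>t\<in>closed_points (cone_semigroup N {0}).
        \<mu> (chart_map N \<Delta> {0} s, chart_map N \<Delta> {0} t) = chart_map N \<Delta> {0} (torus_mult N s t))"

end

theory Submission
  imports Defs "HOL-Analysis.Kronecker_Approximation_Theorem"
begin

text \<open>
  For cones \<open>\<sigma>, \<tau>\<close> of the fan let \<open>v, w\<close> be the sums of their lattice generators.  As \<open>s\<close> tends
  to \<open>0\<close>, the one-parameter subgroups of \<open>i v\<close> and \<open>j w\<close> tend to points \<open>x\<^sub>\<sigma>, x\<^sub>\<tau>\<close> that do not
  depend on \<open>i, j > 0\<close>.  The product \<open>x\<^sub>\<sigma> x\<^sub>\<tau>\<close> lies in a chart of some cone \<open>\<rho>\<close>.  For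
  \<open>u \<in> S\<^sub>\<rho>\<close> the character \<open>\<chi>\<^sup>u\<close> is regular near that point and equals \<open>s\<close> to the power
  \<open>i u(v) + j u(w)\<close> along the product of the two subgroups, so this exponent is nonnegative for all
  \<open>i, j > 0\<close>.  Hence \<open>v, w \<in> \<rho>\<close>, and both \<open>\<sigma>\<close> and \<open>\<tau>\<close> are contained in \<open>\<rho>\<close>.  As the fan is finite, it
  has a largest cone \<open>\<sigma>\<close>, all its cones are faces of \<open>\<sigma>\<close>, and \<open>X\<close> is the chart of \<open>\<sigma>\<close>.  This
  chart is affine because \<open>S\<^sub>\<sigma>\<close> is finitely generated and the closed points of \<open>Spec k[S\<^sub>\<sigma>]\<close> are the
  semigroup homomorphisms \<open>S\<^sub>\<sigma> \<rightarrow> k\<close>.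
\<close>

section \<open>Integral functionals\<close>

text \<open>For one choice of exponents the product of the limits only gives u(v) + u(w) >= 0. The
  limits forget positive multiples because a power of 0 only sees whether its exponent is 0, so both
  directions can be scaled independently against one fixed point, and this separates the two
  inequalities. Sums of generators are taken because they are relative interior points: a face of
  \<sigma> containing v is \<sigma> itself, and the intersection of \<sigma> with \<rho> is a face.
  Two gaps have to be bridged. Characters exist only for functionals in M, whereas half-spaces and
  faces are given by real functionals; simultaneous approximation connects them. Points are maximal
  ideals, so evaluation and gluing become computable only after the Nullstellensatz identifies them
  with semigroup homomorphisms into k; it is proved by extending homomorphisms, which works whatever
  the cardinality of k. Finally, the topology of the product is generated by loci of tensors and is
  not the product topology, so that a pair of curves must be shown to be a morphism.\<close>

lemma dual_lattice_linear: "u \<in> dual_lattice N \<Longrightarrow> linear u"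
  by (simp add: dual_lattice_def)

lemma dual_lattice_Ints: "u \<in> dual_lattice N \<Longrightarrow> v \<in> N \<Longrightarrow> u v \<in> \<int>"
  by (simp add: dual_lattice_def)

lemma dual_lattice_0: "0 \<in> dual_lattice N"
  by (simp add: dual_lattice_def zero_fun_def linear_zero)

lemma dual_lattice_add: "u \<in> dual_lattice N \<Longrightarrow> w \<in> dual_lattice N \<Longrightarrow> u + w \<in> dual_lattice N"
  by (auto simp: dual_lattice_def plus_fun_def intro: linear_compose_add)

lemma dual_lattice_uminus: "u \<in> dual_lattice N \<Longrightarrow> - u \<in> dual_lattice N"
  by (auto simp: dual_lattice_def fun_Compl_def intro: linear_compose_neg)

lemma dual_lattice_diff: "u \<in> dual_lattice N \<Longrightarrow> w \<in> dual_lattice N \<Longrightarrow> u - w \<in> dual_lattice N"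
  using dual_lattice_add[OF _ dual_lattice_uminus] by fastforce

text \<open>
  Dirichlet's simultaneous approximation replaces a real functional by an integral one with the
  same signs: for large \<open>q\<close> the nearest integral functional to \<open>q u\<close> takes an integral value
  of absolute value below \<open>1\<close>, hence \<open>0\<close>, wherever \<open>u\<close> vanishes.
\<close>

lemma ex_dual_lattice_same_signs:
  fixes N :: "'v::real_vector set" and u :: "'v \<Rightarrow> real"
  assumes N: "lattice_in N" and u: "linear u" and F: "finite F" "F \<subseteq> N"
  shows "\<exists>w\<in>dual_lattice N. \<forall>f\<in>F. sgn (w f) = sgn (u f)"
proof -
  obtain B where B: "finite B" "independent B" "span B = UNIV"
    and NB: "N = {\<Sum>b\<in>B. of_int (c b) *\<^sub>R b |c :: 'v \<Rightarrow> int. True}"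
    using N unfolding lattice_in_def by blast
  have "\<forall>f\<in>F. \<exists>c :: 'v \<Rightarrow> int. f = (\<Sum>b\<in>B. of_int (c b) *\<^sub>R b)"
    using F(2) NB by blast
  then obtain c :: "'v \<Rightarrow> 'v \<Rightarrow> int"
    where c: "f = (\<Sum>b\<in>B. of_int (c f b) *\<^sub>R b)" if "f \<in> F" for f
    by metis
  obtain h where h: "bij_betw h {0..<card B} B"
    using ex_bij_betw_nat_finite[OF B(1)] by blast
  \<comment> \<open>\<open>K\<close> bounds the sum of the absolute coordinates of each
    \<open>f\<close>, so an error below 1/m at every basis vector grows to at most K/m at
    \<open>f\<close>. The summand 1 keeps \<open>K\<close> positive.\<close>
  define K where "K = 1 + (\<Sum>f\<in>F. \<Sum>b\<in>B. real_of_int \<bar>c f b\<bar>)"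
  have Kf: "(\<Sum>b\<in>B. real_of_int \<bar>c f b\<bar>) < K" if "f \<in> F" for f
  proof -
    have "(\<Sum>b\<in>B. real_of_int \<bar>c f b\<bar>) \<le> (\<Sum>f\<in>F. \<Sum>b\<in>B. real_of_int \<bar>c f b\<bar>)"
      by (rule member_le_sum[OF that _ F(1)]) (auto intro: sum_nonneg)
    then show ?thesis by (simp add: K_def)
  qed
  have K0: "K > 0"
    unfolding K_def by (intro add_pos_nonneg sum_nonneg) auto
  \<comment> \<open>The bound 1 forces the integer \<open>w f\<close> to be 0 where
    \<open>u f\<close> is; the bounds by the nonzero absolute values keep the approximation from
    changing a sign elsewhere.\<close>
  define \<delta> where "\<delta> = Min (insert 1 ((\<lambda>f. \<bar>u f\<bar>) ` {f \<in> F. u f \<noteq> 0}))"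
  have d0: "\<delta> > 0" unfolding \<delta>_def using F(1) by (subst Min_gr_iff) auto
  have d1: "\<delta> \<le> 1" unfolding \<delta>_def using F(1) by (intro Min_le) auto
  have d2: "\<delta> \<le> \<bar>u f\<bar>" if "f \<in> F" "u f \<noteq> 0" for f
    unfolding \<delta>_def using F(1) that by (intro Min_le) auto
  obtain m :: nat where m: "K / \<delta> < real m" using reals_Archimedean2 by blast
  have m0: "m > 0" using m K0 d0 by (metis divide_pos_pos less_trans of_nat_0_less_iff)
  have Km: "K / real m < \<delta>" using m m0 d0 by (simp add: field_simps)
  obtain q p where q: "0 < q" and p: "\<And>i. i < card B \<Longrightarrow>
      \<bar>of_int q * u (h i) - of_int (p i)\<bar> < 1 / real m"
    using Dirichlet_approx_simult[OF m0, where n="card B" and \<theta>="\<lambda>i. u (h i)"] by metis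
  define g where "g = inv_into {0..<card B} h"
  have hg: "h (g b) = b" and gb: "g b < card B" if "b \<in> B" for b
    using bij_betw_inv_into_right[OF h that] bij_betwE[OF bij_betw_inv_into[OF h]] that
    unfolding g_def by auto
  obtain w where w: "linear w" "\<And>b. b \<in> B \<Longrightarrow> w b = real_of_int (p (g b))"
    using linear_independent_extend[OF B(2), of "\<lambda>b. real_of_int (p (g b))"] by blast
  have wval: "w (\<Sum>b\<in>B. of_int (e b) *\<^sub>R b) = of_int (\<Sum>b\<in>B. e b * p (g b))" for e
    using w by (simp add: linear_sum linear_cmul)
  have wN: "w v \<in> \<int>" if v: "v \<in> N" for v
  proof -
    obtain e :: "'v \<Rightarrow> int" where e: "v = (\<Sum>b\<in>B. of_int (e b) *\<^sub>R b)"
      using v NB by auto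
    show ?thesis unfolding e wval by (rule Ints_of_int)
  qed
  have wM: "w \<in> dual_lattice N"
    using w(1) wN by (simp add: dual_lattice_def)
  have close: "\<bar>of_int q * u f - w f\<bar> < \<delta>" if f: "f \<in> F" for f
  proof -
    have uf: "u f = (\<Sum>b\<in>B. of_int (c f b) * u b)"
      by (subst c[OF f]) (simp add: linear_sum[OF u] linear_cmul[OF u])
    have wf: "w f = (\<Sum>b\<in>B. of_int (c f b) * w b)"
      by (subst c[OF f]) (simp add: linear_sum[OF w(1)] linear_cmul[OF w(1)])
    have "of_int q * u f - w f = (\<Sum>b\<in>B. of_int (c f b) * (of_int q * u b - w b))"
      unfolding uf wf sum_distrib_left sum_subtractf[symmetric]
      by (intro sum.cong) (auto simp: algebra_simps)
    also have "\<bar>\<dots>\<bar> \<le> (\<Sum>b\<in>B. of_int \<bar>c f b\<bar> * (1 / real m))"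
    proof (rule order_trans[OF sum_abs sum_mono])
      fix b assume b: "b \<in> B"
      have "\<bar>of_int q * u b - w b\<bar> \<le> 1 / real m"
        using p[OF gb[OF b]] by (simp add: hg[OF b] w(2)[OF b])
      then show "\<bar>of_int (c f b) * (of_int q * u b - w b)\<bar> \<le> of_int \<bar>c f b\<bar> * (1 / real m)"
        unfolding abs_mult of_int_abs by (intro mult_left_mono) auto
    qed
    also have "\<dots> = (\<Sum>b\<in>B. of_int \<bar>c f b\<bar>) / real m"
      by (simp add: sum_divide_distrib)
    also have "\<dots> \<le> K / real m"
      using Kf[OF f] by (intro divide_right_mono) auto
    finally show ?thesis using Km by linarith
  qed
  have "sgn (w f) = sgn (u f)" if f: "f \<in> F" for f
  proof (cases "u f = 0")
    case True
    have "\<bar>w f\<bar> < 1" using close[OF f] True d1 by simp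
    moreover have "w f \<in> \<int>" using dual_lattice_Ints[OF wM] f F(2) by blast
    ultimately have "w f = 0" using Ints_nonzero_abs_less1 by blast
    then show ?thesis using True by simp
  next
    case False
    have q1: "1 \<le> real_of_int q" using q by linarith
    have "\<delta> \<le> \<bar>u f\<bar>" using d2[OF f False] .
    also have "\<dots> \<le> of_int q * \<bar>u f\<bar>" using q1 mult_right_mono[of 1 "of_int q" "\<bar>u f\<bar>"] by simp
    finally have *: "\<delta> \<le> of_int q * \<bar>u f\<bar>" .
    show ?thesis
    proof (cases "u f > 0")
      case True
      then have "w f > 0" using * close[OF f] by simp
      then show ?thesis using True by simp
    next
      case neg: False
      then have "u f < 0" using False by simp
      then have "w f < 0" using * close[OF f] by simp
      then show ?thesis using \<open>u f < 0\<close> by simp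
    qed
  qed
  then show ?thesis using wM by blast
qed

section \<open>Closure properties of the lattice\<close>

lemma lattice_in_add:
  assumes N: "lattice_in N" and v: "v \<in> N" and w: "w \<in> N"
  shows "v + w \<in> N"
proof -
  obtain B where NB: "N = {\<Sum>b\<in>B. of_int (c b) *\<^sub>R b |c :: 'a \<Rightarrow> int. True}"
    using N unfolding lattice_in_def by blast
  obtain c d :: "'a \<Rightarrow> int" where c: "v = (\<Sum>b\<in>B. of_int (c b) *\<^sub>R b)"
    and d: "w = (\<Sum>b\<in>B. of_int (d b) *\<^sub>R b)" using v w NB by blast
  have "v + w = (\<Sum>b\<in>B. of_int (c b + d b) *\<^sub>R b)"
    unfolding c d by (simp add: sum.distrib scaleR_add_left)
  then show ?thesis unfolding NB mem_Collect_eq by (intro exI[of _ "\<lambda>b. c b + d b"]) simp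
qed

lemma lattice_in_uminus:
  assumes N: "lattice_in N" and v: "v \<in> N"
  shows "- v \<in> N"
proof -
  obtain B where NB: "N = {\<Sum>b\<in>B. of_int (c b) *\<^sub>R b |c :: 'a \<Rightarrow> int. True}"
    using N unfolding lattice_in_def by blast
  obtain c :: "'a \<Rightarrow> int" where c: "v = (\<Sum>b\<in>B. of_int (c b) *\<^sub>R b)"
    using v NB by blast
  have "- v = (\<Sum>b\<in>B. of_int (- c b) *\<^sub>R b)"
    unfolding c by (simp add: sum_negf)
  then show ?thesis unfolding NB mem_Collect_eq by (intro exI[of _ "\<lambda>b. - c b"]) simp
qed

lemma lattice_in_0:
  assumes N: "lattice_in N" shows "0 \<in> N"
proof -
  obtain B where NB: "N = {\<Sum>b\<in>B. of_int (c b) *\<^sub>R b |c :: 'a \<Rightarrow> int. True}"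
    using N unfolding lattice_in_def by blast
  show ?thesis unfolding NB mem_Collect_eq by (intro exI[of _ "\<lambda>_. 0"]) simp
qed

lemma lattice_in_scale:
  assumes N: "lattice_in N" and v: "v \<in> N" shows "real n *\<^sub>R v \<in> N"
  by (induct n) (auto simp: lattice_in_0[OF N] lattice_in_add[OF N v] scaleR_add_left)

lemma lattice_in_sum:
  assumes N: "lattice_in N" and F: "F \<subseteq> N" shows "\<Sum>F \<in> N"
proof (cases "finite F")
  case True
  then show ?thesis using F
    by induct (auto simp: lattice_in_0[OF N] lattice_in_add[OF N])
qed (simp add: lattice_in_0[OF N])

lemma lattice_in_finite_spanning:
  assumes "lattice_in N"
  obtains B where "finite B" "B \<subseteq> N" "span B = UNIV"
proof -
  obtain B where B: "finite B" "span B = UNIV"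
    and NB: "N = {\<Sum>b\<in>B. of_int (c b) *\<^sub>R b |c :: 'a \<Rightarrow> int. True}"
    using assms unfolding lattice_in_def by blast
  have "B \<subseteq> N"
  proof
    fix x assume x: "x \<in> B"
    have "(\<Sum>b\<in>B. of_int (if b = x then 1 else 0) *\<^sub>R b) = x"
      using B(1) x by (simp add: if_distrib[of "\<lambda>z. z *\<^sub>R _"] if_distrib[of of_int] cong: if_cong)
    then show "x \<in> N" unfolding NB mem_Collect_eq 
      by (intro exI[of _ "\<lambda>b. if b = x then 1 else 0"]) simp
  qed
  then show ?thesis using B that by blast
qed

section \<open>Rational polyhedral cones\<close>

text \<open>Makes the witness of \<open>rational_cone\<close> available: linear conditions on the
  cone reduce to finitely many inequalities at lattice vectors.\<close>

definition cone_gens :: "'v::real_vector set \<Rightarrow> 'v set \<Rightarrow> 'v set \<Rightarrow> bool" where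
  "cone_gens N \<sigma> F \<longleftrightarrow>
     finite F \<and> F \<subseteq> N \<and> \<sigma> = {\<Sum>v\<in>F. c v *\<^sub>R v |c. \<forall>v\<in>F. (0::real) \<le> c v}"

lemma cone_gens_sumI:
  assumes "cone_gens N \<sigma> F" "\<And>v. v \<in> F \<Longrightarrow> 0 \<le> c v"
  shows "(\<Sum>v\<in>F. c v *\<^sub>R v) \<in> \<sigma>"
  using assms unfolding cone_gens_def by blast

lemma cone_gens_subset:
  assumes "cone_gens N \<sigma> F" shows "F \<subseteq> \<sigma>"
proof
  fix f assume f: "f \<in> F"
  have fin: "finite F" using assms by (simp add: cone_gens_def)
  have "(\<Sum>v\<in>F. (if v = f then 1 else 0) *\<^sub>R v) \<in> \<sigma>"
    using assms by (rule cone_gens_sumI) simp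
  also have "(\<Sum>v\<in>F. (if v = f then 1 else 0) *\<^sub>R v) = f"
    using fin f by (simp add: if_distrib[of "\<lambda>z. z *\<^sub>R _"] cong: if_cong)
  finally show "f \<in> \<sigma>" .
qed

lemma dual_cone_gens:
  assumes "cone_gens N \<sigma> F"
  shows "dual_cone \<sigma> = {u. linear u \<and> (\<forall>f\<in>F. 0 \<le> u f)}"
proof -
  have "0 \<le> u v" if u: "linear u" "\<forall>f\<in>F. 0 \<le> u f" and v: "v \<in> \<sigma>"
    for u :: "'a \<Rightarrow> real" and v
  proof -
    obtain c where c: "v = (\<Sum>v\<in>F. c v *\<^sub>R v)" "\<forall>v\<in>F. 0 \<le> c v"
      using v assms unfolding cone_gens_def by blast
    show ?thesis unfolding c(1) using u c(2)
      by (auto simp: linear_sum linear_cmul intro!: sum_nonneg mult_nonneg_nonneg)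
  qed
  then show ?thesis using cone_gens_subset[OF assms] by (auto simp: dual_cone_def)
qed

lemma cone_semigroup_gens:
  assumes "cone_gens N \<sigma> F"
  shows "cone_semigroup N \<sigma> = {u \<in> dual_lattice N. \<forall>f\<in>F. 0 \<le> u f}"
  unfolding cone_semigroup_def dual_cone_gens[OF assms] by (auto simp: dual_lattice_def)

lemma fan_gens:
  assumes "fan N \<Delta>" "\<sigma> \<in> \<Delta>"
  obtains F where "cone_gens N \<sigma> F"
proof -
  have "rational_cone N \<sigma>" using assms by (simp add: fan_def)
  then show ?thesis using that unfolding rational_cone_def cone_gens_def by blast
qed

text \<open>Polyhedrality supplies a half-space \<open>c \<le> u\<close> that contains the cone and
  misses \<open>v\<close>. Its constant can be moved to 0, because a negative value of
  \<open>u\<close> on the cone could be scaled below any \<open>c\<close>.\<close>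

lemma polyhedral_cone_separation:
  assumes s: "cone \<sigma>" "polyhedral \<sigma>" "\<sigma> \<noteq> {}" and v: "v \<notin> \<sigma>"
  obtains u where "u \<in> dual_cone \<sigma>" "u v < 0"
proof -
  obtain \<H> where H: "\<forall>H\<in>\<H>. closed_half_space H" "\<sigma> = \<Inter>\<H>"
    using s(2) unfolding polyhedral_def by blast
  obtain H where vH: "H \<in> \<H>" "v \<notin> H" using v H(2) by blast
  have sub: "\<sigma> \<subseteq> H" using vH(1) H(2) by auto
  have "closed_half_space H" using H(1) vH(1) by simp
  then obtain u :: "'a \<Rightarrow> real" and c where "linear u" "H = {v. c \<le> u v}"
    unfolding closed_half_space_def by blast
  then have u: "linear u" "H = {v. c \<le> u v}" "\<sigma> \<subseteq> H" using sub by auto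
  have s0: "0 \<in> \<sigma>" using s(1,3) by (simp add: cone_contains_0)
  have c0: "c \<le> 0" using s0 u by (auto simp: linear_0)
  have "0 \<le> u x" if x: "x \<in> \<sigma>" for x
  proof (rule ccontr)
    assume n: "\<not> 0 \<le> u x"
    \<comment> \<open>The multiple of \<open>x\<close> at which \<open>u\<close> takes the value
      \<open>c - 1\<close>; it is nonnegative because \<open>c \<le> 0\<close> and
      \<open>u x < 0\<close>.\<close>
    define t where "t = (c - 1) / u x"
    have "0 \<le> t" unfolding t_def using n c0 by (intro divide_nonpos_nonpos) auto
    then have "t *\<^sub>R x \<in> \<sigma>" using s(1) x by (simp add: cone_def)
    then have "c \<le> u (t *\<^sub>R x)" using u(2,3) by auto
    also have "\<dots> = c - 1" using n by (simp add: linear_cmul[OF u(1)] t_def)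
    finally show False by simp
  qed
  moreover have "u v < 0" using vH(2) u(2) c0 by auto
  ultimately show ?thesis using u(1) that by (auto simp: dual_cone_def)
qed

lemma fan_cone_nonempty:
  assumes "fan N \<Delta>" "\<sigma> \<in> \<Delta>" shows "0 \<in> \<sigma>"
proof -
  obtain F where F: "cone_gens N \<sigma> F" using fan_gens[OF assms] .
  have "(\<Sum>v\<in>F. 0 *\<^sub>R v) \<in> \<sigma>" by (rule cone_gens_sumI[OF F]) simp
  then show ?thesis by simp
qed

lemma fan_separation:
  assumes "fan N \<Delta>" "\<sigma> \<in> \<Delta>" "v \<notin> \<sigma>"
  obtains u where "u \<in> dual_cone \<sigma>" "u v < 0"
proof -
  have "cone \<sigma>" "polyhedral \<sigma>" "\<sigma> \<noteq> {}"
    using assms(1,2) fan_cone_nonempty[OF assms(1,2)] by (auto simp: fan_def)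
  then show ?thesis using polyhedral_cone_separation[OF _ _ _ assms(3)] that by blast
qed

text \<open>A separating functional is real at first. Replacing it by an integral one with the same
  signs on the generators and on \<open>v\<close> preserves both membership in the dual cone and the
  separation.\<close>

lemma mem_cone_if_semigroup_nonneg:
  assumes N: "lattice_in N" and fan: "fan N \<Delta>" "\<sigma> \<in> \<Delta>" and v: "v \<in> N"
    and nonneg: "\<And>u. u \<in> cone_semigroup N \<sigma> \<Longrightarrow> 0 \<le> u v"
  shows "v \<in> \<sigma>"
proof (rule ccontr)
  assume "v \<notin> \<sigma>"
  then obtain u where u: "u \<in> dual_cone \<sigma>" "u v < 0" using fan_separation[OF fan] by blast
  obtain F where F: "cone_gens N \<sigma> F" using fan_gens[OF fan] .
  have "linear u" "finite (insert v F)" "insert v F \<subseteq> N"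
    using u(1) F v by (auto simp: dual_cone_def cone_gens_def)
  then obtain w where w: "w \<in> dual_lattice N" "\<forall>f\<in>insert v F. sgn (w f) = sgn (u f)"
    using ex_dual_lattice_same_signs[OF N] by blast
  have "0 \<le> w f" if "f \<in> F" for f
  proof -
    have "0 \<le> sgn (u f)" using u(1) that by (simp add: dual_cone_gens[OF F])
    then show ?thesis using w(2) that by (metis insertCI zero_le_sgn_iff)
  qed
  then have "w \<in> cone_semigroup N \<sigma>" using w(1) by (simp add: cone_semigroup_gens[OF F])
  moreover have "w v < 0" using w(2) u(2) by (metis insertCI sgn_less)
  ultimately show False using nonneg by fastforce
qed

text \<open>The sum of the generators is a relative interior point: a functional that is nonnegative
  on the generators and vanishes at their sum vanishes at each of them, hence on the whole
  cone.\<close>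

lemma face_contains_interior:
  assumes F: "cone_gens N \<sigma> F" and face: "face_of_cone \<tau> \<sigma>" and v: "\<Sum>F \<in> \<tau>"
  shows "\<tau> = \<sigma>"
proof -
  obtain u where u: "u \<in> dual_cone \<sigma>" "\<tau> = \<sigma> \<inter> {v. u v = 0}"
    using face unfolding face_of_cone_def by blast
  have lin: "linear u" and nn: "\<forall>f\<in>F. 0 \<le> u f" using u(1) by (auto simp: dual_cone_gens[OF F])
  have fin: "finite F" using F by (simp add: cone_gens_def)
  have "(\<Sum>f\<in>F. u f) = 0" using v u(2) by (simp add: linear_sum[OF lin, symmetric])
  then have z: "u f = 0" if "f \<in> F" for f
    using sum_nonneg_eq_0_iff[OF fin] nn that by auto
  have "u x = 0" if x: "x \<in> \<sigma>" for x
  proof -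
    obtain c where "x = (\<Sum>v\<in>F. c v *\<^sub>R v)"
      using x F unfolding cone_gens_def by blast
    then show ?thesis using z by (simp add: linear_sum[OF lin] linear_cmul[OF lin])
  qed
  then show ?thesis using u(2) by blast
qed

text \<open>Strong convexity excludes \<open>- f\<close> for each nonzero generator
  \<open>f\<close>, so some element of the dual cone is positive at \<open>f\<close>; the sum of
  these elements vanishes on the cone only at 0. This is what puts the cone of the torus into the
  fan.\<close>

lemma zero_face:
  assumes fan: "fan N \<Delta>" "\<sigma> \<in> \<Delta>" shows "face_of_cone {0} \<sigma>"
proof -
  obtain F where F: "cone_gens N \<sigma> F" using fan_gens[OF fan] .
  have fin: "finite F" using F by (simp add: cone_gens_def)
  have co: "cone \<sigma>" "strongly_convex \<sigma>" using fan by (auto simp: fan_def)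
  have "\<exists>u\<in>dual_cone \<sigma>. 0 < u f" if f: "f \<in> F" "f \<noteq> 0" for f
  proof -
    have fs: "f \<in> \<sigma>" using cone_gens_subset[OF F] f by blast
    have "- f \<notin> \<sigma>"
    proof
      assume m: "- f \<in> \<sigma>"
      have "0 + t *\<^sub>R f \<in> \<sigma>" for t
      proof (cases "0 \<le> t")
        case True
        then show ?thesis using co(1) fs by (simp add: cone_def)
      next
        case False
        then have "\<bar>t\<bar> *\<^sub>R (- f) \<in> \<sigma>" using co(1) m mem_cone[of \<sigma> "- f" "\<bar>t\<bar>"] by simp
        then show ?thesis using False by simp
      qed
      then show False using co(2) f(2) unfolding strongly_convex_def by blast
    qed
    then obtain u where u: "u \<in> dual_cone \<sigma>" "u (- f) < 0" using fan_separation[OF fan] by blast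
    then have "linear u" by (simp add: dual_cone_def)
    then show ?thesis using u by (intro bexI[of _ u]) (auto simp: linear_neg)
  qed
  then obtain g where g: "\<And>f. f \<in> F \<Longrightarrow> f \<noteq> 0 \<Longrightarrow> g f \<in> dual_cone \<sigma> \<and> 0 < g f f" by metis
  define u where "u = (\<lambda>v. \<Sum>f\<in>F-{0}. g f v)"
  have lin: "linear u" unfolding u_def
    using g by (intro linear_compose_sum) (auto simp: dual_cone_def)
  have unn: "0 \<le> u v" if "v \<in> \<sigma>" for v
    unfolding u_def using g that by (intro sum_nonneg) (auto simp: dual_cone_def)
  have upos: "0 < u f" if f: "f \<in> F" "f \<noteq> 0" for f
  proof -
    have "0 < g f f" using g f by blast
    also have "g f f \<le> u f" unfolding u_def
      using g f fin cone_gens_subset[OF F]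
      by (intro member_le_sum[where f="\<lambda>h. g h f"]) (auto simp: dual_cone_def)
    finally show ?thesis .
  qed
  have "v = 0" if v: "v \<in> \<sigma>" "u v = 0" for v
  proof -
    obtain c where c: "v = (\<Sum>v\<in>F. c v *\<^sub>R v)" "\<forall>v\<in>F. 0 \<le> c v"
      using v F unfolding cone_gens_def by blast
    have "(\<Sum>f\<in>F. c f * u f) = 0"
      using v(2) unfolding c(1) by (simp add: linear_sum[OF lin] linear_cmul[OF lin])
    then have "c f * u f = 0" if "f \<in> F" for f
      using sum_nonneg_eq_0_iff[OF fin, of "\<lambda>f. c f * u f"] c(2) unn cone_gens_subset[OF F] that
      by (simp add: subset_iff)
    then have "c f *\<^sub>R f = 0" if "f \<in> F" for f using upos that by fastforce
    then show ?thesis unfolding c(1) by (intro sum.neutral) simp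
  qed
  moreover have "u 0 = 0" using lin by (rule linear_0)
  ultimately have "{0} = \<sigma> \<inter> {v. u v = 0}" using fan_cone_nonempty[OF fan] by blast
  then show ?thesis unfolding face_of_cone_def dual_cone_def using lin unn by blast
qed

lemma zero_cone_in_fan:
  assumes fan: "fan N \<Delta>" shows "{0} \<in> \<Delta>"
  using assms zero_face[OF fan] unfolding fan_def by blast

lemma fan_Int:
  assumes "fan N \<Delta>" "\<sigma> \<in> \<Delta>" "\<tau> \<in> \<Delta>"
  shows "\<sigma> \<inter> \<tau> \<in> \<Delta>" "face_of_cone (\<sigma> \<inter> \<tau>) \<sigma>" "face_of_cone (\<sigma> \<inter> \<tau>) \<tau>"
  using assms unfolding fan_def by blast+

section \<open>Semigroups of cones and their localization at faces\<close>

lemma cone_semigroup_mono: "\<tau> \<subseteq> \<sigma> \<Longrightarrow> cone_semigroup N \<sigma> \<subseteq> cone_semigroup N \<tau>"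
  by (auto simp: cone_semigroup_def dual_cone_def)

lemma cone_semigroup_0: "0 \<in> cone_semigroup N \<sigma>"
  using dual_lattice_0[of N] by (auto simp: cone_semigroup_def dual_cone_def dual_lattice_linear)

lemma cone_semigroup_add:
  "u \<in> cone_semigroup N \<sigma> \<Longrightarrow> w \<in> cone_semigroup N \<sigma> \<Longrightarrow> u + w \<in> cone_semigroup N \<sigma>"
  using dual_lattice_add[of u N w]
  by (auto simp: cone_semigroup_def dual_cone_def dual_lattice_linear)

lemma cone_semigroup_zero_cone: "cone_semigroup N {0} = dual_lattice N"
  by (auto simp: cone_semigroup_def dual_cone_def dual_lattice_def linear_0)

text \<open>A nonnegative functional vanishes at a nonnegative combination of generators iff every
  term vanishes, so its zero set on the cone depends only on its signs at the generators. An
  integral functional can therefore replace the real one.\<close>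

lemma face_integral_functional:
  assumes N: "lattice_in N" and fan: "fan N \<Delta>" "\<sigma> \<in> \<Delta>" and face: "face_of_cone \<tau> \<sigma>"
  obtains u where "u \<in> cone_semigroup N \<sigma>" "\<tau> = \<sigma> \<inter> {v. u v = 0}"
proof -
  obtain u where u: "u \<in> dual_cone \<sigma>" "\<tau> = \<sigma> \<inter> {v. u v = 0}"
    using face unfolding face_of_cone_def by blast
  obtain F where F: "cone_gens N \<sigma> F" using fan_gens[OF fan] .
  have FN: "finite F" "F \<subseteq> N" using F by (auto simp: cone_gens_def)
  have lin: "linear u" using u(1) by (simp add: dual_cone_def)
  obtain w where w: "w \<in> dual_lattice N" "\<forall>f\<in>F. sgn (w f) = sgn (u f)"
    using ex_dual_lattice_same_signs[OF N lin FN] by blast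
  have linw: "linear w" using w(1) by (rule dual_lattice_linear)
  have un: "0 \<le> u f" if "f \<in> F" for f using u(1) that by (simp add: dual_cone_gens[OF F])
  have wn: "0 \<le> w f" if "f \<in> F" for f
    using un[OF that] w(2) that by (metis zero_le_sgn_iff)
  have "w x = 0 \<longleftrightarrow> u x = 0" if x: "x \<in> \<sigma>" for x
  proof -
    obtain c where c: "x = (\<Sum>v\<in>F. c v *\<^sub>R v)" "\<forall>v\<in>F. 0 \<le> c v"
      using x F unfolding cone_gens_def by blast
    have "w x = 0 \<longleftrightarrow> (\<forall>f\<in>F. c f * w f = 0)"
      unfolding c(1) using c(2) wn
      by (simp add: linear_sum[OF linw] linear_cmul[OF linw] sum_nonneg_eq_0_iff[OF FN(1)])
    also have "\<dots> \<longleftrightarrow> (\<forall>f\<in>F. c f * u f = 0)"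
      using w(2) by (metis mult_eq_0_iff sgn_0_0)
    also have "\<dots> \<longleftrightarrow> u x = 0"
      unfolding c(1) using c(2) un
      by (simp add: linear_sum[OF lin] linear_cmul[OF lin] sum_nonneg_eq_0_iff[OF FN(1)])
    finally show ?thesis .
  qed
  then have "\<tau> = \<sigma> \<inter> {v. w v = 0}" using u(2) by blast
  moreover have "w \<in> cone_semigroup N \<sigma>" using w(1) wn by (simp add: cone_semigroup_gens[OF F])
  ultimately show ?thesis using that by blast
qed

lemma cone_semigroup_of_nat_mult:
  "u \<in> cone_semigroup N \<sigma> \<Longrightarrow> of_nat n * u \<in> cone_semigroup N \<sigma>"
  by (induct n) (auto simp: distrib_right cone_semigroup_0 cone_semigroup_add)

text \<open>On generators where \<open>u\<close> vanishes, \<open>w\<close> is nonnegative already;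
  on the others \<open>u\<close> is positive and a large multiple of it outweighs \<open>w\<close>.
  Geometrically, the chart of the face is the locus of \<open>\<chi>\<^sup>u\<close> in the chart of
  the cone.\<close>

lemma face_semigroup_localization:
  assumes F: "cone_gens N \<sigma> F" and u: "u \<in> cone_semigroup N \<sigma>"
    and w: "w \<in> cone_semigroup N (\<sigma> \<inter> {v. u v = 0})"
  shows "\<exists>n. w + of_nat n * u \<in> cone_semigroup N \<sigma>"
proof -
  have fin: "finite F" using F by (simp add: cone_gens_def)
  have uF: "0 \<le> u f" if "f \<in> F" for f using u that by (simp add: cone_semigroup_gens[OF F])
  have "\<exists>n. - w f \<le> real n * u f" if f: "f \<in> F" for f
  proof (cases "u f = 0")
    case True
    then have "0 \<le> w f" using w f cone_gens_subset[OF F]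
      by (auto simp: cone_semigroup_def dual_cone_def)
    then show ?thesis using True by simp
  next
    case False
    obtain n :: nat where "- w f / u f \<le> real n" using real_arch_simple by blast
    then show ?thesis using False uF[OF f] by (intro exI[of _ n]) (simp add: field_simps)
  qed
  then obtain n where n: "\<And>f. f \<in> F \<Longrightarrow> - w f \<le> real (n f) * u f" by metis
  define m where "m = (\<Sum>f\<in>F. n f)"
  have "0 \<le> (w + of_nat m * u) f" if f: "f \<in> F" for f
  proof -
    have "real (n f) * u f \<le> real m * u f"
      unfolding m_def using member_le_sum[OF f _ fin, of n] uF[OF f]
      by (intro mult_right_mono) (auto simp del: of_nat_sum)
    then show ?thesis using n[OF f] by simp
  qed
  moreover have "w + of_nat m * u \<in> dual_lattice N"
    using w cone_semigroup_of_nat_mult[OF u, of m]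
    by (auto simp: cone_semigroup_def intro: dual_lattice_add)
  ultimately show ?thesis by (auto simp: cone_semigroup_gens[OF F])
qed

section \<open>Gordan's lemma\<close>

lemma nat_seq_mono_subseq:
  fixes x :: "nat \<Rightarrow> nat"
  obtains r :: "nat \<Rightarrow> nat" where "strict_mono r" "mono (\<lambda>n. x (r n))"
proof -
  obtain f where f: "strict_mono f" "monoseq (\<lambda>n. x (f n))" using seq_monosub[of x] by blast
  show ?thesis
  proof (cases "\<forall>m n. m \<le> n \<longrightarrow> x (f m) \<le> x (f n)")
    case True
    then show ?thesis using f(1) by (intro that[of f]) (auto simp: mono_def)
  next
    case False
    then have dec: "x (f n) \<le> x (f m)" if "m \<le> n" for m n
      using f(2) that unfolding monoseq_def by blast
    \<comment> \<open>A nonincreasing sequence of natural numbers is constant from an index where it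
      attains its minimum.\<close>
    define k where "k = (ARG_MIN (\<lambda>n. x (f n)) n. True)"
    have k: "x (f k) \<le> x (f n)" for n
      unfolding k_def by (rule arg_min_nat_le) simp
    have "x (f (k + n)) = x (f k)" for n
      using dec[of k "k + n"] k[of "k + n"] by simp
    then have "mono (\<lambda>n. x (f (k + n)))" by (simp add: mono_def)
    moreover have "strict_mono (\<lambda>n. f (k + n))"
      using f(1) by (simp add: strict_mono_def)
    ultimately show ?thesis by (rule that[rotated])
  qed
qed

text \<open>Dickson's lemma for sequences: the subsequence is refined one coordinate at a time, and
  monotonicity already reached survives each refinement.\<close>

lemma dickson_subseq:
  fixes a :: "nat \<Rightarrow> 'i \<Rightarrow> nat"
  assumes "finite I"
  shows "\<exists>r :: nat \<Rightarrow> nat. strict_mono r \<and> (\<forall>i\<in>I. mono (\<lambda>n. a (r n) i))"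
  using assms
proof (induct I)
  case empty
  then show ?case using strict_mono_id by blast
next
  case (insert j I)
  then obtain r :: "nat \<Rightarrow> nat" where r: "strict_mono r" "\<forall>i\<in>I. mono (\<lambda>n. a (r n) i)" by blast
  obtain q :: "nat \<Rightarrow> nat" where q: "strict_mono q" "mono (\<lambda>n. a (r (q n)) j)"
    using nat_seq_mono_subseq[of "\<lambda>n. a (r n) j"] by blast
  have "strict_mono (\<lambda>n. r (q n))"
    using r(1) q(1) by (simp add: strict_mono_def)
  moreover have "mono (\<lambda>n. a (r (q n)) i)" if "i \<in> I" for i
    using r(2) that strict_mono_mono[OF q(1)] by (auto simp: mono_def)
  ultimately show ?case using q(2) by blast
qed

inductive_set monoid_span :: "'a::comm_monoid_add set \<Rightarrow> 'a set" for G where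
  zero: "0 \<in> monoid_span G"
| add: "g \<in> G \<Longrightarrow> a \<in> monoid_span G \<Longrightarrow> g + a \<in> monoid_span G"

lemma monoid_span_mono: "G \<subseteq> H \<Longrightarrow> monoid_span G \<subseteq> monoid_span H"
proof
  fix x assume "G \<subseteq> H" and "x \<in> monoid_span G"
  from this(2,1) show "x \<in> monoid_span H"
    by induct (auto intro: monoid_span.intros)
qed

text \<open>As \<open>D\<close> spans, evaluation on \<open>D\<close> embeds \<open>P\<close> into
  the vectors of natural numbers indexed by \<open>D\<close>, and \<open>P\<close> is closed under
  differences of comparable elements. \<open>G\<close> consists of the minimal nonzero elements;
  they are pairwise incomparable, hence finitely many by Dickson's lemma, and subtracting them
  reduces every element to 0.\<close>

lemma spanning_semigroup_fg:
  fixes N D :: "'v::real_vector set"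
  assumes D: "finite D" "D \<subseteq> N" "span D = UNIV"
  defines "P \<equiv> {u \<in> dual_lattice N. \<forall>d\<in>D. 0 \<le> u d}"
  shows "\<exists>G. finite G \<and> G \<subseteq> P \<and> P \<subseteq> monoid_span G"
proof -
  define G where "G = {g \<in> P. g \<noteq> 0 \<and> (\<forall>h\<in>P. h \<noteq> 0 \<longrightarrow> (\<forall>d\<in>D. h d \<le> g d) \<longrightarrow> h = g)}"
  have coord: "u d = real (nat \<lfloor>u d\<rfloor>)" if "u \<in> P" "d \<in> D" for u d
  proof -
    have "u d \<in> \<int>" "0 \<le> u d" using that D(2) by (auto simp: P_def dual_lattice_def)
    then show ?thesis by (auto elim!: Ints_cases)
  qed
  have ext: "u = w" if uw: "u \<in> P" "w \<in> P" "\<And>d. d \<in> D \<Longrightarrow> u d = w d" for u w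
  proof
    fix x
    have "linear u" "linear w" using uw by (auto simp: P_def dual_lattice_def)
    then show "u x = w x" using linear_eq_on_span[of u w D x] uw(3) D(3) by auto
  qed
  have P0: "0 \<in> P" by (simp add: P_def dual_lattice_0)
  have diff: "u - h \<in> P" if "u \<in> P" "h \<in> P" "\<And>d. d \<in> D \<Longrightarrow> h d \<le> u d" for u h
    using that by (auto simp: P_def dual_lattice_diff)
  have "finite G"
  proof (rule ccontr)
    assume "infinite G"
    then obtain x :: "nat \<Rightarrow> 'v \<Rightarrow> real" where x: "inj x" "range x \<subseteq> G"
      using infinite_countable_subset by blast
    obtain r :: "nat \<Rightarrow> nat" where r: "strict_mono r" "\<forall>d\<in>D. mono (\<lambda>n. nat \<lfloor>x (r n) d\<rfloor>)"
      using dickson_subseq[OF D(1), of "\<lambda>n d. nat \<lfloor>x n d\<rfloor>"] by blast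
    have xG: "x n \<in> G" for n using x(2) by blast
    have xP: "x n \<in> P" for n using xG[of n] by (simp add: G_def)
    have "x (r 0) d \<le> x (r 1) d" if "d \<in> D" for d
    proof -
      have "nat \<lfloor>x (r 0) d\<rfloor> \<le> nat \<lfloor>x (r 1) d\<rfloor>"
        using r(2) that by (auto simp: mono_def)
      then show ?thesis using coord[OF xP that] by (metis of_nat_le_iff)
    qed
    then have "x (r 0) = x (r 1)"
      using xG[of "r 1"] xG[of "r 0"] unfolding G_def by blast
    then have "r 0 = r 1" using x(1) by (simp add: inj_eq)
    then show False using r(1) by (metis strict_mono_eq zero_neq_one)
  qed
  moreover have "G \<subseteq> P" by (auto simp: G_def)
  moreover have "u \<in> monoid_span G" if "u \<in> P" for u
  proof -
    \<comment> \<open>The total of the values serves twice: a nonzero element below \<open>u\<close>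
      of least total is minimal, and subtracting it lowers the total, so that the induction
      terminates.\<close>
    define s where "s = (\<lambda>u :: 'v \<Rightarrow> real. \<Sum>d\<in>D. nat \<lfloor>u d\<rfloor>)"
    have s_real: "real (s u) = (\<Sum>d\<in>D. u d)" if "u \<in> P" for u
      unfolding s_def of_nat_sum using coord[OF that] by (intro sum.cong) auto
    have s_eq: "h = g" if hg: "h \<in> P" "g \<in> P" "\<And>d. d \<in> D \<Longrightarrow> h d \<le> g d" "s g \<le> s h" for h g
    proof -
      have "(\<Sum>d\<in>D. g d - h d) \<le> 0"
        using hg(4) s_real[OF hg(1)] s_real[OF hg(2)] by (simp add: sum_subtractf)
      then have "(\<Sum>d\<in>D. g d - h d) = 0"
        using hg(3) by (intro antisym sum_nonneg) auto
      then have "\<forall>d\<in>D. g d - h d = 0"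
        using hg(3) by (subst (asm) sum_nonneg_eq_0_iff[OF D(1)]) auto
      then show ?thesis using ext[OF hg(1,2)] by simp
    qed
    from that show ?thesis
    proof (induct "s u" arbitrary: u rule: less_induct)
      case less
      show ?case
      proof (cases "u = 0")
        case True
        then show ?thesis by (simp add: monoid_span.zero)
      next
        case False
        define Q where "Q = (\<lambda>h. h \<in> P \<and> h \<noteq> 0 \<and> (\<forall>d\<in>D. h d \<le> u d))"
        define h where "h = arg_min s Q"
        have Qu: "Q u" using False less.prems by (simp add: Q_def)
        have Qh: "Q h" unfolding h_def by (rule arg_min_natI[of Q, OF Qu])
        have min: "s h \<le> s k" if "Q k" for k
          unfolding h_def by (rule arg_min_nat_le[of Q, OF that])
        have hP: "h \<in> P" "h \<noteq> 0" "\<And>d. d \<in> D \<Longrightarrow> h d \<le> u d" using Qh by (auto simp: Q_def)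
        have hG: "h \<in> G"
          unfolding G_def
        proof (safe intro!: hP(1) hP(2))
          fix k assume k: "k \<in> P" "k \<noteq> 0" "\<forall>d\<in>D. k d \<le> h d"
          then have "Q k" using hP(3) by (force simp: Q_def)
          then show "k = h" using min s_eq[OF k(1) hP(1)] k(3) by blast
        qed
        have uh: "u - h \<in> P" using diff[OF less.prems hP(1)] hP(3) by blast
        have "s h \<noteq> 0"
        proof
          assume "s h = 0"
          then have "0 = h" using P0 hP(1) s_eq[of 0 h] by (simp add: P_def)
          then show False using hP(2) by simp
        qed
        moreover have "real (s (u - h)) = real (s u) - real (s h)"
          using s_real[OF uh] s_real[OF less.prems] s_real[OF hP(1)] by (simp add: sum_subtractf)
        ultimately have "s (u - h) < s u" by linarith
        then have "h + (u - h) \<in> monoid_span G"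
          using less.hyps[of "u - h"] uh hG by (intro monoid_span.add) auto
        then show ?thesis by simp
      qed
    qed
  qed
  ultimately show ?thesis by blast
qed

text \<open>
  The semigroup is cut into finitely many pieces by the signs of the values on a spanning set of
  lattice vectors; on each piece the functionals are determined by nonnegative integral values.
\<close>

lemma gordan:
  assumes N: "lattice_in N" and F: "cone_gens N \<sigma> F"
  shows "\<exists>G. finite G \<and> G \<subseteq> cone_semigroup N \<sigma> \<and> cone_semigroup N \<sigma> \<subseteq> monoid_span G"
proof -
  obtain B where B: "finite B" "B \<subseteq> N" "span B = UNIV"
    using lattice_in_finite_spanning[OF N] .
  \<comment> \<open>\<open>E\<close> lists the members of \<open>B\<close> on which a functional is
    required to be nonnegative; on the rest it is required to be nonpositive. In both cases the
    enlarged set still spans.\<close>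
  define D where "D = (\<lambda>E. F \<union> E \<union> uminus ` (B - E))"
  have fin: "finite (D E)" and DN: "D E \<subseteq> N" if "E \<subseteq> B" for E
    using that F B lattice_in_uminus[OF N] finite_subset[OF that B(1)]
    by (auto simp: D_def cone_gens_def)
  have sp: "span (D E) = UNIV" if "E \<subseteq> B" for E
  proof -
    have "b \<in> span (D E)" if "b \<in> B" for b
    proof (cases "b \<in> E")
      case True
      then show ?thesis by (auto simp: D_def intro: span_base)
    next
      case False
      then have "- b \<in> span (D E)" using that by (auto simp: D_def intro: span_base)
      then have "- (- b) \<in> span (D E)" by (rule span_neg)
      then show ?thesis by simp
    qed
    then show ?thesis using B(3) by (metis span_mono span_span subsetI top.extremum_uniqueI)
  qed
  define P where "P = (\<lambda>E. {u \<in> dual_lattice N. \<forall>d\<in>D E. 0 \<le> u d})"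
  have "\<forall>E\<in>Pow B. \<exists>G. finite G \<and> G \<subseteq> P E \<and> P E \<subseteq> monoid_span G"
    using spanning_semigroup_fg[OF fin DN sp] unfolding P_def by blast
  then obtain G where G: "\<And>E. E \<subseteq> B \<Longrightarrow> finite (G E) \<and> G E \<subseteq> P E \<and> P E \<subseteq> monoid_span (G E)"
    by (metis Pow_iff)
  define H where "H = (\<Union>E\<in>Pow B. G E)"
  have "finite H" unfolding H_def
  proof (rule finite_UN_I)
    show "finite (Pow B)" using B(1) by simp
    show "finite (G E)" if "E \<in> Pow B" for E using G that by blast
  qed
  moreover have "H \<subseteq> cone_semigroup N \<sigma>"
  proof
    fix g assume "g \<in> H"
    then obtain E where "E \<subseteq> B" "g \<in> G E" by (auto simp: H_def)
    then have "g \<in> P E" using G by blast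
    then show "g \<in> cone_semigroup N \<sigma>" by (auto simp: cone_semigroup_gens[OF F] P_def D_def)
  qed
  moreover have "u \<in> monoid_span H" if u: "u \<in> cone_semigroup N \<sigma>" for u
  proof -
    define E where "E = {b \<in> B. 0 \<le> u b}"
    have "u \<in> P E"
      using u by (auto simp: P_def D_def E_def cone_semigroup_gens[OF F] dual_lattice_linear linear_neg)
    moreover have "E \<subseteq> B" by (auto simp: E_def)
    ultimately have "u \<in> monoid_span (G E)" "G E \<subseteq> H"
      using G[of E] unfolding H_def by blast+
    then show ?thesis using monoid_span_mono by blast
  qed
  ultimately show ?thesis by blast
qed

section \<open>Extension of homomorphisms and the Nullstellensatz\<close>

text \<open>Subrings are subsets of one type, so that adjoining elements can be iterated and the
  results compared. Closure under differences also yields 0, negatives and sums.\<close>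

definition sub_ring :: "'a::comm_ring_1 set \<Rightarrow> bool" where
  "sub_ring A \<longleftrightarrow> 1 \<in> A \<and> (\<forall>x\<in>A. \<forall>y\<in>A. x - y \<in> A \<and> x * y \<in> A)"

lemma sub_ring_closed:
  assumes "sub_ring A"
  shows sub_ring_0: "0 \<in> A" and sub_ring_1: "1 \<in> A"
    and sub_ring_diff: "x \<in> A \<Longrightarrow> y \<in> A \<Longrightarrow> x - y \<in> A"
    and sub_ring_mult: "x \<in> A \<Longrightarrow> y \<in> A \<Longrightarrow> x * y \<in> A"
    and sub_ring_uminus: "x \<in> A \<Longrightarrow> - x \<in> A"
    and sub_ring_add: "x \<in> A \<Longrightarrow> y \<in> A \<Longrightarrow> x + y \<in> A"
proof -
  show z: "0 \<in> A" using assms unfolding sub_ring_def by (metis diff_self)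
  show "1 \<in> A" using assms by (simp add: sub_ring_def)
  show d: "x - y \<in> A" if "x \<in> A" "y \<in> A" for x y using assms that by (simp add: sub_ring_def)
  show "x * y \<in> A" if "x \<in> A" "y \<in> A" for x y using assms that by (simp add: sub_ring_def)
  show u: "- x \<in> A" if "x \<in> A" for x using d[OF z that] by simp
  show "x + y \<in> A" if "x \<in> A" "y \<in> A" for x y using d[OF that(1) u[OF that(2)]] by simp
qed

lemma sub_ring_sum:
  assumes "sub_ring A" "\<And>i. i \<in> I \<Longrightarrow> f i \<in> A" shows "sum f I \<in> A"
  using assms(2)
  by (induct I rule: infinite_finite_induct)
    (auto simp: sub_ring_0[OF assms(1)] sub_ring_add[OF assms(1)])

lemma sub_ring_power:
  assumes "sub_ring A" "x \<in> A" shows "x ^ n \<in> A"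
  using assms by (induct n) (auto simp: sub_ring_closed)

definition polys_over :: "'a::comm_ring_1 set \<Rightarrow> 'a poly set" where
  "polys_over A = {p. \<forall>i. coeff p i \<in> A}"

definition adjoin :: "'a::comm_ring_1 set \<Rightarrow> 'a \<Rightarrow> 'a set" where
  "adjoin A x = (\<lambda>p. poly p x) ` polys_over A"

context
  fixes A :: "'a::comm_ring_1 set"
  assumes A: "sub_ring A"
begin

lemma polys_over_add: "p \<in> polys_over A \<Longrightarrow> q \<in> polys_over A \<Longrightarrow> p + q \<in> polys_over A"
  by (simp add: polys_over_def sub_ring_add[OF A])

lemma polys_over_diff: "p \<in> polys_over A \<Longrightarrow> q \<in> polys_over A \<Longrightarrow> p - q \<in> polys_over A"
  by (simp add: polys_over_def sub_ring_diff[OF A])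

lemma polys_over_mult: "p \<in> polys_over A \<Longrightarrow> q \<in> polys_over A \<Longrightarrow> p * q \<in> polys_over A"
  by (auto simp: polys_over_def coeff_mult intro!: sub_ring_sum[OF A] sub_ring_mult[OF A])

lemma polys_over_monom: "a \<in> A \<Longrightarrow> monom a n \<in> polys_over A"
  by (simp add: polys_over_def sub_ring_0[OF A])

lemma polys_over_const: "a \<in> A \<Longrightarrow> [:a:] \<in> polys_over A"
  using polys_over_monom[of a 0] by (simp add: monom_0)

lemma polys_over_smult: "a \<in> A \<Longrightarrow> p \<in> polys_over A \<Longrightarrow> smult a p \<in> polys_over A"
  by (simp add: polys_over_def sub_ring_mult[OF A])

lemma polys_over_0: "0 \<in> polys_over A"
  by (simp add: polys_over_def sub_ring_0[OF A])

lemma adjoinI: "p \<in> polys_over A \<Longrightarrow> poly p x \<in> adjoin A x"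
  by (simp add: adjoin_def)

lemma sub_ring_adjoin: "sub_ring (adjoin A x)"
  unfolding sub_ring_def
proof (intro conjI ballI)
  show "1 \<in> adjoin A x" using adjoinI[OF polys_over_const[OF sub_ring_1[OF A]]] by simp
  fix y z assume "y \<in> adjoin A x" "z \<in> adjoin A x"
  then obtain p q where "p \<in> polys_over A" "q \<in> polys_over A" "y = poly p x" "z = poly q x"
    by (auto simp: adjoin_def)
  then show "y - z \<in> adjoin A x" "y * z \<in> adjoin A x"
    using adjoinI[OF polys_over_diff, of p q x] adjoinI[OF polys_over_mult, of p q x] by simp_all
qed

lemma subset_adjoin: "A \<subseteq> adjoin A x"
proof
  fix a assume "a \<in> A"
  then show "a \<in> adjoin A x" using adjoinI[OF polys_over_const, of a x] by simp
qed

lemma mem_adjoin: "x \<in> adjoin A x"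
  using adjoinI[OF polys_over_monom[OF sub_ring_1[OF A], of 1], of x] by (simp add: poly_monom)

lemma poly_mem:
  assumes C: "sub_ring C" "A \<subseteq> C" "x \<in> C" and p: "p \<in> polys_over A"
  shows "poly p x \<in> C"
proof -
  have "coeff p i \<in> C" for i using p C(2) unfolding polys_over_def by blast
  then show ?thesis unfolding poly_altdef
    by (intro sub_ring_sum[OF C(1)] sub_ring_mult[OF C(1)] sub_ring_power[OF C(1) C(3)])
qed

lemma adjoin_subset:
  assumes "sub_ring C" "A \<subseteq> C" "x \<in> C" shows "adjoin A x \<subseteq> C"
  using poly_mem[OF assms] by (auto simp: adjoin_def)

text \<open>
  The coefficient ring need not be a domain, so the library's pseudo-division does not apply.
\<close>

lemma pseudo_division:
  assumes g: "g \<in> polys_over A" "0 < degree g" and p: "p \<in> polys_over A"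
  shows "\<exists>n. \<exists>q\<in>polys_over A. \<exists>r\<in>polys_over A.
           smult (lead_coeff g ^ n) p = q * g + r \<and> degree r < degree g \<and>
           degree q \<le> degree p - degree g"
  using p
proof (induct "degree p" arbitrary: p rule: less_induct)
  case less
  define a e where "a = lead_coeff g" and "e = degree g"
  have aA: "a \<in> A" using g(1) by (simp add: a_def polys_over_def)
  show ?case
  proof (cases "degree p < e")
    case True
    show ?thesis
      using less.prems True polys_over_0
      by (intro exI[of _ 0] bexI[of _ 0] bexI[of _ p]) (auto simp: e_def)
  next
    case False
    define k where "k = degree p - e"
    have dp: "degree p = k + e" "0 < degree p" using False g(2) by (auto simp: k_def e_def)
    define t where "t = monom (lead_coeff p) k"
    define p' where "p' = smult a p - t * g"
    have tP: "t \<in> polys_over A"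
      unfolding t_def using less.prems by (intro polys_over_monom) (simp add: polys_over_def)
    have p'P: "p' \<in> polys_over A"
      unfolding p'_def using tP g(1) less.prems aA
      by (intro polys_over_diff polys_over_mult polys_over_smult)
    have "degree (t * g) \<le> degree p"
      using degree_mult_le[of t g] degree_monom_le[of "lead_coeff p" k]
      by (simp add: t_def dp(1) e_def)
    then have "degree p' \<le> degree p"
      unfolding p'_def by (intro degree_diff_le) (auto intro: degree_smult_le)
    moreover have "coeff p' (degree p) = 0"
      by (simp add: p'_def t_def dp(1) coeff_monom_mult a_def e_def mult.commute[of "lead_coeff g"])
    ultimately have deg: "degree p' < degree p"
      using dp(2) by (metis leading_coeff_0_iff degree_0 order.not_eq_order_implies_strict)
    obtain n q r where IH: "q \<in> polys_over A" "r \<in> polys_over A"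
      "smult (a ^ n) p' = q * g + r" "degree r < e" "degree q \<le> degree p' - e"
      using less.hyps[OF deg p'P] unfolding a_def e_def by blast
    define q' where "q' = q + smult (a ^ n) t"
    have "smult (a ^ Suc n) p = q' * g + r"
    proof -
      have "smult (a ^ Suc n) p = smult (a ^ n) (p' + t * g)"
        by (simp add: p'_def mult.commute)
      also have "\<dots> = q' * g + r"
        by (simp add: smult_add_right IH(3) q'_def algebra_simps)
      finally show ?thesis .
    qed
    moreover have "q' \<in> polys_over A"
      unfolding q'_def using IH(1) tP aA sub_ring_power[OF A]
      by (intro polys_over_add polys_over_smult) auto
    \<comment> \<open>The bound on the quotient is needed later: it makes the cofactor of a
      nonconstant divisor shorter than the minimal polynomial.\<close>
    moreover have "degree q' \<le> degree p - e"
    proof -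
      have "degree q \<le> degree p - e" using IH(5) deg by linarith
      moreover have "degree (smult (a ^ n) t) \<le> k"
        using degree_smult_le[of "a ^ n" t] degree_monom_le[of "lead_coeff p" k]
        by (simp add: t_def)
      ultimately show ?thesis unfolding q'_def using k_def by (intro degree_add_le) auto
    qed
    ultimately show ?thesis using IH(2,4) unfolding a_def e_def by blast
  qed
qed

end

text \<open>At a root of \<open>p - 1\<close> the polynomial \<open>p\<close> takes the value 1; no
  count of the elements of the field is involved.\<close>

lemma alg_closed_poly_nonroot:
  fixes p :: "'k::alg_closed_field poly"
  assumes "p \<noteq> 0"
  obtains x where "poly p x \<noteq> 0"
proof (cases "degree p = 0")
  case True
  then obtain c where "p = [:c:]" by (rule degree_eq_zeroE)
  then show ?thesis using assms that by auto
next
  case False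
  then have "degree (p - [:1:]) > 0"
    using degree_add_eq_left[of "- [:1:]" p] by (simp del: minus_pCons)
  then obtain x where "poly (p - [:1:]) x = 0" using alg_closed_imp_poly_has_root by blast
  then show ?thesis using that[of x] by simp
qed

text \<open>Stands for the domain C/m without forming the quotient: being nonzero is expressed as
  lying outside \<open>m\<close>.\<close>

locale prime_ideal_in =
  fixes C m :: "'a::comm_ring_1 set"
  assumes C: "sub_ring C"
    and m_subset: "m \<subseteq> C"
    and m_diff: "x \<in> m \<Longrightarrow> y \<in> m \<Longrightarrow> x - y \<in> m"
    and m_mult: "x \<in> C \<Longrightarrow> y \<in> m \<Longrightarrow> x * y \<in> m"
    and m_prime: "x \<in> C \<Longrightarrow> y \<in> C \<Longrightarrow> x * y \<in> m \<Longrightarrow> x \<in> m \<or> y \<in> m"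
    and m_zero: "0 \<in> m"
    and m_one: "1 \<notin> m"
begin

lemma m_uminus: "x \<in> m \<Longrightarrow> - x \<in> m"
  using m_diff[OF m_zero] by fastforce

lemma m_add: "x \<in> m \<Longrightarrow> y \<in> m \<Longrightarrow> x + y \<in> m"
  using m_diff[OF _ m_uminus] by fastforce

lemma m_sum: "(\<And>i. i \<in> I \<Longrightarrow> f i \<in> m) \<Longrightarrow> sum f I \<in> m"
  by (induct I rule: infinite_finite_induct) (auto simp: m_zero m_add)

lemma m_power: "x \<in> C \<Longrightarrow> x ^ n \<in> m \<Longrightarrow> x \<in> m"
  by (induct n) (use m_one m_prime sub_ring_power[OF C] in auto)

lemma poly_mem_m:
  assumes "x \<in> C" "\<And>i. coeff p i \<in> m" shows "poly p x \<in> m"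
  unfolding poly_altdef using assms sub_ring_power[OF C assms(1)]
  by (intro m_sum) (auto simp: mult.commute[of "coeff p _"] intro!: m_mult)

text \<open>Encodes a homomorphism from the quotient of \<open>A\<close> by
  \<open>A \<inter> m\<close> to the field as a function on \<open>A\<close> that kills
  \<open>A \<inter> m\<close>.\<close>

definition hom_mod :: "'a set \<Rightarrow> ('a \<Rightarrow> 'k::field) \<Rightarrow> bool" where
  "hom_mod A \<phi> \<longleftrightarrow> \<phi> 1 = 1 \<and> (\<forall>x\<in>A. \<forall>y\<in>A. \<phi> (x + y) = \<phi> x + \<phi> y \<and> \<phi> (x * y) = \<phi> x * \<phi> y) \<and>
     (\<forall>x\<in>A \<inter> m. \<phi> x = 0)"

lemma hom_modD:
  assumes "hom_mod A \<phi>"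
  shows "\<phi> 1 = 1" "x \<in> A \<Longrightarrow> y \<in> A \<Longrightarrow> \<phi> (x + y) = \<phi> x + \<phi> y"
    "x \<in> A \<Longrightarrow> y \<in> A \<Longrightarrow> \<phi> (x * y) = \<phi> x * \<phi> y" "x \<in> A \<Longrightarrow> x \<in> m \<Longrightarrow> \<phi> x = 0"
  using assms by (auto simp: hom_mod_def)

lemma hom_mod_0: "sub_ring A \<Longrightarrow> hom_mod A \<phi> \<Longrightarrow> \<phi> 0 = 0"
  using hom_modD(4) sub_ring_0 m_zero by blast

lemma hom_mod_diff:
  assumes "sub_ring A" "hom_mod A \<phi>" "x \<in> A" "y \<in> A"
  shows "\<phi> (x - y) = \<phi> x - \<phi> y"
  using hom_modD(2)[OF assms(2), of "x - y" y] sub_ring_diff[OF assms(1,3,4)] assms(4) by simp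

lemma hom_mod_power:
  assumes "sub_ring A" "hom_mod A \<phi>" "x \<in> A"
  shows "\<phi> (x ^ n) = \<phi> x ^ n"
  by (induct n)
    (simp_all add: hom_modD(1)[OF assms(2)] hom_modD(3)[OF assms(2)] assms(3)
      sub_ring_power[OF assms(1)])

lemma hom_mod_sum:
  assumes "sub_ring A" "hom_mod A \<phi>" "\<And>i. i \<in> I \<Longrightarrow> f i \<in> A"
  shows "\<phi> (sum f I) = (\<Sum>i\<in>I. \<phi> (f i))"
  using assms(3)
  by (induct I rule: infinite_finite_induct)
    (auto simp: hom_mod_0[OF assms(1,2)] hom_modD(2)[OF assms(2)] sub_ring_sum[OF assms(1)])

context
  fixes A :: "'a set" and \<phi> :: "'a \<Rightarrow> 'k::field"
  assumes A: "sub_ring A" and \<phi>: "hom_mod A \<phi>"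
begin

lemma map_poly_hom_add:
  assumes "p \<in> polys_over A" "q \<in> polys_over A"
  shows "map_poly \<phi> (p + q) = map_poly \<phi> p + map_poly \<phi> q"
  using assms hom_modD(2)[OF \<phi>]
  by (intro poly_eqI) (simp add: coeff_map_poly hom_mod_0[OF A \<phi>] polys_over_def)

lemma map_poly_hom_diff:
  assumes "p \<in> polys_over A" "q \<in> polys_over A"
  shows "map_poly \<phi> (p - q) = map_poly \<phi> p - map_poly \<phi> q"
  using assms hom_mod_diff[OF A \<phi>]
  by (intro poly_eqI) (simp add: coeff_map_poly hom_mod_0[OF A \<phi>] polys_over_def)

lemma map_poly_hom_mult:
  assumes "p \<in> polys_over A" "q \<in> polys_over A"
  shows "map_poly \<phi> (p * q) = map_poly \<phi> p * map_poly \<phi> q"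
proof (rule poly_eqI)
  fix n
  have "\<phi> (\<Sum>i\<le>n. coeff p i * coeff q (n - i)) = (\<Sum>i\<le>n. \<phi> (coeff p i) * \<phi> (coeff q (n - i)))"
    using assms hom_modD(3)[OF \<phi>] sub_ring_mult[OF A]
    by (subst hom_mod_sum[OF A \<phi>]) (auto simp: polys_over_def)
  then show "coeff (map_poly \<phi> (p * q)) n = coeff (map_poly \<phi> p * map_poly \<phi> q) n"
    by (simp add: coeff_map_poly hom_mod_0[OF A \<phi>] coeff_mult)
qed

lemma map_poly_hom_smult:
  assumes "a \<in> A" "p \<in> polys_over A"
  shows "map_poly \<phi> (smult a p) = smult (\<phi> a) (map_poly \<phi> p)"
  using assms hom_modD(3)[OF \<phi>]
  by (intro poly_eqI) (simp add: coeff_map_poly hom_mod_0[OF A \<phi>] polys_over_def)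

lemma map_poly_hom_m:
  assumes "p \<in> polys_over A" "\<And>i. coeff p i \<in> m"
  shows "map_poly \<phi> p = 0"
  using assms hom_modD(4)[OF \<phi>]
  by (intro poly_eqI) (simp add: coeff_map_poly hom_mod_0[OF A \<phi>] polys_over_def)

text \<open>Sending \<open>x\<close> to \<xi> is well defined as soon as every polynomial relation
  of \<open>x\<close> modulo \<open>m\<close> is mapped to a relation satisfied by \<xi>; the choice
  of a representing polynomial is then immaterial.\<close>

lemma hom_mod_adjoin:
  assumes wd: "\<And>p. p \<in> polys_over A \<Longrightarrow> poly p x \<in> m \<Longrightarrow> poly (map_poly \<phi> p) \<xi> = 0"
  obtains \<psi> where "hom_mod (adjoin A x) \<psi>"
    "\<And>p. p \<in> polys_over A \<Longrightarrow> \<psi> (poly p x) = poly (map_poly \<phi> p) \<xi>"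
    "\<And>a. a \<in> A \<Longrightarrow> \<psi> a = \<phi> a"
proof -
  define \<psi> where "\<psi> = (\<lambda>y. poly (map_poly \<phi> (SOME p. p \<in> polys_over A \<and> poly p x = y)) \<xi>)"
  have *: "\<psi> (poly p x) = poly (map_poly \<phi> p) \<xi>" if p: "p \<in> polys_over A" for p
  proof -
    define q where "q = (SOME q. q \<in> polys_over A \<and> poly q x = poly p x)"
    have q: "q \<in> polys_over A" "poly q x = poly p x"
      using someI_ex[of "\<lambda>q. q \<in> polys_over A \<and> poly q x = poly p x"] p unfolding q_def by blast+
    have "poly (map_poly \<phi> (q - p)) \<xi> = 0"
      using q m_zero by (intro wd polys_over_diff[OF A] p) auto
    then show ?thesis
      unfolding map_poly_hom_diff[OF q(1) p] \<psi>_def q_def[symmetric] by simp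
  qed
  have \<psi>A: "\<psi> a = \<phi> a" if "a \<in> A" for a
    using *[OF polys_over_const[OF A that]] by (simp add: map_poly_pCons hom_mod_0[OF A \<phi>])
  have "hom_mod (adjoin A x) \<psi>"
    unfolding hom_mod_def
  proof (intro conjI ballI)
    show "\<psi> 1 = 1" using \<psi>A[OF sub_ring_1[OF A]] hom_modD(1)[OF \<phi>] by simp
    fix y z assume "y \<in> adjoin A x" "z \<in> adjoin A x"
    then obtain p q where pq: "p \<in> polys_over A" "q \<in> polys_over A" and yz: "y = poly p x" "z = poly q x"
      by (auto simp: adjoin_def)
    show "\<psi> (y + z) = \<psi> y + \<psi> z"
      unfolding yz Polynomial.poly_add[symmetric] *[OF pq(1)] *[OF pq(2)] *[OF polys_over_add[OF A pq]]
      by (simp add: map_poly_hom_add[OF pq])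
    show "\<psi> (y * z) = \<psi> y * \<psi> z"
      unfolding yz Polynomial.poly_mult[symmetric] *[OF pq(1)] *[OF pq(2)] *[OF polys_over_mult[OF A pq]]
      by (simp add: map_poly_hom_mult[OF pq])
  next
    fix y assume "y \<in> adjoin A x \<inter> m"
    then show "\<psi> y = 0" using * wd by (auto simp: adjoin_def)
  qed
  then show ?thesis using * \<psi>A by (rule that)
qed

end

text \<open>Least degree is taken among the polynomials with some coefficient outside
  \<open>m\<close>. As \<open>J\<close> is only an additive group containing \<open>m\<close>, the
  lemma serves both for \<open>m\<close> itself and for the ideal spanned by \<open>m\<close> and
  one further element.\<close>

lemma minimal_poly:
  assumes A: "sub_ring A" "A \<subseteq> C" "x \<in> C"
    and J: "m \<subseteq> J" "\<And>y z. y \<in> J \<Longrightarrow> z \<in> J \<Longrightarrow> y - z \<in> J"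
    and p: "p \<in> polys_over A" "poly p x \<in> J" "coeff p i \<notin> m"
  obtains r where "r \<in> polys_over A" "poly r x \<in> J" "lead_coeff r \<notin> m"
    "\<And>s i. s \<in> polys_over A \<Longrightarrow> poly s x \<in> J \<Longrightarrow> degree s < degree r \<Longrightarrow> coeff s i \<in> m"
proof -
  define Q where "Q = (\<lambda>r. r \<in> polys_over A \<and> poly r x \<in> J \<and> (\<exists>i. coeff r i \<notin> m))"
  define r where "r = arg_min degree Q"
  have Qp: "Q p" using p by (auto simp: Q_def)
  have Qr: "Q r" unfolding r_def by (rule arg_min_natI[of Q, OF Qp])
  have min: "degree r \<le> degree s" if "Q s" for s
    unfolding r_def by (rule arg_min_nat_le[of Q, OF that])
  have r: "r \<in> polys_over A" "poly r x \<in> J" using Qr by (auto simp: Q_def)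
  obtain j where j: "coeff r j \<notin> m" using Qr by (auto simp: Q_def)
  have "lead_coeff r \<notin> m"
  proof
    assume lm: "lead_coeff r \<in> m"
    then have jd: "j \<noteq> degree r" using j by auto
    define s where "s = r - monom (lead_coeff r) (degree r)"
    have "lead_coeff r \<in> A" using r(1) by (simp add: polys_over_def)
    then have "s \<in> polys_over A"
      unfolding s_def using r(1) by (intro polys_over_diff[OF A(1)] polys_over_monom[OF A(1)])
    moreover have "poly s x \<in> J"
      unfolding s_def poly_diff poly_monom mult.commute[of "lead_coeff r"]
      using J(1) m_mult[OF sub_ring_power[OF C A(3)] lm] r(2) by (intro J(2)) auto
    moreover have "coeff s j \<notin> m" using j jd by (simp add: s_def)
    ultimately have "degree r \<le> degree s" using min by (auto simp: Q_def)
    moreover have "degree s \<le> degree r"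
      unfolding s_def by (intro degree_diff_le degree_monom_le) auto
    moreover have "coeff s (degree r) = 0" by (simp add: s_def)
    ultimately have "s = 0" by (metis leading_coeff_0_iff antisym)
    then show False using \<open>coeff s j \<notin> m\<close> m_zero by simp
  qed
  moreover have "coeff s i \<in> m" if "s \<in> polys_over A" "poly s x \<in> J" "degree s < degree r" for s i
    using min[of s] that by (auto simp: Q_def)
  ultimately show ?thesis using r that by blast
qed

text \<open>
  \<open>f\<close> is a minimal polynomial of \<open>x\<close> modulo \<open>m\<close>.  The polynomial \<open>r\<close> plays the role of a
  greatest common divisor of \<open>f\<close> and a polynomial representing \<open>b\<close>; by minimality of \<open>f\<close> it is a
  constant, which exhibits a nonzero multiple of \<open>b\<close> in the smaller ring.
\<close>

lemma algebraic_multiple: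
  assumes A: "sub_ring A" "A \<subseteq> C" "x \<in> C" and b: "b \<in> adjoin A x" "b \<notin> m"
    and f: "f \<in> polys_over A" "poly f x \<in> m" "lead_coeff f \<notin> m"
    and fmin: "\<And>s i. s \<in> polys_over A \<Longrightarrow> poly s x \<in> m \<Longrightarrow> degree s < degree f \<Longrightarrow> coeff s i \<in> m"
  obtains c h where "c \<in> A" "c \<notin> m" "h \<in> adjoin A x" "c - h * b \<in> m"
proof -
  have adC: "adjoin A x \<subseteq> C" by (rule adjoin_subset[OF A(1) C A(2,3)])
  have sA: "sub_ring (adjoin A x)" by (rule sub_ring_adjoin[OF A(1)])
  have bC: "b \<in> C" using b adC by blast
  \<comment> \<open>Modulo \<open>m\<close> this is the principal ideal generated by
    \<open>b\<close> in \<open>adjoin A x\<close>; the aim is an element of \<open>A\<close> in it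
    that lies outside \<open>m\<close>.\<close>
  define J where "J = {y. \<exists>h\<in>adjoin A x. y - h * b \<in> m}"
  have mJ: "m \<subseteq> J" using sub_ring_0[OF sA] by (force simp: J_def)
  have bJ: "b \<in> J" using sub_ring_1[OF sA] m_zero by (force simp: J_def)
  have Jdiff: "y - z \<in> J" if yz: "y \<in> J" "z \<in> J" for y z
  proof -
    obtain h k where hk: "h \<in> adjoin A x" "k \<in> adjoin A x" "y - h * b \<in> m" "z - k * b \<in> m"
      using yz unfolding J_def by blast
    have eq: "(y - z) - (h - k) * b = (y - h * b) - (z - k * b)" by (simp add: algebra_simps)
    have "(y - z) - (h - k) * b \<in> m" unfolding eq by (rule m_diff[OF hk(3,4)])
    then show ?thesis using sub_ring_diff[OF sA hk(1,2)] by (auto simp: J_def)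
  qed
  have Jmult: "q * y \<in> J" if q: "q \<in> adjoin A x" and y: "y \<in> J" for q y
  proof -
    obtain h where h: "h \<in> adjoin A x" "y - h * b \<in> m" using y by (auto simp: J_def)
    have "q * (y - h * b) \<in> m" using m_mult h(2) q adC by blast
    then have "q * y - (q * h) * b \<in> m" by (simp add: algebra_simps)
    then show ?thesis using sub_ring_mult[OF sA q h(1)] by (auto simp: J_def)
  qed
  obtain g where g: "g \<in> polys_over A" "b = poly g x" using b(1) by (auto simp: adjoin_def)
  have fJ: "poly f x \<in> J" using f(2) mJ by blast
  obtain r where r: "r \<in> polys_over A" "poly r x \<in> J" "lead_coeff r \<notin> m"
    and rmin: "\<And>s i. s \<in> polys_over A \<Longrightarrow> poly s x \<in> J \<Longrightarrow> degree s < degree r \<Longrightarrow> coeff s i \<in> m"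
    using minimal_poly[OF A mJ Jdiff f(1) fJ f(3)] by blast
  have lcA: "lead_coeff r \<in> A" using r(1) by (simp add: polys_over_def)
  then have lcC: "lead_coeff r \<in> C" using A(2) by blast
  have "degree r = 0"
  proof (rule ccontr)
    assume "degree r \<noteq> 0"
    then have dr: "0 < degree r" by simp
    have remainder: "\<exists>n. \<exists>q\<in>polys_over A. \<exists>s\<in>polys_over A. smult (lead_coeff r ^ n) p = q * r + s \<and>
        (\<forall>i. coeff s i \<in> m) \<and> degree q \<le> degree p - degree r"
      if p: "p \<in> polys_over A" "poly p x \<in> J" for p
    proof -
      obtain n q s where qs: "q \<in> polys_over A" "s \<in> polys_over A"
        "smult (lead_coeff r ^ n) p = q * r + s" "degree s < degree r" "degree q \<le> degree p - degree r"
        using pseudo_division[OF A(1) r(1) dr p(1)] by blast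
      have "s = smult (lead_coeff r ^ n) p - q * r" using qs(3) by simp
      then have sx: "poly s x = lead_coeff r ^ n * poly p x - poly q x * poly r x" by simp
      have "lead_coeff r ^ n \<in> adjoin A x"
        using sub_ring_power[OF A(1) lcA] subset_adjoin[OF A(1)] by blast
      then have "poly s x \<in> J"
        unfolding sx using p(2) r(2) adjoinI[OF A(1) qs(1)] by (intro Jdiff Jmult)
      then have "\<forall>i. coeff s i \<in> m" using rmin qs(2,4) by blast
      then show ?thesis using qs by blast
    qed
    obtain n q s where qs: "q \<in> polys_over A" "s \<in> polys_over A"
      "smult (lead_coeff r ^ n) f = q * r + s" "\<forall>i. coeff s i \<in> m" "degree q \<le> degree f - degree r"
      using remainder[OF f(1) fJ] by blast
    obtain k q' s' where qs': "q' \<in> polys_over A" "s' \<in> polys_over A"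
      "smult (lead_coeff r ^ k) g = q' * r + s'" "\<forall>i. coeff s' i \<in> m"
      using remainder[OF g(1)] g(2) bJ by blast
    have rC: "poly r x \<in> C" and qC: "poly q x \<in> C" and q'C: "poly q' x \<in> C"
      using poly_mem[OF A(1) C A(2,3)] r(1) qs(1) qs'(1) by blast+
    \<comment> \<open>Otherwise pseudo-division of \<open>g\<close> by \<open>r\<close>, evaluated
      at \<open>x\<close>, would put a power of \<open>lead_coeff r\<close> times \<open>b\<close>
      into the prime ideal.\<close>
    have "poly r x \<notin> m"
    proof
      assume "poly r x \<in> m"
      then have "poly q' x * poly r x + poly s' x \<in> m"
        using m_mult[OF q'C] poly_mem_m[OF A(3)] qs'(4) by (intro m_add) auto
      also have "poly q' x * poly r x + poly s' x = lead_coeff r ^ k * b"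
        using arg_cong[OF qs'(3), of "\<lambda>p. poly p x"] g(2) by simp
      finally show False
        using m_prime[OF sub_ring_power[OF C lcC] bC] m_power[OF lcC] b(2) r(3) by blast
    qed
    moreover have "poly q x * poly r x \<in> m"
    proof -
      have "poly q x * poly r x = lead_coeff r ^ n * poly f x - poly s x"
        using arg_cong[OF qs(3), of "\<lambda>p. poly p x"] by simp
      also have "\<dots> \<in> m"
        using m_mult[OF sub_ring_power[OF C lcC] f(2)] poly_mem_m[OF A(3)] qs(4) by (intro m_diff) auto
      finally show ?thesis .
    qed
    \<comment> \<open>The cofactor \<open>q\<close> is thus a relation of \<open>x\<close> shorter
      than \<open>f\<close>, so all its coefficients lie in \<open>m\<close>; comparing coefficients
      in degree \<open>degree f\<close> then puts a product of elements outside \<open>m\<close>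
      into \<open>m\<close>.\<close>
    ultimately have qm: "poly q x \<in> m" using m_prime[OF qC rC] by blast
    have df: "degree f \<noteq> 0"
    proof
      assume d0: "degree f = 0"
      then have "poly f x = lead_coeff f" by (metis degree_eq_zeroE lead_coeff_pCons(2) poly_pCons mult_zero_right add.right_neutral poly_0 pCons_0_0 lead_coeff_pCons(1))
      then show False using f(2,3) by simp
    qed
    have "degree q < degree f" using qs(5) dr df by linarith
    then have "\<forall>i. coeff q i \<in> m" using fmin[OF qs(1) qm] by blast
    then have qr: "coeff (q * r) i \<in> m" for i
      unfolding coeff_mult using r(1) A(2)
      by (intro m_sum) (auto simp: polys_over_def mult.commute[of "coeff q _"] intro!: m_mult)
    have "lead_coeff r ^ n * lead_coeff f = coeff (q * r) (degree f) + coeff s (degree f)"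
      using arg_cong[OF qs(3), of "\<lambda>p. coeff p (degree f)"] by simp
    then have "lead_coeff r ^ n * lead_coeff f \<in> m" using qr qs(4) m_add by simp
    moreover have "lead_coeff f \<in> C" using f(1) A(2) by (auto simp: polys_over_def)
    ultimately show False
      using m_prime[OF sub_ring_power[OF C lcC]] m_power[OF lcC] r(3) f(3) by blast
  qed
  then obtain c where c: "r = [:c:]" by (rule degree_eq_zeroE)
  then have "c \<in> A" "c \<notin> m" "c \<in> J"
    using lcA r(2,3) by auto
  then show ?thesis using that by (auto simp: J_def)
qed

text \<open>If \<open>x\<close> is transcendental modulo \<open>m\<close>, it may be sent anywhere,
  and only the zeros of one polynomial have to be avoided; if it is algebraic, it goes to a root of
  the image of its minimal polynomial. The element \<open>a\<close> is chosen before \<phi>, and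
  this order of quantifiers is what permits iteration.\<close>

lemma extend_hom_adjoin:
  assumes A: "sub_ring A" "A \<subseteq> C" "x \<in> C" and b: "b \<in> adjoin A x" "b \<notin> m"
  shows "\<exists>a\<in>A. a \<notin> m \<and> (\<forall>\<phi> :: 'a \<Rightarrow> 'k::alg_closed_field. hom_mod A \<phi> \<longrightarrow> \<phi> a \<noteq> 0 \<longrightarrow>
           (\<exists>\<psi>. hom_mod (adjoin A x) \<psi> \<and> (\<forall>y\<in>A. \<psi> y = \<phi> y) \<and> \<psi> b \<noteq> 0))"
proof (cases "\<exists>p\<in>polys_over A. poly p x \<in> m \<and> (\<exists>i. coeff p i \<notin> m)")
  case False
  obtain g where g: "g \<in> polys_over A" "b = poly g x" using b(1) by (auto simp: adjoin_def)
  \<comment> \<open>If this coefficient survives under \<phi>, the image of \<open>g\<close> is a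
    nonzero polynomial and has a nonroot.\<close>
  obtain i where i: "coeff g i \<notin> m" using poly_mem_m[OF A(3), of g] b(2) g(2) by blast
  have "\<exists>\<psi>. hom_mod (adjoin A x) \<psi> \<and> (\<forall>y\<in>A. \<psi> y = \<phi> y) \<and> \<psi> b \<noteq> 0"
    if \<phi>: "hom_mod A \<phi>" "\<phi> (coeff g i) \<noteq> 0" for \<phi> :: "'a \<Rightarrow> 'k"
  proof -
    have "coeff (map_poly \<phi> g) i \<noteq> 0"
      using \<phi>(2) by (simp add: coeff_map_poly hom_mod_0[OF A(1) \<phi>(1)])
    then have "map_poly \<phi> g \<noteq> 0" by auto
    then obtain \<xi> where \<xi>: "poly (map_poly \<phi> g) \<xi> \<noteq> 0" by (rule alg_closed_poly_nonroot)
    have wd: "poly (map_poly \<phi> p) \<xi> = 0" if "p \<in> polys_over A" "poly p x \<in> m" for p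
      using map_poly_hom_m[OF A(1) \<phi>(1) that(1)] False that by auto
    show ?thesis
      using hom_mod_adjoin[OF A(1) \<phi>(1) wd] g \<xi> by metis
  qed
  then show ?thesis using i g(1) by (auto simp: polys_over_def intro!: bexI[of _ "coeff g i"])
next
  case True
  have "\<And>y z. y \<in> m \<Longrightarrow> z \<in> m \<Longrightarrow> y - z \<in> m" by (rule m_diff)
  then obtain f where f: "f \<in> polys_over A" "poly f x \<in> m" "lead_coeff f \<notin> m"
    and fmin: "\<And>s i. s \<in> polys_over A \<Longrightarrow> poly s x \<in> m \<Longrightarrow> degree s < degree f \<Longrightarrow> coeff s i \<in> m"
    using True minimal_poly[OF A order_refl] by metis
  define a where "a = lead_coeff f"
  have aA: "a \<in> A" using f(1) by (simp add: a_def polys_over_def)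
  have df: "0 < degree f"
  proof (rule ccontr)
    assume "\<not> 0 < degree f"
    then obtain c where "f = [:c:]" using degree_eq_zeroE by blast
    then show False using f(2,3) by auto
  qed
  obtain c h where c: "c \<in> A" "c \<notin> m" "h \<in> adjoin A x" "c - h * b \<in> m"
    using algebraic_multiple[OF A b f fmin] .
  \<comment> \<open>\<open>\<phi> a \<noteq> 0\<close> keeps the image of \<open>f\<close>
    nonconstant, so that it has a root, and cancels the factor introduced by pseudo-division.
    \<open>\<phi> c \<noteq> 0\<close> forces \<open>\<psi> b \<noteq> 0\<close>, since
    \<open>c\<close> and \<open>h * b\<close> agree modulo \<open>m\<close>.\<close>
  have "\<exists>\<psi>. hom_mod (adjoin A x) \<psi> \<and> (\<forall>y\<in>A. \<psi> y = \<phi> y) \<and> \<psi> b \<noteq> 0"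
    if \<phi>: "hom_mod A \<phi>" "\<phi> (a * c) \<noteq> 0" for \<phi> :: "'a \<Rightarrow> 'k"
  proof -
    have ac: "\<phi> a \<noteq> 0" "\<phi> c \<noteq> 0" using \<phi>(2) hom_modD(3)[OF \<phi>(1) aA c(1)] by auto
    have "coeff (map_poly \<phi> f) (degree f) \<noteq> 0"
      using ac(1) by (simp add: coeff_map_poly hom_mod_0[OF A(1) \<phi>(1)] a_def)
    then have "0 < degree (map_poly \<phi> f)" using df le_degree by (metis gr_zeroI leD)
    then obtain \<xi> where \<xi>: "poly (map_poly \<phi> f) \<xi> = 0" using alg_closed_imp_poly_has_root by blast
    \<comment> \<open>The pseudo-remainder is a relation of \<open>x\<close> shorter than
      \<open>f\<close>, so by minimality its coefficients lie in \<open>m\<close> and are killed by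
      \<phi>.\<close>
    have wd: "poly (map_poly \<phi> p) \<xi> = 0" if p: "p \<in> polys_over A" "poly p x \<in> m" for p
    proof -
      obtain n q r where qr: "q \<in> polys_over A" "r \<in> polys_over A"
        "smult (a ^ n) p = q * f + r" "degree r < degree f"
        using pseudo_division[OF A(1) f(1) df p(1)] unfolding a_def by blast
      have qC: "poly q x \<in> C" using poly_mem[OF A(1) C A(2,3) qr(1)] .
      have anC: "a ^ n \<in> C" using sub_ring_power[OF C] aA A(2) by blast
      have "r = smult (a ^ n) p - q * f" using qr(3) by simp
      then have "poly r x = a ^ n * poly p x - poly q x * poly f x" by simp
      then have "poly r x \<in> m" using m_diff[OF m_mult[OF anC p(2)] m_mult[OF qC f(2)]] by simp
      then have "\<And>i. coeff r i \<in> m" using fmin qr(2,4) by blast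
      then have "map_poly \<phi> r = 0" by (rule map_poly_hom_m[OF A(1) \<phi>(1) qr(2)])
      then have "smult (\<phi> (a ^ n)) (map_poly \<phi> p) = map_poly \<phi> q * map_poly \<phi> f"
        using arg_cong[OF qr(3), of "map_poly \<phi>"] qr(1,2) f(1) p(1)
        by (simp add: map_poly_hom_add[OF A(1) \<phi>(1)] map_poly_hom_mult[OF A(1) \<phi>(1)]
            map_poly_hom_smult[OF A(1) \<phi>(1)] sub_ring_power[OF A(1) aA] polys_over_mult[OF A(1)])
      from arg_cong[OF this, of "\<lambda>p. poly p \<xi>"] show ?thesis
        using \<xi> ac(1) by (simp add: hom_mod_power[OF A(1) \<phi>(1) aA])
    qed
    obtain \<psi> where \<psi>: "hom_mod (adjoin A x) \<psi>" "\<And>y. y \<in> A \<Longrightarrow> \<psi> y = \<phi> y"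
      using hom_mod_adjoin[OF A(1) \<phi>(1) wd] by metis
    have sA: "sub_ring (adjoin A x)" by (rule sub_ring_adjoin[OF A(1)])
    have cx: "c \<in> adjoin A x" using c(1) subset_adjoin[OF A(1)] by blast
    have hb: "h * b \<in> adjoin A x" using sub_ring_mult[OF sA c(3) b(1)] .
    have "\<psi> (c - h * b) = 0" using hom_modD(4)[OF \<psi>(1) sub_ring_diff[OF sA cx hb] c(4)] .
    then have "\<phi> c = \<psi> h * \<psi> b"
      using hom_mod_diff[OF sA \<psi>(1) cx hb] hom_modD(3)[OF \<psi>(1) c(3) b(1)] \<psi>(2)[OF c(1)] by simp
    then show ?thesis using \<psi> ac(2) by auto
  qed
  moreover have "a * c \<notin> m" using m_prime aA c(1,2) A(2) f(3) unfolding a_def by blast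
  ultimately show ?thesis using sub_ring_mult[OF A(1) aA c(1)] by blast
qed

text \<open>The adjunctions are treated from the last to the first: the element that must not be
  killed at one stage plays the role of \<open>b\<close> at the stage below.\<close>

lemma extend_hom_fold:
  assumes "sub_ring A" "A \<subseteq> C" "set xs \<subseteq> C" "b \<in> foldl adjoin A xs" "b \<notin> m"
  shows "\<exists>a\<in>A. a \<notin> m \<and> (\<forall>\<phi> :: 'a \<Rightarrow> 'k::alg_closed_field. hom_mod A \<phi> \<longrightarrow> \<phi> a \<noteq> 0 \<longrightarrow>
           (\<exists>\<psi>. hom_mod (foldl adjoin A xs) \<psi> \<and> (\<forall>y\<in>A. \<psi> y = \<phi> y) \<and> \<psi> b \<noteq> 0))"
  using assms
proof (induct xs arbitrary: A)
  case Nil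
  then show ?case by (intro bexI[of _ b]) auto
next
  case (Cons x xs)
  have x: "x \<in> C" using Cons.prems by simp
  have "\<exists>a\<in>adjoin A x. a \<notin> m \<and> (\<forall>\<phi> :: 'a \<Rightarrow> 'k. hom_mod (adjoin A x) \<phi> \<longrightarrow> \<phi> a \<noteq> 0 \<longrightarrow>
           (\<exists>\<psi>. hom_mod (foldl adjoin (adjoin A x) xs) \<psi> \<and> (\<forall>y\<in>adjoin A x. \<psi> y = \<phi> y) \<and> \<psi> b \<noteq> 0))"
    using Cons.prems
    by (intro Cons.hyps) (auto simp: sub_ring_adjoin adjoin_subset[OF _ C, THEN subsetD])
  then obtain a where a: "a \<in> adjoin A x" "a \<notin> m" and
    aex: "\<And>\<phi> :: 'a \<Rightarrow> 'k. hom_mod (adjoin A x) \<phi> \<Longrightarrow> \<phi> a \<noteq> 0 \<Longrightarrow>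
      (\<exists>\<psi>. hom_mod (foldl adjoin (adjoin A x) xs) \<psi> \<and> (\<forall>y\<in>adjoin A x. \<psi> y = \<phi> y) \<and> \<psi> b \<noteq> 0)"
    by blast
  obtain c where c: "c \<in> A" "c \<notin> m" and
    cex: "\<And>\<phi> :: 'a \<Rightarrow> 'k. hom_mod A \<phi> \<Longrightarrow> \<phi> c \<noteq> 0 \<Longrightarrow>
      \<exists>\<psi>. hom_mod (adjoin A x) \<psi> \<and> (\<forall>y\<in>A. \<psi> y = \<phi> y) \<and> \<psi> a \<noteq> 0"
    using extend_hom_adjoin[OF Cons.prems(1,2) x a] by blast
  have "\<exists>\<psi>. hom_mod (foldl adjoin A (x # xs)) \<psi> \<and> (\<forall>y\<in>A. \<psi> y = \<phi> y) \<and> \<psi> b \<noteq> 0"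
    if \<phi>: "hom_mod A \<phi>" "\<phi> c \<noteq> 0" for \<phi> :: "'a \<Rightarrow> 'k"
  proof -
    obtain \<psi> where \<psi>: "hom_mod (adjoin A x) \<psi>" "\<forall>y\<in>A. \<psi> y = \<phi> y" "\<psi> a \<noteq> 0"
      using cex[OF \<phi>] by blast
    obtain \<eta> where "hom_mod (foldl adjoin (adjoin A x) xs) \<eta>" "\<forall>y\<in>adjoin A x. \<eta> y = \<psi> y" "\<eta> b \<noteq> 0"
      using aex[OF \<psi>(1,3)] by blast
    then show ?thesis using \<psi>(2) subset_adjoin[OF Cons.prems(1), of x]
      by (auto simp: subset_iff intro!: exI[of _ \<eta>])
  qed
  then show ?case using c by blast
qed

end

lemma sub_ring_foldl_adjoin:
  assumes "sub_ring A"
  shows "sub_ring (foldl adjoin A xs) \<and> A \<subseteq> foldl adjoin A xs \<and> set xs \<subseteq> foldl adjoin A xs"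
  using assms
proof (induct xs arbitrary: A)
  case (Cons x xs)
  have "sub_ring (adjoin A x)" using sub_ring_adjoin[OF Cons.prems] .
  from Cons.hyps[OF this] show ?case
    using subset_adjoin[OF Cons.prems, of x] mem_adjoin[OF Cons.prems, of x] by auto
qed simp

section \<open>Closed points of semigroup rings\<close>

definition submonoid_set :: "'a::comm_monoid_add set \<Rightarrow> bool" where
  "submonoid_set S \<longleftrightarrow> 0 \<in> S \<and> (\<forall>a\<in>S. \<forall>b\<in>S. a + b \<in> S)"

definition monoid_hom :: "'a::comm_monoid_add set \<Rightarrow> ('a \<Rightarrow> 'k::field) \<Rightarrow> bool" where
  "monoid_hom S \<gamma> \<longleftrightarrow> \<gamma> 0 = 1 \<and> (\<forall>a\<in>S. \<forall>b\<in>S. \<gamma> (a + b) = \<gamma> a * \<gamma> b)"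

definition ev :: "('a \<Rightarrow> 'k::field) \<Rightarrow> ('a \<Rightarrow>\<^sub>0 'k) \<Rightarrow> 'k" where
  "ev \<gamma> f = (\<Sum>u\<in>Poly_Mapping.keys f. Poly_Mapping.lookup f u * \<gamma> u)"

text \<open>The kernel of the evaluation that sends \<open>\<chi>\<^sup>u\<close> to
  \<open>\<gamma> u\<close>. Only the values of \<gamma> on \<open>S\<close> matter, so
  homomorphisms are compared only there.\<close>

definition point ::
  "('v \<Rightarrow> real) set \<Rightarrow> (('v \<Rightarrow> real) \<Rightarrow> 'k::field) \<Rightarrow> (('v \<Rightarrow> real) \<Rightarrow>\<^sub>0 'k) set" where
  "point S \<gamma> = {f \<in> carrier (semigroup_ring S). ev \<gamma> f = 0}"

lemma mem_carrier_semigroup_ring: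
  "f \<in> carrier (semigroup_ring S) \<longleftrightarrow> Poly_Mapping.keys f \<subseteq> S"
  by (simp add: semigroup_ring_def)

lemma ev_superset:
  assumes "finite K" "Poly_Mapping.keys f \<subseteq> K"
  shows "ev \<gamma> f = (\<Sum>u\<in>K. Poly_Mapping.lookup f u * \<gamma> u)"
  unfolding ev_def using assms
  by (intro sum.mono_neutral_left) (auto simp: in_keys_iff)

lemma ev_add: "ev \<gamma> (f + g) = ev \<gamma> f + ev \<gamma> g"
proof -
  let ?K = "Poly_Mapping.keys f \<union> Poly_Mapping.keys g"
  have "ev \<gamma> (f + g) = (\<Sum>u\<in>?K. Poly_Mapping.lookup (f + g) u * \<gamma> u)"
    using Poly_Mapping.keys_add[of f g] by (intro ev_superset) auto
  also have "\<dots> = (\<Sum>u\<in>?K. Poly_Mapping.lookup f u * \<gamma> u) + (\<Sum>u\<in>?K. Poly_Mapping.lookup g u * \<gamma> u)"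
    by (simp add: lookup_add distrib_right sum.distrib)
  also have "(\<Sum>u\<in>?K. Poly_Mapping.lookup f u * \<gamma> u) = ev \<gamma> f"
    by (intro ev_superset[symmetric]) auto
  also have "(\<Sum>u\<in>?K. Poly_Mapping.lookup g u * \<gamma> u) = ev \<gamma> g"
    by (intro ev_superset[symmetric]) auto
  finally show ?thesis .
qed

lemma ev_0 [simp]: "ev \<gamma> 0 = 0"
  by (simp add: ev_def)

lemma ev_diff: "ev \<gamma> (f - g) = ev \<gamma> f - ev \<gamma> g"
  using ev_add[of \<gamma> "f - g" g] by simp

lemma ev_single [simp]: "ev \<gamma> (Poly_Mapping.single u c) = c * \<gamma> u"
  by (simp add: ev_def)

lemma ev_sum: "ev \<gamma> (sum f I) = (\<Sum>i\<in>I. ev \<gamma> (f i))"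
  by (induct I rule: infinite_finite_induct) (auto simp: ev_add)

lemma poly_mapping_sum_singles:
  fixes f :: "'a \<Rightarrow>\<^sub>0 'b::comm_monoid_add"
  shows "f = (\<Sum>u\<in>Poly_Mapping.keys f. Poly_Mapping.single u (Poly_Mapping.lookup f u))"
proof (rule poly_mapping_eqI)
  fix w
  have "(\<Sum>u\<in>Poly_Mapping.keys f. Poly_Mapping.lookup (Poly_Mapping.single u (Poly_Mapping.lookup f u)) w)
      = (\<Sum>u\<in>Poly_Mapping.keys f. if w = u then Poly_Mapping.lookup f w else 0)"
    by (intro sum.cong) (auto simp: lookup_single when_def)
  also have "\<dots> = Poly_Mapping.lookup f w"
    by (simp add: in_keys_iff)
  finally show "Poly_Mapping.lookup f w = Poly_Mapping.lookup
      (\<Sum>u\<in>Poly_Mapping.keys f. Poly_Mapping.single u (Poly_Mapping.lookup f u)) w"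
    by (simp add: lookup_sum)
qed

lemma ev_mult:
  assumes \<gamma>: "monoid_hom S \<gamma>" and f: "Poly_Mapping.keys f \<subseteq> S" and g: "Poly_Mapping.keys g \<subseteq> S"
  shows "ev \<gamma> (f * g) = ev \<gamma> f * ev \<gamma> g"
proof -
  let ?s = "\<lambda>f u. Poly_Mapping.single u (Poly_Mapping.lookup f u)"
  have "f * g = (\<Sum>u\<in>Poly_Mapping.keys f. \<Sum>w\<in>Poly_Mapping.keys g. ?s f u * ?s g w)"
    by (subst poly_mapping_sum_singles[of f], subst poly_mapping_sum_singles[of g])
      (simp add: sum_product)
  then have "ev \<gamma> (f * g) = (\<Sum>u\<in>Poly_Mapping.keys f. \<Sum>w\<in>Poly_Mapping.keys g.
      Poly_Mapping.lookup f u * Poly_Mapping.lookup g w * \<gamma> (u + w))"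
    by (simp add: ev_sum mult_single)
  also have "\<dots> = (\<Sum>u\<in>Poly_Mapping.keys f. \<Sum>w\<in>Poly_Mapping.keys g.
      (Poly_Mapping.lookup f u * \<gamma> u) * (Poly_Mapping.lookup g w * \<gamma> w))"
    using \<gamma> f g by (intro sum.cong refl) (auto simp: monoid_hom_def)
  finally show ?thesis by (simp add: ev_def sum_product)
qed

lemma sub_ring_carrier:
  assumes S: "submonoid_set S"
  shows "sub_ring (carrier (semigroup_ring S) :: (('v \<Rightarrow> real) \<Rightarrow>\<^sub>0 'k::field) set)"
proof -
  have "Poly_Mapping.keys (f - g) \<subseteq> S" "Poly_Mapping.keys (f * g) \<subseteq> S"
    if "Poly_Mapping.keys f \<subseteq> S" "Poly_Mapping.keys g \<subseteq> S" for f g :: "('v \<Rightarrow> real) \<Rightarrow>\<^sub>0 'k"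
  proof -
    show "Poly_Mapping.keys (f - g) \<subseteq> S"
    proof
      fix u assume "u \<in> Poly_Mapping.keys (f - g)"
      then have "u \<in> Poly_Mapping.keys f \<or> u \<in> Poly_Mapping.keys g"
        by (auto simp: in_keys_iff lookup_minus)
      then show "u \<in> S" using that by blast
    qed
    show "Poly_Mapping.keys (f * g) \<subseteq> S"
      using that S Poly_Mapping.keys_mult[of f g] unfolding submonoid_set_def by blast
  qed
  then show ?thesis
    using S by (auto simp: sub_ring_def mem_carrier_semigroup_ring submonoid_set_def)
qed

lemma single_mem_carrier: "u \<in> S \<Longrightarrow> Poly_Mapping.single u c \<in> carrier (semigroup_ring S)"
  by (simp add: mem_carrier_semigroup_ring)

lemma semigroup_ring_simps:
  "mult (semigroup_ring S) = (*)" "add (semigroup_ring S) = (+)"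
  "one (semigroup_ring S) = 1" "zero (semigroup_ring S) = 0"
  by (simp_all add: semigroup_ring_def)

lemma cring_semigroup_ring:
  assumes S: "submonoid_set S"
  shows "cring (semigroup_ring S :: (('v \<Rightarrow> real) \<Rightarrow>\<^sub>0 'k::field) ring)"
proof -
  note cl = sub_ring_closed[OF sub_ring_carrier[OF S, where 'k = 'k]]
  show ?thesis
  proof (rule cringI)
    show "abelian_group (semigroup_ring S :: (('v \<Rightarrow> real) \<Rightarrow>\<^sub>0 'k) ring)"
    proof (rule abelian_groupI; unfold semigroup_ring_simps)
      fix x :: "('v \<Rightarrow> real) \<Rightarrow>\<^sub>0 'k" assume "x \<in> carrier (semigroup_ring S)"
      then show "\<exists>y\<in>carrier (semigroup_ring S). y + x = 0"
        by (intro bexI[of _ "- x"]) (auto intro: cl)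
    qed (auto intro: cl simp: algebra_simps)
    show "comm_monoid (semigroup_ring S :: (('v \<Rightarrow> real) \<Rightarrow>\<^sub>0 'k) ring)"
      by (rule comm_monoidI; unfold semigroup_ring_simps) (auto intro: cl simp: algebra_simps)
  qed (auto simp: semigroup_ring_simps algebra_simps)
qed

text \<open>Carries ideals of the record structure over to the ring operations of the type.\<close>

lemma ideal_semigroup_ringD:
  fixes I :: "(('v \<Rightarrow> real) \<Rightarrow>\<^sub>0 'k::field) set"
  assumes S: "submonoid_set S" and I: "ideal I (semigroup_ring S)"
  shows "I \<subseteq> carrier (semigroup_ring S)" "0 \<in> I"
    "x \<in> carrier (semigroup_ring S) \<Longrightarrow> y \<in> I \<Longrightarrow> x * y \<in> I"
    "x \<in> I \<Longrightarrow> y \<in> I \<Longrightarrow> x + y \<in> I"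
    "x \<in> I \<Longrightarrow> y \<in> I \<Longrightarrow> x - y \<in> I"
    "1 \<in> I \<Longrightarrow> I = carrier (semigroup_ring S)"
proof -
  interpret ideal I "semigroup_ring S" by (rule I)
  note cl = sub_ring_closed[OF sub_ring_carrier[OF S, where 'k = 'k]]
  show "I \<subseteq> carrier (semigroup_ring S)" by (rule a_subset)
  show "0 \<in> I" using additive_subgroup.zero_closed[OF ideal.axioms(1)[OF I]]
    by (simp add: semigroup_ring_simps)
  show mult: "x * y \<in> I" if "x \<in> carrier (semigroup_ring S)" "y \<in> I" for x y
    using I_l_closed[OF that(2,1)] by (simp add: semigroup_ring_simps)
  show add: "x + y \<in> I" if "x \<in> I" "y \<in> I" for x y
    using additive_subgroup.a_closed[OF ideal.axioms(1)[OF I] that] by (simp add: semigroup_ring_simps)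
  show "x - y \<in> I" if "x \<in> I" "y \<in> I" for x y
  proof -
    have "(- 1) * y \<in> I" by (rule mult[OF cl(5)[OF cl(2)] that(2)])
    then show ?thesis using add[OF that(1), of "(- 1) * y"] by simp
  qed
  show "I = carrier (semigroup_ring S)" if "1 \<in> I"
    using one_imp_carrier that by (simp add: semigroup_ring_simps)
qed

lemma ideal_point:
  fixes \<gamma> :: "('v \<Rightarrow> real) \<Rightarrow> 'k::field"
  assumes S: "submonoid_set S" and \<gamma>: "monoid_hom S \<gamma>"
  shows "ideal (point S \<gamma>) (semigroup_ring S)"
proof -
  note cl = sub_ring_closed[OF sub_ring_carrier[OF S, where 'k = 'k]]
  interpret cring "semigroup_ring S :: (('v \<Rightarrow> real) \<Rightarrow>\<^sub>0 'k) ring"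
    by (rule cring_semigroup_ring[OF S])
  have ev_mult': "ev \<gamma> (x * y) = ev \<gamma> x * ev \<gamma> y"
    if "x \<in> carrier (semigroup_ring S)" "y \<in> carrier (semigroup_ring S)" for x y
    using that ev_mult[OF \<gamma>] by (simp add: mem_carrier_semigroup_ring)
  have minus: "(\<ominus>\<^bsub>semigroup_ring S\<^esub> x) = - x" if "x \<in> carrier (semigroup_ring S)"
    for x :: "('v \<Rightarrow> real) \<Rightarrow>\<^sub>0 'k"
    using that by (intro minus_equality) (auto simp: semigroup_ring_simps intro: cl)
  show ?thesis
  proof (rule idealI)
    show "ring (semigroup_ring S :: (('v \<Rightarrow> real) \<Rightarrow>\<^sub>0 'k) ring)" by (rule ring_axioms)
    show "subgroup (point S \<gamma>) (add_monoid (semigroup_ring S))"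
    proof (rule add.subgroupI)
      show "point S \<gamma> \<subseteq> carrier (semigroup_ring S)" by (auto simp: point_def)
      show "point S \<gamma> \<noteq> {}" using cl(1) by (auto simp: point_def)
      show "\<ominus>\<^bsub>semigroup_ring S\<^esub> a \<in> point S \<gamma>" if "a \<in> point S \<gamma>" for a
        using that ev_diff[of \<gamma> 0 a] by (auto simp: point_def minus intro: cl)
      show "a \<oplus>\<^bsub>semigroup_ring S\<^esub> b \<in> point S \<gamma>" if "a \<in> point S \<gamma>" "b \<in> point S \<gamma>" for a b
        using that by (auto simp: point_def semigroup_ring_simps ev_add intro: cl)
    qed
    fix a x assume "a \<in> point S \<gamma>" "x \<in> carrier (semigroup_ring S :: (('v \<Rightarrow> real) \<Rightarrow>\<^sub>0 'k) ring)"
    then show "x \<otimes>\<^bsub>semigroup_ring S\<^esub> a \<in> point S \<gamma>" "a \<otimes>\<^bsub>semigroup_ring S\<^esub> x \<in> point S \<gamma>"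
      by (auto simp: point_def semigroup_ring_simps ev_mult' intro: cl)
  qed
qed

lemma one_notin_point:
  assumes "monoid_hom S \<gamma>" shows "1 \<notin> point S \<gamma>"
  using assms ev_single[of \<gamma> 0 1] by (auto simp: point_def monoid_hom_def)

text \<open>The residue field is \<open>k\<close>: every element is congruent to exactly one scalar,
  so the description in \<open>value_at\<close> is definite.\<close>

lemma diff_const_mem_point:
  assumes S: "submonoid_set S" and \<gamma>: "monoid_hom S \<gamma>" and f: "f \<in> carrier (semigroup_ring S)"
  shows "f - Poly_Mapping.single 0 c \<in> point S \<gamma> \<longleftrightarrow> ev \<gamma> f = c"
proof -
  have "Poly_Mapping.single 0 c \<in> carrier (semigroup_ring S)"
    using S by (intro single_mem_carrier) (simp add: submonoid_set_def)
  then show ?thesis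
    using sub_ring_diff[OF sub_ring_carrier[OF S] f] \<gamma>
    by (simp add: point_def ev_diff monoid_hom_def)
qed

text \<open>An element of a larger ideal with value c \<noteq> 0 differs from the scalar c by an
  element of the kernel; the larger ideal therefore contains c, a unit.\<close>

lemma point_mem_closed_points:
  fixes \<gamma> :: "('v \<Rightarrow> real) \<Rightarrow> 'k::field"
  assumes S: "submonoid_set S" and \<gamma>: "monoid_hom S \<gamma>"
  shows "point S \<gamma> \<in> closed_points S"
proof -
  have "maximalideal (point S \<gamma>) (semigroup_ring S)"
  proof (rule maximalidealI)
    show "ideal (point S \<gamma>) (semigroup_ring S)" by (rule ideal_point[OF S \<gamma>])
    show "carrier (semigroup_ring S) \<noteq> point S \<gamma>"
      using one_notin_point[OF \<gamma>] sub_ring_1[OF sub_ring_carrier[OF S]] by blast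
    fix J assume J: "ideal J (semigroup_ring S)" "point S \<gamma> \<subseteq> J" "J \<subseteq> carrier (semigroup_ring S)"
    note Jd = ideal_semigroup_ringD[OF S J(1)]
    show "J = point S \<gamma> \<or> J = carrier (semigroup_ring S)"
    proof (cases "J = point S \<gamma>")
      case False
      then obtain j where j: "j \<in> J" "j \<notin> point S \<gamma>" using J(2) by blast
      then have jc: "j \<in> carrier (semigroup_ring S)" using J(3) by blast
      define c where "c = ev \<gamma> j"
      have c0: "c \<noteq> 0" using j jc by (simp add: point_def c_def)
      have "j - Poly_Mapping.single 0 c \<in> J"
        using diff_const_mem_point[OF S \<gamma> jc] J(2) by (auto simp: c_def)
      then have "j - (j - Poly_Mapping.single 0 c) \<in> J" using Jd(5) j(1) by blast
      then have "Poly_Mapping.single 0 (inverse c) * Poly_Mapping.single 0 c \<in> J"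
        using S by (intro Jd(3)) (auto simp: submonoid_set_def intro: single_mem_carrier)
      then have "1 \<in> J" using c0 by (simp add: mult_single)
      then show ?thesis using Jd(6) by blast
    qed blast
  qed
  then show ?thesis by (simp add: closed_points_def)
qed

lemma value_at_point:
  assumes "submonoid_set S" "monoid_hom S \<gamma>" "f \<in> carrier (semigroup_ring S)"
  shows "value_at f (point S \<gamma>) = ev \<gamma> f"
  unfolding value_at_def diff_const_mem_point[OF assms] by (rule the_equality) auto

lemma value_at_single_point:
  assumes "submonoid_set S" "monoid_hom S \<gamma>" "u \<in> S"
  shows "value_at (Poly_Mapping.single u 1) (point S \<gamma>) = \<gamma> u"
  using value_at_point[OF assms(1,2) single_mem_carrier[OF assms(3)]] by simp

lemma point_cong:
  assumes "\<And>u. u \<in> S \<Longrightarrow> \<gamma> u = \<delta> u"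
  shows "point S \<gamma> = point S \<delta>"
proof -
  have "ev \<gamma> f = ev \<delta> f" if "f \<in> carrier (semigroup_ring S)" for f
    unfolding ev_def using that assms
    by (intro sum.cong) (auto simp: mem_carrier_semigroup_ring)
  then show ?thesis by (auto simp: point_def)
qed

lemma point_eq_iff:
  assumes S: "submonoid_set S" and "monoid_hom S \<gamma>" "monoid_hom S \<delta>"
  shows "point S \<gamma> = point S \<delta> \<longleftrightarrow> (\<forall>u\<in>S. \<gamma> u = \<delta> u)"
  using value_at_single_point[OF S] assms point_cong by metis

text \<open>For homomorphisms the map between the spectra is restriction; gluing thereby becomes a
  question of extending homomorphisms.\<close>

lemma contract_point:
  assumes "S \<subseteq> S'" shows "contract S (point S' \<gamma>) = point S \<gamma>"
  using assms by (auto simp: contract_def point_def mem_carrier_semigroup_ring)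

lemma monoid_hom_subset: "monoid_hom S' \<gamma> \<Longrightarrow> S \<subseteq> S' \<Longrightarrow> monoid_hom S \<gamma>"
  by (auto simp: monoid_hom_def)

text \<open>
  Nullstellensatz: the identity of \<open>k\<close> extends, one monomial generator at a time, to a
  homomorphism \<open>k[S] \<rightarrow> k\<close> that vanishes on a given maximal ideal.
\<close>

lemma closed_points_eq_points:
  fixes S :: "('v \<Rightarrow> real) set"
  assumes S: "submonoid_set S" and G: "finite G" "G \<subseteq> S" "S \<subseteq> monoid_span G"
  shows "closed_points S = {point S \<gamma> |\<gamma> :: ('v \<Rightarrow> real) \<Rightarrow> 'k::alg_closed_field. monoid_hom S \<gamma>}"
proof (intro equalityI subsetI)
  fix m :: "(('v \<Rightarrow> real) \<Rightarrow>\<^sub>0 'k) set" assume "m \<in> closed_points S"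
  then have max: "maximalideal m (semigroup_ring S)" by (simp add: closed_points_def)
  then have id: "ideal m (semigroup_ring S)" by (rule maximalideal.axioms(1))
  note md = ideal_semigroup_ringD[OF S id]
  define C where "C = (carrier (semigroup_ring S) :: (('v \<Rightarrow> real) \<Rightarrow>\<^sub>0 'k) set)"
  have C: "sub_ring C" unfolding C_def by (rule sub_ring_carrier[OF S])
  note cl = sub_ring_closed[OF C]
  have "primeideal m (semigroup_ring S)"
    by (rule cring.maximalideal_prime[OF cring_semigroup_ring[OF S] max])
  then have prime: "x \<in> m \<or> y \<in> m" if "x \<in> C" "y \<in> C" "x * y \<in> m" for x y
    using primeideal.I_prime[of m "semigroup_ring S" x y] that
    by (simp add: C_def semigroup_ring_simps)
  interpret prime_ideal_in C m
  proof
    show "1 \<notin> m" using md(6) maximalideal.I_notcarr[OF max] by blast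
  qed (use C md prime in \<open>auto simp: C_def\<close>)
  define A :: "(('v \<Rightarrow> real) \<Rightarrow>\<^sub>0 'k) set" where "A = range (Poly_Mapping.single 0)"
  have "1 \<in> A" unfolding A_def by (rule image_eqI[of _ _ 1]) simp_all
  then have A: "sub_ring A"
    unfolding sub_ring_def by (auto simp: A_def single_diff[symmetric] mult_single)
  have AC: "A \<subseteq> C" using S by (auto simp: A_def C_def mem_carrier_semigroup_ring submonoid_set_def)
  obtain gs where gs: "set gs = G" using finite_list[OF G(1)] by blast
  define xs where "xs = map (\<lambda>g. Poly_Mapping.single g (1 :: 'k)) gs"
  have xsC: "set xs \<subseteq> C" using G(2) by (auto simp: xs_def gs C_def mem_carrier_semigroup_ring)
  define R where "R = foldl adjoin A xs"
  have R: "sub_ring R" "A \<subseteq> R" "set xs \<subseteq> R"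
    using sub_ring_foldl_adjoin[OF A, of xs] by (auto simp: R_def)
  have single_R: "Poly_Mapping.single u c \<in> R" if "u \<in> monoid_span G" for u c
    using that
  proof (induct arbitrary: c)
    case zero
    then show ?case using R(2) unfolding A_def by blast
  next
    case (add g a)
    have "Poly_Mapping.single g 1 \<in> R" using add(1) R(3) gs by (auto simp: xs_def)
    then have "Poly_Mapping.single g 1 * Poly_Mapping.single a c \<in> R"
      using add(3) by (rule sub_ring_mult[OF R(1)])
    then show ?case by (simp only: mult_single mult_1_left)
  qed
  have CR: "C \<subseteq> R"
  proof
    fix f assume f: "f \<in> C"
    show "f \<in> R"
      apply (subst poly_mapping_sum_singles)
      using f G(3) by (intro sub_ring_sum[OF R(1)] single_R) (auto simp: C_def mem_carrier_semigroup_ring)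
  qed
  define \<phi>0 :: "(('v \<Rightarrow> real) \<Rightarrow>\<^sub>0 'k) \<Rightarrow> 'k" where "\<phi>0 f = Poly_Mapping.lookup f 0" for f
  have const_m: "c = 0" if "Poly_Mapping.single 0 c \<in> m" for c :: 'k
  proof (rule ccontr)
    assume "c \<noteq> 0"
    moreover have "Poly_Mapping.single 0 (inverse c) * Poly_Mapping.single 0 c \<in> m"
      using that AC by (intro m_mult) (auto simp: A_def)
    ultimately show False using m_one by (simp add: mult_single)
  qed
  have hom0: "hom_mod A \<phi>0"
    using const_m by (auto simp: hom_mod_def A_def \<phi>0_def lookup_one lookup_add mult_single)
  \<comment> \<open>With \<open>b = 1\<close> nothing beyond the existence of an extension is
    required; the element \<open>a\<close> obtained from it is a nonzero constant, which
    \<open>\<phi>0\<close> does not kill.\<close>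
  have one_R: "1 \<in> foldl adjoin A xs" using sub_ring_1[OF R(1)] by (simp add: R_def)
  obtain a where a: "a \<in> A" "a \<notin> m" and aex: "\<And>\<phi> :: (('v \<Rightarrow> real) \<Rightarrow>\<^sub>0 'k) \<Rightarrow> 'k. hom_mod A \<phi> \<Longrightarrow>
      \<phi> a \<noteq> 0 \<Longrightarrow> \<exists>\<psi>. hom_mod R \<psi> \<and> (\<forall>y\<in>A. \<psi> y = \<phi> y) \<and> \<psi> 1 \<noteq> 0"
    using extend_hom_fold[OF A AC xsC one_R m_one] unfolding R_def by blast
  have "\<phi>0 a \<noteq> 0" using a m_zero by (auto simp: A_def \<phi>0_def)
  then obtain \<psi> where \<psi>: "hom_mod R \<psi>" "\<forall>y\<in>A. \<psi> y = \<phi>0 y" using aex[OF hom0] by blast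
  define \<gamma> where "\<gamma> u = \<psi> (Poly_Mapping.single u 1)" for u
  have \<psi>_ev: "\<psi> f = ev \<gamma> f" if f: "f \<in> C" for f
  proof -
    have keys: "Poly_Mapping.keys f \<subseteq> monoid_span G"
      using f G(3) by (auto simp: C_def mem_carrier_semigroup_ring)
    have "\<psi> f = (\<Sum>u\<in>Poly_Mapping.keys f. \<psi> (Poly_Mapping.single u (Poly_Mapping.lookup f u)))"
      by (subst poly_mapping_sum_singles, subst hom_mod_sum[OF R(1) \<psi>(1)])
        (use single_R keys in auto)
    also have "\<dots> = ev \<gamma> f"
      unfolding ev_def
    proof (rule sum.cong[OF refl])
      fix u assume u: "u \<in> Poly_Mapping.keys f"
      let ?c = "Poly_Mapping.lookup f u"
      have "\<psi> (Poly_Mapping.single 0 ?c * Poly_Mapping.single u 1)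
          = \<psi> (Poly_Mapping.single 0 ?c) * \<psi> (Poly_Mapping.single u 1)"
        using u keys R(2) by (intro hom_modD(3)[OF \<psi>(1)]) (auto simp: A_def intro: single_R)
      then show "\<psi> (Poly_Mapping.single u ?c) = ?c * \<gamma> u"
        using \<psi>(2) by (simp add: mult_single \<gamma>_def A_def \<phi>0_def)
    qed
    finally show ?thesis .
  qed
  have \<gamma>: "monoid_hom S \<gamma>"
    unfolding monoid_hom_def
  proof (intro conjI ballI)
    show "\<gamma> 0 = 1" using hom_modD(1)[OF \<psi>(1)] by (simp add: \<gamma>_def)
    fix u w assume "u \<in> S" "w \<in> S"
    then have "\<psi> (Poly_Mapping.single u 1 * Poly_Mapping.single w 1) = \<gamma> u * \<gamma> w"
      unfolding \<gamma>_def using G(3) by (intro hom_modD(3)[OF \<psi>(1)] single_R) auto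
    then show "\<gamma> (u + w) = \<gamma> u * \<gamma> w" by (simp add: \<gamma>_def mult_single)
  qed
  have "m \<subseteq> point S \<gamma>"
  proof
    fix f assume f: "f \<in> m"
    then have fC: "f \<in> C" using m_subset by blast
    then have "\<psi> f = 0" using hom_modD(4)[OF \<psi>(1)] f CR by blast
    then show "f \<in> point S \<gamma>" using fC \<psi>_ev by (simp add: point_def C_def)
  qed
  moreover have "point S \<gamma> \<subseteq> carrier (semigroup_ring S)" by (auto simp: point_def)
  ultimately have "point S \<gamma> = m \<or> point S \<gamma> = carrier (semigroup_ring S)"
    using maximalideal.I_maximal[OF max ideal_point[OF S \<gamma>]] by blast
  moreover have "point S \<gamma> \<noteq> carrier (semigroup_ring S)"
    using one_notin_point[OF \<gamma>] cl(2) by (auto simp: C_def)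
  ultimately show "m \<in> {point S \<gamma> |\<gamma>. monoid_hom S \<gamma>}" using \<gamma> by blast
qed (use point_mem_closed_points[OF S] in blast)

section \<open>Spaces of functions\<close>

text \<open>
  The functions in \<open>A\<close> only matter on \<open>X\<close>, so \<open>A\<close> is an algebra only up to their values
  outside \<open>X\<close>.
\<close>

locale function_algebra =
  fixes X :: "'x set" and A :: "('x \<Rightarrow> 'k::field) set"
  assumes zero: "\<exists>c\<in>A. \<forall>x\<in>X. c x = 0"
    and one: "\<exists>c\<in>A. \<forall>x\<in>X. c x = 1"
    and add: "a \<in> A \<Longrightarrow> b \<in> A \<Longrightarrow> \<exists>c\<in>A. \<forall>x\<in>X. c x = a x + b x"
    and mult: "a \<in> A \<Longrightarrow> b \<in> A \<Longrightarrow> \<exists>c\<in>A. \<forall>x\<in>X. c x = a x * b x"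
begin

abbreviation Z :: "'x topology" where "Z \<equiv> top_of (fspace_of X A)"
abbreviation R :: "'x set \<Rightarrow> ('x \<Rightarrow> 'k) set" where "R \<equiv> regular (fspace_of X A)"

lemma top_eq: "Z = topology_generated_by {{x \<in> X. b x \<noteq> 0} |b. b \<in> A}"
  by (simp add: fspace_of_def Let_def)

lemma regular_def': "R U = {f. \<forall>x\<in>U. \<exists>V. openin Z V \<and> x \<in> V \<and> V \<subseteq> U \<and>
    (\<exists>a\<in>A. \<exists>b\<in>A. \<forall>y\<in>V. b y \<noteq> 0 \<and> f y = a y / b y)}"
  by (simp add: fspace_of_def Let_def)

lemma topspace_Z [simp]: "topspace Z = X"
proof -
  obtain c where c: "c \<in> A" "\<forall>x\<in>X. c x = 1" using one by blast
  then have "X = {x \<in> X. c x \<noteq> 0}" by auto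
  then have "X \<in> {{x \<in> X. b x \<noteq> 0} |b. b \<in> A}" using c(1) by blast
  then show ?thesis unfolding top_eq topology_generated_by_topspace by blast
qed

lemma openin_nonzero: "a \<in> A \<Longrightarrow> openin Z {x \<in> X. a x \<noteq> 0}"
  unfolding top_eq by (rule topology_generated_by_Basis) blast

text \<open>Closure of \<open>A\<close> under products makes finite intersections of the generating
  loci loci again, so that they form a basis.\<close>

lemma openin_basis:
  assumes "openin Z V" "x \<in> V"
  shows "\<exists>b\<in>A. b x \<noteq> 0 \<and> {y \<in> X. b y \<noteq> 0} \<subseteq> V"
proof -
  have "generate_topology_on {{x \<in> X. b x \<noteq> 0} |b. b \<in> A} V"
    using assms(1) unfolding top_eq by (rule openin_topology_generated_by)
  then show ?thesis using assms(2)
  proof (induct arbitrary: x)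
    case (Int V W)
    obtain b c where bc: "b \<in> A" "b x \<noteq> 0" "{y \<in> X. b y \<noteq> 0} \<subseteq> V"
      "c \<in> A" "c x \<noteq> 0" "{y \<in> X. c y \<noteq> 0} \<subseteq> W"
      using Int.hyps(2)[of x] Int.hyps(4)[of x] Int.prems by blast
    obtain d where d: "d \<in> A" "\<forall>x\<in>X. d x = b x * c x" using mult[OF bc(1,4)] by blast
    have "V \<subseteq> X"
      using Int.hyps(1) openin_subset[of Z V] topspace_Z
      unfolding top_eq openin_topology_generated_by_iff by blast
    then have "d x \<noteq> 0" using d(2) bc Int.prems by auto
    moreover have "{y \<in> X. d y \<noteq> 0} \<subseteq> V \<inter> W" using d(2) bc(3,6) by auto
    ultimately show ?case using d(1) by blast
  next
    case (UN K)
    then obtain k where k: "k \<in> K" "x \<in> k" by blast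
    then obtain b where "b \<in> A" "b x \<noteq> 0" "{y \<in> X. b y \<noteq> 0} \<subseteq> k" using UN.hyps(2) by blast
    then show ?case using k(1) by blast
  qed auto
qed

lemma openinI:
  assumes "\<And>x. x \<in> V \<Longrightarrow> \<exists>W. openin Z W \<and> x \<in> W \<and> W \<subseteq> V" shows "openin Z V"
  using assms by (subst openin_subopen) blast

lemma openin_Z_subset: "openin Z V \<Longrightarrow> V \<subseteq> X"
  using openin_subset[of Z V] by simp

text \<open>Expanding the fraction by a function whose locus lies in the given neighbourhood lets
  the locus of the denominator itself serve as the neighbourhood. This normal form makes sums and
  products of fractions easy to handle.\<close>

lemma regularD:
  assumes "f \<in> R U" "x \<in> U"
  shows "\<exists>a\<in>A. \<exists>b\<in>A. b x \<noteq> 0 \<and> {y \<in> X. b y \<noteq> 0} \<subseteq> U \<and> (\<forall>y\<in>X. b y \<noteq> 0 \<longrightarrow> f y = a y / b y)"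
proof -
  obtain V a b where V: "openin Z V" "x \<in> V" "V \<subseteq> U" and ab: "a \<in> A" "b \<in> A"
    and fV: "\<forall>y\<in>V. b y \<noteq> 0 \<and> f y = a y / b y"
    using assms unfolding regular_def' by blast
  obtain c where c: "c \<in> A" "c x \<noteq> 0" "{y \<in> X. c y \<noteq> 0} \<subseteq> V" using openin_basis[OF V(1,2)] by blast
  obtain a' where a': "a' \<in> A" "\<forall>x\<in>X. a' x = a x * c x" using mult[OF ab(1) c(1)] by blast
  obtain b' where b': "b' \<in> A" "\<forall>x\<in>X. b' x = b x * c x" using mult[OF ab(2) c(1)] by blast
  have "x \<in> X" using V openin_Z_subset by blast
  then have "b' x \<noteq> 0" using b'(2) fV V(2) c(2) by simp
  moreover have "{y \<in> X. b' y \<noteq> 0} \<subseteq> U" using b'(2) c(3) V(3) by auto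
  moreover have "\<forall>y\<in>X. b' y \<noteq> 0 \<longrightarrow> f y = a' y / b' y"
    using a'(2) b'(2) fV c(3) by auto
  ultimately show ?thesis using a'(1) b'(1) by blast
qed

lemma regularI:
  assumes "U \<subseteq> X" and "\<And>x. x \<in> U \<Longrightarrow> \<exists>a\<in>A. \<exists>b\<in>A. b x \<noteq> 0 \<and> {y \<in> X. b y \<noteq> 0} \<subseteq> U \<and>
    (\<forall>y\<in>X. b y \<noteq> 0 \<longrightarrow> f y = a y / b y)"
  shows "f \<in> R U"
  unfolding regular_def' mem_Collect_eq
proof
  fix x assume x: "x \<in> U"
  from assms(2)[OF this] obtain a b where
    ab: "a \<in> A" "b \<in> A" "b x \<noteq> 0" "{y \<in> X. b y \<noteq> 0} \<subseteq> U"
    "\<forall>y\<in>X. b y \<noteq> 0 \<longrightarrow> f y = a y / b y" by blast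
  show "\<exists>V. openin Z V \<and> x \<in> V \<and> V \<subseteq> U \<and> (\<exists>a\<in>A. \<exists>b\<in>A. \<forall>y\<in>V. b y \<noteq> 0 \<and> f y = a y / b y)"
  proof (intro exI[of _ "{y \<in> X. b y \<noteq> 0}"] conjI)
    show "\<exists>a\<in>A. \<exists>b'\<in>A. \<forall>y\<in>{y \<in> X. b y \<noteq> 0}. b' y \<noteq> 0 \<and> f y = a y / b' y"
      using ab(5) by (intro bexI[OF _ ab(1)] bexI[OF _ ab(2)]) simp
    show "x \<in> {y \<in> X. b y \<noteq> 0}" using x assms(1) ab(3) by auto
  qed (rule openin_nonzero[OF ab(2)], rule ab(4))
qed

lemma regular_cong:
  assumes "f \<in> R U" "\<And>x. x \<in> U \<Longrightarrow> f x = g x" shows "g \<in> R U"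
  unfolding regular_def' mem_Collect_eq
proof
  fix x assume "x \<in> U"
  then obtain V a b where V: "openin Z V" "x \<in> V" "V \<subseteq> U" and ab: "a \<in> A" "b \<in> A"
    and f: "\<forall>y\<in>V. b y \<noteq> 0 \<and> f y = a y / b y"
    using assms(1) unfolding regular_def' by blast
  have "\<forall>y\<in>V. b y \<noteq> 0 \<and> g y = a y / b y" using f assms(2) V(3) by (metis subsetD)
  then show "\<exists>V. openin Z V \<and> x \<in> V \<and> V \<subseteq> U \<and>
      (\<exists>a\<in>A. \<exists>b\<in>A. \<forall>y\<in>V. b y \<noteq> 0 \<and> g y = a y / b y)"
    using V ab by blast
qed

lemma regular_restrict:
  assumes "f \<in> R U" "openin Z V" "V \<subseteq> U" shows "f \<in> R V"
  unfolding regular_def' mem_Collect_eq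
proof
  fix x assume x: "x \<in> V"
  then obtain W a b where W: "openin Z W" "x \<in> W" and ab: "a \<in> A" "b \<in> A"
    and f: "\<forall>y\<in>W. b y \<noteq> 0 \<and> f y = a y / b y"
    using assms unfolding regular_def' by blast
  have "\<forall>y\<in>W \<inter> V. b y \<noteq> 0 \<and> f y = a y / b y" using f by blast
  then show "\<exists>V'. openin Z V' \<and> x \<in> V' \<and> V' \<subseteq> V \<and>
      (\<exists>a\<in>A. \<exists>b\<in>A. \<forall>y\<in>V'. b y \<noteq> 0 \<and> f y = a y / b y)"
    using openin_Int[OF W(1) assms(2)] x W(2) ab by blast
qed

lemma regular_local:
  assumes "\<And>x. x \<in> U \<Longrightarrow> \<exists>V. openin Z V \<and> x \<in> V \<and> V \<subseteq> U \<and> f \<in> R V"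
  shows "f \<in> R U"
  unfolding regular_def' mem_Collect_eq
proof
  fix x assume x: "x \<in> U"
  then obtain V where V: "openin Z V" "x \<in> V" "V \<subseteq> U" "f \<in> R V" using assms by blast
  then show "\<exists>V. openin Z V \<and> x \<in> V \<and> V \<subseteq> U \<and> (\<exists>a\<in>A. \<exists>b\<in>A. \<forall>y\<in>V. b y \<noteq> 0 \<and> f y = a y / b y)"
    unfolding regular_def' by blast
qed

lemma regular_quotient:
  assumes U: "openin Z U" and "a \<in> A" "b \<in> A" and "\<And>x. x \<in> U \<Longrightarrow> b x \<noteq> 0 \<and> f x = a x / b x"
  shows "f \<in> R U"
  using assms unfolding regular_def' by blast

lemma regular_one: "openin Z U \<Longrightarrow> (\<lambda>_. 1) \<in> R U"
proof -
  assume U: "openin Z U"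
  obtain c where "c \<in> A" "\<forall>x\<in>X. c x = 1" using one by blast
  then show ?thesis using openin_Z_subset[OF U] by (intro regular_quotient[OF U, of c c]) auto
qed

lemma regular_mult:
  assumes "U \<subseteq> X" "f \<in> R U" "g \<in> R U" shows "(\<lambda>x. f x * g x) \<in> R U"
proof (rule regularI[OF assms(1)])
  fix x assume x: "x \<in> U"
  obtain a b where ab: "a \<in> A" "b \<in> A" "b x \<noteq> 0" "{y \<in> X. b y \<noteq> 0} \<subseteq> U"
    "\<forall>y\<in>X. b y \<noteq> 0 \<longrightarrow> f y = a y / b y" using regularD[OF assms(2) x] by blast
  obtain c d where cd: "c \<in> A" "d \<in> A" "d x \<noteq> 0" "{y \<in> X. d y \<noteq> 0} \<subseteq> U"
    "\<forall>y\<in>X. d y \<noteq> 0 \<longrightarrow> g y = c y / d y" using regularD[OF assms(3) x] by blast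
  obtain p where p: "p \<in> A" "\<forall>x\<in>X. p x = a x * c x" using mult[OF ab(1) cd(1)] by blast
  obtain q where q: "q \<in> A" "\<forall>x\<in>X. q x = b x * d x" using mult[OF ab(2) cd(2)] by blast
  show "\<exists>a\<in>A. \<exists>b\<in>A. b x \<noteq> 0 \<and> {y \<in> X. b y \<noteq> 0} \<subseteq> U \<and>
      (\<forall>y\<in>X. b y \<noteq> 0 \<longrightarrow> f y * g y = a y / b y)"
  proof (rule bexI[OF _ p(1)], rule bexI[OF _ q(1)], intro conjI ballI impI)
    show "q x \<noteq> 0" using q(2) ab(3) cd(3) x assms(1) by auto
    show "{y \<in> X. q y \<noteq> 0} \<subseteq> U" using q(2) ab(4) by auto
    show "f y * g y = p y / q y" if "y \<in> X" "q y \<noteq> 0" for y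
      using that p(2) q(2) ab(5) cd(5) by simp
  qed
qed

lemma regular_add:
  assumes "U \<subseteq> X" "f \<in> R U" "g \<in> R U" shows "(\<lambda>x. f x + g x) \<in> R U"
proof (rule regularI[OF assms(1)])
  fix x assume x: "x \<in> U"
  obtain a b where ab: "a \<in> A" "b \<in> A" "b x \<noteq> 0" "{y \<in> X. b y \<noteq> 0} \<subseteq> U"
    "\<forall>y\<in>X. b y \<noteq> 0 \<longrightarrow> f y = a y / b y" using regularD[OF assms(2) x] by blast
  obtain c d where cd: "c \<in> A" "d \<in> A" "d x \<noteq> 0" "{y \<in> X. d y \<noteq> 0} \<subseteq> U"
    "\<forall>y\<in>X. d y \<noteq> 0 \<longrightarrow> g y = c y / d y" using regularD[OF assms(3) x] by blast
  obtain p where p: "p \<in> A" "\<forall>x\<in>X. p x = a x * d x" using mult[OF ab(1) cd(2)] by blast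
  obtain p' where p': "p' \<in> A" "\<forall>x\<in>X. p' x = c x * b x" using mult[OF cd(1) ab(2)] by blast
  obtain r where r: "r \<in> A" "\<forall>x\<in>X. r x = p x + p' x" using add[OF p(1) p'(1)] by blast
  obtain q where q: "q \<in> A" "\<forall>x\<in>X. q x = b x * d x" using mult[OF ab(2) cd(2)] by blast
  show "\<exists>a\<in>A. \<exists>b\<in>A. b x \<noteq> 0 \<and> {y \<in> X. b y \<noteq> 0} \<subseteq> U \<and>
      (\<forall>y\<in>X. b y \<noteq> 0 \<longrightarrow> f y + g y = a y / b y)"
  proof (rule bexI[OF _ r(1)], rule bexI[OF _ q(1)], intro conjI ballI impI)
    show "q x \<noteq> 0" using q(2) ab(3) cd(3) x assms(1) by auto
    show "{y \<in> X. q y \<noteq> 0} \<subseteq> U" using q(2) ab(4) by auto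
    show "f y + g y = r y / q y" if "y \<in> X" "q y \<noteq> 0" for y
      using that p(2) p'(2) r(2) q(2) ab(5) cd(5) by (simp add: add_frac_eq)
  qed
qed

lemma regular_zero: "openin Z U \<Longrightarrow> (\<lambda>_. 0) \<in> R U"
proof -
  assume U: "openin Z U"
  obtain c d where "c \<in> A" "\<forall>x\<in>X. c x = 1" "d \<in> A" "\<forall>x\<in>X. d x = 0" using zero one by blast
  then show ?thesis using openin_Z_subset[OF U] by (intro regular_quotient[OF U, of d c]) auto
qed

lemma openin_regular_nonzero:
  assumes U: "openin Z U" and f: "f \<in> R U"
  shows "openin Z {x \<in> U. f x \<noteq> 0}"
proof (rule openinI)
  fix x assume x: "x \<in> {x \<in> U. f x \<noteq> 0}"
  obtain a b where ab: "a \<in> A" "b \<in> A" "b x \<noteq> 0" "{y \<in> X. b y \<noteq> 0} \<subseteq> U"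
    "\<forall>y\<in>X. b y \<noteq> 0 \<longrightarrow> f y = a y / b y" using regularD[OF f, of x] x by auto
  have "openin Z ({y \<in> X. a y \<noteq> 0} \<inter> {y \<in> X. b y \<noteq> 0})"
    using openin_nonzero ab by blast
  moreover have "x \<in> X" using x openin_Z_subset[OF U] by blast
  ultimately show "\<exists>W. openin Z W \<and> x \<in> W \<and> W \<subseteq> {x \<in> U. f x \<noteq> 0}"
    using x ab(3-5) by (intro exI[of _ "{y \<in> X. a y \<noteq> 0} \<inter> {y \<in> X. b y \<noteq> 0}"]) auto
qed

lemma regular_divide:
  assumes U: "U \<subseteq> X" and f: "f \<in> R U" and g: "g \<in> R U" and nz: "\<And>x. x \<in> U \<Longrightarrow> g x \<noteq> 0"
  shows "(\<lambda>x. f x / g x) \<in> R U"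
proof -
  have "(\<lambda>x. 1 / g x) \<in> R U"
  proof (rule regularI[OF U])
    fix x assume x: "x \<in> U"
    obtain a b where ab: "a \<in> A" "b \<in> A" "b x \<noteq> 0" "{y \<in> X. b y \<noteq> 0} \<subseteq> U"
      "\<forall>y\<in>X. b y \<noteq> 0 \<longrightarrow> g y = a y / b y" using regularD[OF g x] by blast
    \<comment> \<open>The inverse b/a is expanded by \<open>b\<close>, so that the locus of its
      denominator stays inside \<open>U\<close> and inside the region where the formula for
      \<open>g\<close> holds.\<close>
    obtain p where p: "p \<in> A" "\<forall>x\<in>X. p x = a x * b x" using mult[OF ab(1,2)] by blast
    obtain q where q: "q \<in> A" "\<forall>x\<in>X. q x = b x * b x" using mult[OF ab(2,2)] by blast
    have ax: "a x \<noteq> 0" using nz[OF x] ab(3,5) x U by auto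
    show "\<exists>a\<in>A. \<exists>b\<in>A. b x \<noteq> 0 \<and> {y \<in> X. b y \<noteq> 0} \<subseteq> U \<and>
        (\<forall>y\<in>X. b y \<noteq> 0 \<longrightarrow> 1 / g y = a y / b y)"
    proof (rule bexI[OF _ q(1)], rule bexI[OF _ p(1)], intro conjI ballI impI)
      show "p x \<noteq> 0" using ax p(2) ab(3) x U by auto
      show "{y \<in> X. p y \<noteq> 0} \<subseteq> U" using p(2) ab(4) by auto
      show "1 / g y = q y / p y" if "y \<in> X" "p y \<noteq> 0" for y
        using that p(2) q(2) ab(5) by simp
    qed
  qed
  from regular_mult[OF U f this] show ?thesis by simp
qed

end

text \<open>Open sets and regular functions are both built from the algebra, so it is enough to pull
  back its elements.\<close>

lemma morphism_fspace_of:
  assumes "function_algebra X A" "function_algebra Y B"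
    and \<phi>: "\<And>x. x \<in> X \<Longrightarrow> \<phi> x \<in> Y"
    and pull: "\<And>b. b \<in> B \<Longrightarrow> \<exists>a\<in>A. \<forall>x\<in>X. a x = b (\<phi> x)"
  shows "morphism (fspace_of X A) (fspace_of Y B) \<phi>"
proof -
  interpret S: function_algebra X A by fact
  interpret T: function_algebra Y B by fact
  have cont: "openin S.Z {x \<in> X. \<phi> x \<in> V}" if V: "openin T.Z V" for V
  proof (rule S.openinI)
    fix x assume x: "x \<in> {x \<in> X. \<phi> x \<in> V}"
    then obtain b where b: "b \<in> B" "b (\<phi> x) \<noteq> 0" "{y \<in> Y. b y \<noteq> 0} \<subseteq> V"
      using T.openin_basis[OF V] by blast
    obtain a where a: "a \<in> A" "\<forall>x\<in>X. a x = b (\<phi> x)" using pull[OF b(1)] by blast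
    show "\<exists>W. openin S.Z W \<and> x \<in> W \<and> W \<subseteq> {x \<in> X. \<phi> x \<in> V}"
    proof (intro exI[of _ "{x \<in> X. a x \<noteq> 0}"] conjI)
      show "openin S.Z {x \<in> X. a x \<noteq> 0}" by (rule S.openin_nonzero[OF a(1)])
      show "x \<in> {x \<in> X. a x \<noteq> 0}" using a(2) b(2) x by simp
      show "{x \<in> X. a x \<noteq> 0} \<subseteq> {x \<in> X. \<phi> x \<in> V}" using a(2) b(3) \<phi> by auto
    qed
  qed
  have reg: "f \<circ> \<phi> \<in> S.R {x \<in> X. \<phi> x \<in> V}" if V: "openin T.Z V" "f \<in> T.R V" for V f
  proof (rule S.regularI)
    fix x assume x: "x \<in> {x \<in> X. \<phi> x \<in> V}"
    then have "\<phi> x \<in> V" by simp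
    from T.regularD[OF V(2) this] obtain a b where
      ab: "a \<in> B" "b \<in> B" "b (\<phi> x) \<noteq> 0" "{y \<in> Y. b y \<noteq> 0} \<subseteq> V"
      "\<forall>y\<in>Y. b y \<noteq> 0 \<longrightarrow> f y = a y / b y" by blast
    obtain a' where a': "a' \<in> A" "\<forall>x\<in>X. a' x = a (\<phi> x)" using pull[OF ab(1)] by blast
    obtain b' where b': "b' \<in> A" "\<forall>x\<in>X. b' x = b (\<phi> x)" using pull[OF ab(2)] by blast
    show "\<exists>a\<in>A. \<exists>b\<in>A. b x \<noteq> 0 \<and> {y \<in> X. b y \<noteq> 0} \<subseteq> {x \<in> X. \<phi> x \<in> V} \<and>
        (\<forall>y\<in>X. b y \<noteq> 0 \<longrightarrow> (f \<circ> \<phi>) y = a y / b y)"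
    proof (rule bexI[OF _ a'(1)], rule bexI[OF _ b'(1)], intro conjI ballI impI)
      show "b' x \<noteq> 0" using b'(2) ab(3) x by auto
      show "{y \<in> X. b' y \<noteq> 0} \<subseteq> {x \<in> X. \<phi> x \<in> V}" using b'(2) ab(4) \<phi> by auto
      show "(f \<circ> \<phi>) y = a' y / b' y" if "y \<in> X" "b' y \<noteq> 0" for y
        using that a'(2) b'(2) ab(5) \<phi> by simp
    qed
  qed auto
  show ?thesis
    unfolding morphism_def continuous_map_def using cont reg \<phi> by auto
qed

section \<open>Morphisms, composition and pairing\<close>

lemma morphism_points: "morphism X Y \<phi> \<Longrightarrow> x \<in> points X \<Longrightarrow> \<phi> x \<in> points Y"
  unfolding morphism_def continuous_map_def by blast

lemma morphism_openin:
  "morphism X Y \<phi> \<Longrightarrow> openin (top_of Y) V \<Longrightarrow> openin (top_of X) {x \<in> points X. \<phi> x \<in> V}"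
  unfolding morphism_def continuous_map_def by blast

lemma morphism_regular:
  "morphism X Y \<phi> \<Longrightarrow> openin (top_of Y) V \<Longrightarrow> f \<in> regular Y V \<Longrightarrow>
    f \<circ> \<phi> \<in> regular X {x \<in> points X. \<phi> x \<in> V}"
  unfolding morphism_def by blast

lemma morphism_comp:
  assumes "morphism X Y \<phi>" "morphism Y W \<psi>" shows "morphism X W (\<psi> \<circ> \<phi>)"
  unfolding morphism_def
proof (intro conjI allI impI)
  show "continuous_map (top_of X) (top_of W) (\<psi> \<circ> \<phi>)"
    using assms by (auto simp: morphism_def intro: continuous_map_compose)
  fix V f assume V: "openin (top_of W) V" "f \<in> regular W V"
  have "f \<circ> \<psi> \<circ> \<phi> \<in> regular X {x \<in> points X. \<phi> x \<in> {y \<in> points Y. \<psi> y \<in> V}}"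
    by (rule morphism_regular[OF assms(1) morphism_openin[OF assms(2) V(1)] morphism_regular[OF assms(2) V]])
  moreover have "{x \<in> points X. \<phi> x \<in> {y \<in> points Y. \<psi> y \<in> V}} = {x \<in> points X. (\<psi> \<circ> \<phi>) x \<in> V}"
    using morphism_points[OF assms(1)] by auto
  ultimately show "f \<circ> (\<psi> \<circ> \<phi>) \<in> regular X {x \<in> points X. (\<psi> \<circ> \<phi>) x \<in> V}"
    by (simp add: comp_assoc)
qed

lemma isomorphic_fspace_trans:
  assumes "isomorphic_fspace X Y" "isomorphic_fspace Y W" shows "isomorphic_fspace X W"
proof -
  obtain \<phi> \<psi> where 1: "morphism X Y \<phi>" "morphism Y X \<psi>"
    "\<forall>x\<in>points X. \<psi> (\<phi> x) = x" "\<forall>y\<in>points Y. \<phi> (\<psi> y) = y"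
    using assms(1) unfolding isomorphic_fspace_def by blast
  obtain \<alpha> \<beta> where 2: "morphism Y W \<alpha>" "morphism W Y \<beta>"
    "\<forall>x\<in>points Y. \<beta> (\<alpha> x) = x" "\<forall>y\<in>points W. \<alpha> (\<beta> y) = y"
    using assms(2) unfolding isomorphic_fspace_def by blast
  show ?thesis
    unfolding isomorphic_fspace_def
    using 1 2 morphism_comp[OF 1(1) 2(1)] morphism_comp[OF 2(2) 1(2)]
      morphism_points[OF 1(1)] morphism_points[OF 2(2)]
    by (intro exI[of _ "\<alpha> \<circ> \<phi>"] exI[of _ "\<psi> \<circ> \<beta>"]) auto
qed

text \<open>The existence half of the universal property of the product. Continuity of the
  components alone is not sufficient, as the open sets are generated by loci of tensors; the
  pull-back of a tensor is a sum of products of regular functions, hence regular with open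
  locus.\<close>

lemma morphism_pair:
  assumes fa: "function_algebra Z0 A" and \<phi>: "morphism (fspace_of Z0 A) X \<phi>"
    and \<psi>: "morphism (fspace_of Z0 A) Y \<psi>"
    and oneX: "(\<lambda>_. 1) \<in> regular X (points X)" and oneY: "(\<lambda>_. 1) \<in> regular Y (points Y)"
  shows "morphism (fspace_of Z0 A) (prod_fspace X Y) (\<lambda>z. (\<phi> z, \<psi> z))"
proof -
  interpret function_algebra Z0 A by fact
  let ?C = "\<lambda>z. (\<phi> z, \<psi> z)"
  have pre: "openin Z {z \<in> Z0. \<phi> z \<in> U \<and> \<psi> z \<in> V}"
    if "openin (top_of X) U" "openin (top_of Y) V" for U V
  proof -
    have "{z \<in> Z0. \<phi> z \<in> U \<and> \<psi> z \<in> V} = {z \<in> Z0. \<phi> z \<in> U} \<inter> {z \<in> Z0. \<psi> z \<in> V}" by blast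
    then show ?thesis using morphism_openin[OF \<phi> that(1)] morphism_openin[OF \<psi> that(2)] by auto
  qed
  have tens: "(\<lambda>z. h (?C z)) \<in> R {z \<in> Z0. \<phi> z \<in> U \<and> \<psi> z \<in> V}"
    if UV: "openin (top_of X) U" "openin (top_of Y) V" and h: "h \<in> tensor_fun X Y U V" for U V h
  proof -
    obtain n :: nat and a b where hab: "h = (\<lambda>p. \<Sum>i<n. a i (fst p) * b i (snd p))"
      and ab: "\<And>i. i < n \<Longrightarrow> a i \<in> regular X U \<and> b i \<in> regular Y V"
      using h unfolding tensor_fun_def by blast
    let ?W = "{z \<in> Z0. \<phi> z \<in> U \<and> \<psi> z \<in> V}"
    have "m \<le> n \<Longrightarrow> (\<lambda>z. \<Sum>i<m. a i (\<phi> z) * b i (\<psi> z)) \<in> R ?W" for m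
    proof (induct m)
      case 0
      show ?case using regular_zero[OF pre[OF UV]] by simp
    next
      case (Suc m)
      have "a m \<circ> \<phi> \<in> R ?W" "b m \<circ> \<psi> \<in> R ?W"
        using ab[of m] Suc.prems morphism_regular[OF \<phi> UV(1), of "a m"]
          morphism_regular[OF \<psi> UV(2), of "b m"] pre[OF UV]
        by (auto intro!: regular_restrict[where V = ?W])
      then have "(\<lambda>z. (a m \<circ> \<phi>) z * (b m \<circ> \<psi>) z) \<in> R ?W"
        by (intro regular_mult) blast+
      then show ?case using Suc by (simp add: regular_add)
    qed
    then show ?thesis unfolding hab by simp
  qed
  have basic: "openin Z {z \<in> Z0. ?C z \<in> basic_open U V h}"
    if UV: "openin (top_of X) U" "openin (top_of Y) V" and h: "h \<in> tensor_fun X Y U V" for U V h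
    using openin_regular_nonzero[OF pre[OF UV] tens[OF UV h]]
    by (simp add: basic_open_def conj_assoc)
  define \<B> where "\<B> = {basic_open U V h |U V h.
            openin (top_of X) U \<and> openin (top_of Y) V \<and> h \<in> tensor_fun X Y U V}"
  have topP: "top_of (prod_fspace X Y) = topology_generated_by \<B>"
    by (simp add: prod_fspace_def \<B>_def)
  \<comment> \<open>This makes the whole product one of the generating open sets, so that every pair
    is a point of the generated topology.\<close>
  have one_tensor: "(\<lambda>_. 1) \<in> tensor_fun X Y (points X) (points Y)"
    unfolding tensor_fun_def mem_Collect_eq
    using oneX oneY by (intro exI[of _ 1] exI[of _ "\<lambda>_ _. 1"]) auto
  have all_basic: "basic_open (points X) (points Y) (\<lambda>_. 1 :: 'b) \<in> \<B>"
    unfolding \<B>_def using one_tensor by blast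
  have inP: "?C z \<in> \<Union>\<B>" if "z \<in> Z0" for z
    using morphism_points[OF \<phi>, of z] morphism_points[OF \<psi>, of z] that
    by (intro UnionI[OF all_basic]) (simp add: basic_open_def)
  have cont: "continuous_map Z (topology_generated_by \<B>) ?C"
  proof (rule continuous_on_generated_topo)
    fix B assume "B \<in> \<B>"
    then have "openin Z {z \<in> Z0. ?C z \<in> B}" using basic unfolding \<B>_def by blast
    moreover have "{z \<in> Z0. ?C z \<in> B} = ?C -` B \<inter> topspace Z" by auto
    ultimately show "openin Z (?C -` B \<inter> topspace Z)" by simp
  qed (use inP in auto)
  have reg: "f \<circ> ?C \<in> R {z \<in> Z0. ?C z \<in> W}" if f: "f \<in> regular (prod_fspace X Y) W" for f W
  proof (rule regular_local)
    fix z assume z: "z \<in> {z \<in> Z0. ?C z \<in> W}"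
    then obtain U V g h where UV: "openin (top_of X) U" "openin (top_of Y) V"
      and gh: "g \<in> tensor_fun X Y U V" "h \<in> tensor_fun X Y U V"
      and zb: "?C z \<in> basic_open U V h" "basic_open U V h \<subseteq> W"
      and fgh: "\<forall>q\<in>basic_open U V h. f q = g q / h q"
      using f unfolding prod_fspace_def by fastforce
    let ?D = "{z \<in> Z0. ?C z \<in> basic_open U V h}"
    have oD: "openin Z ?D" by (rule basic[OF UV gh(2)])
    have sub: "?D \<subseteq> {z \<in> Z0. \<phi> z \<in> U \<and> \<psi> z \<in> V}" by (auto simp: basic_open_def)
    have "(\<lambda>z. g (?C z) / h (?C z)) \<in> R ?D"
      using regular_restrict[OF tens[OF UV gh(1)] oD sub] regular_restrict[OF tens[OF UV gh(2)] oD sub]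
      by (intro regular_divide) (auto simp: basic_open_def)
    then have "f \<circ> ?C \<in> R ?D" by (rule regular_cong) (use fgh in auto)
    then show "\<exists>V. openin Z V \<and> z \<in> V \<and> V \<subseteq> {z \<in> Z0. ?C z \<in> W} \<and> f \<circ> ?C \<in> R V"
      using oD z zb by (intro exI[of _ ?D]) auto
  qed
  show ?thesis unfolding morphism_def topP using cont reg by simp
qed

section \<open>Charts and gluing\<close>

text \<open>
  As simplification rules these also fire on unapplied functions and rewrite \<open>u + w\<close> into an
  abstraction.
\<close>

declare plus_fun_apply [simp del] times_fun_apply [simp del] zero_fun_apply [simp del]
  of_nat_fun_apply [simp del]

lemma submonoid_cone_semigroup: "submonoid_set (cone_semigroup N \<sigma>)"
  by (simp add: submonoid_set_def cone_semigroup_0 cone_semigroup_add)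

lemma submonoid_of_nat_mult:
  fixes S :: "('v \<Rightarrow> real) set"
  assumes "submonoid_set S" "u \<in> S" shows "of_nat n * u \<in> S"
  using assms by (induct n) (auto simp: submonoid_set_def distrib_right)

lemma monoid_hom_of_nat_mult:
  fixes S :: "('v \<Rightarrow> real) set"
  assumes S: "submonoid_set S" and u: "u \<in> S" and \<gamma>: "monoid_hom S \<gamma>"
  shows "\<gamma> (of_nat n * u) = \<gamma> u ^ n"
proof (induct n)
  case 0
  then show ?case using \<gamma> by (simp add: monoid_hom_def)
next
  case (Suc n)
  have "\<gamma> (u + of_nat n * u) = \<gamma> u * \<gamma> (of_nat n * u)"
    using \<gamma> u submonoid_of_nat_mult[OF S u] by (simp add: monoid_hom_def)
  moreover have "of_nat (Suc n) * u = u + of_nat n * u" by (simp add: distrib_right)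
  ultimately show ?case using Suc by simp
qed

text \<open>\<open>S'\<close> arises from \<open>S\<close> by adjoining \<open>- u\<close>, and its
  spectrum is the principal open set where \<open>\<chi>\<^sup>u\<close> does not vanish. The notion
  is needed for pairwise and for triple intersections of cones.\<close>

definition localizes :: "('v \<Rightarrow> real) set \<Rightarrow> ('v \<Rightarrow> real) \<Rightarrow> ('v \<Rightarrow> real) set \<Rightarrow> bool" where
  "localizes S u S' \<longleftrightarrow> submonoid_set S \<and> submonoid_set S' \<and> S \<subseteq> S' \<and> u \<in> S \<and> - u \<in> S' \<and>
     (\<forall>w\<in>S'. \<exists>n. w + of_nat n * u \<in> S)"

lemma localizes_hom_nonzero:
  assumes "localizes S u S'" "monoid_hom S' \<gamma>" shows "\<gamma> u \<noteq> 0"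
proof -
  have "u \<in> S'" "- u \<in> S'" using assms(1) by (auto simp: localizes_def)
  then have "\<gamma> (u + - u) = \<gamma> u * \<gamma> (- u)" using assms(2) unfolding monoid_hom_def by blast
  then have "\<gamma> u * \<gamma> (- u) = 1" using assms(2) by (simp add: monoid_hom_def)
  then show ?thesis by auto
qed

lemma localizes_hom_formula:
  assumes loc: "localizes S u S'" and \<gamma>: "monoid_hom S' \<gamma>" and w: "w \<in> S'"
  shows "\<gamma> w = \<gamma> (w + of_nat n * u) / \<gamma> u ^ n"
proof -
  have S': "submonoid_set S'" "u \<in> S'" using loc by (auto simp: localizes_def)
  have "\<gamma> (w + of_nat n * u) = \<gamma> w * \<gamma> u ^ n"
    using \<gamma> w submonoid_of_nat_mult[OF S'] monoid_hom_of_nat_mult[OF S' \<gamma>]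
    by (simp add: monoid_hom_def)
  then show ?thesis using localizes_hom_nonzero[OF loc \<gamma>] by simp
qed

lemma localizes_hom_unique:
  assumes loc: "localizes S u S'" and "monoid_hom S' \<gamma>" "monoid_hom S' \<delta>"
    and eq: "\<And>w. w \<in> S \<Longrightarrow> \<gamma> w = \<delta> w" and w: "w \<in> S'"
  shows "\<gamma> w = \<delta> w"
proof -
  obtain n where "w + of_nat n * u \<in> S" "u \<in> S" using loc w by (auto simp: localizes_def)
  then show ?thesis
    using localizes_hom_formula[OF loc assms(2) w, of n] localizes_hom_formula[OF loc assms(3) w, of n] eq
    by simp
qed

text \<open>Universal property of the localization: the value at \<open>w\<close> must be the value
  at w + n u divided by \<open>\<gamma> u ^ n\<close>, and passing to a common larger multiple of
  \<open>u\<close> shows that every admissible n gives the same quotient.\<close>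

lemma localizes_hom_extend:
  assumes loc: "localizes S u S'" and \<gamma>: "monoid_hom S \<gamma>" and nz: "\<gamma> u \<noteq> 0"
  obtains \<epsilon> where "monoid_hom S' \<epsilon>" "\<And>w. w \<in> S \<Longrightarrow> \<epsilon> w = \<gamma> w"
proof -
  have S: "submonoid_set S" "submonoid_set S'" "S \<subseteq> S'" and u: "u \<in> S"
    and ex: "\<And>w. w \<in> S' \<Longrightarrow> \<exists>n. w + of_nat n * u \<in> S"
    using loc by (auto simp: localizes_def)
  have shift: "\<gamma> (a + of_nat n * u) = \<gamma> a * \<gamma> u ^ n" if "a \<in> S" for a n
    using \<gamma> that submonoid_of_nat_mult[OF S(1) u] monoid_hom_of_nat_mult[OF S(1) u \<gamma>]
    by (simp add: monoid_hom_def)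
  define \<nu> where "\<nu> w = (SOME n. w + of_nat n * u \<in> S)" for w
  have \<nu>: "w + of_nat (\<nu> w) * u \<in> S" if "w \<in> S'" for w
    unfolding \<nu>_def using someI_ex[OF ex[OF that]] .
  define \<epsilon> where "\<epsilon> w = \<gamma> (w + of_nat (\<nu> w) * u) / \<gamma> u ^ \<nu> w" for w
  have \<epsilon>: "\<epsilon> w = \<gamma> (w + of_nat n * u) / \<gamma> u ^ n" if w: "w \<in> S'" "w + of_nat n * u \<in> S" for w n
  proof -
    have "\<gamma> (w + of_nat (\<nu> w) * u) * \<gamma> u ^ n = \<gamma> ((w + of_nat (\<nu> w) * u) + of_nat n * u)"
      using shift[OF \<nu>[OF w(1)]] by simp
    also have "(w + of_nat (\<nu> w) * u) + of_nat n * u = (w + of_nat n * u) + of_nat (\<nu> w) * u"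
      by (simp add: ac_simps)
    also have "\<gamma> \<dots> = \<gamma> (w + of_nat n * u) * \<gamma> u ^ \<nu> w" using shift[OF w(2)] .
    finally show ?thesis using nz by (simp add: \<epsilon>_def field_simps)
  qed
  have ext: "\<epsilon> w = \<gamma> w" if "w \<in> S" for w
    using \<epsilon>[of w 0] that S(3) by auto
  have "monoid_hom S' \<epsilon>"
    unfolding monoid_hom_def
  proof (intro conjI ballI)
    show "\<epsilon> 0 = 1" using ext[of 0] S(1) \<gamma> by (simp add: submonoid_set_def monoid_hom_def)
    fix a b assume ab: "a \<in> S'" "b \<in> S'"
    let ?n = "\<nu> a + \<nu> b"
    have mem: "(a + of_nat (\<nu> a) * u) + (b + of_nat (\<nu> b) * u) \<in> S"
      using S(1) \<nu> ab unfolding submonoid_set_def by blast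
    have eq: "(a + of_nat (\<nu> a) * u) + (b + of_nat (\<nu> b) * u) = (a + b) + of_nat ?n * u"
      by (simp add: algebra_simps)
    have "a + b \<in> S'" using S(2) ab by (simp add: submonoid_set_def)
    then have "\<epsilon> (a + b) = \<gamma> ((a + of_nat (\<nu> a) * u) + (b + of_nat (\<nu> b) * u)) / \<gamma> u ^ ?n"
      using mem unfolding eq by (rule \<epsilon>)
    also have "\<dots> = \<epsilon> a * \<epsilon> b"
      using \<gamma> \<nu>[OF ab(1)] \<nu>[OF ab(2)] by (simp add: monoid_hom_def \<epsilon>_def power_add)
    finally show "\<epsilon> (a + b) = \<epsilon> a * \<epsilon> b" .
  qed
  then show ?thesis using ext by (rule that)
qed

lemma function_algebra_Spec:
  fixes S :: "('v \<Rightarrow> real) set"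
  assumes S: "submonoid_set S"
    and closed: "closed_points S = {point S \<gamma> |\<gamma> :: ('v \<Rightarrow> real) \<Rightarrow> 'k::alg_closed_field. monoid_hom S \<gamma>}"
  shows "function_algebra (closed_points S)
    (value_at ` carrier (semigroup_ring S) :: ((('v \<Rightarrow> real) \<Rightarrow>\<^sub>0 'k) set \<Rightarrow> 'k) set)"
proof -
  have S0: "0 \<in> S" using S by (simp add: submonoid_set_def)
  let ?A = "value_at ` carrier (semigroup_ring S) :: ((('v \<Rightarrow> real) \<Rightarrow>\<^sub>0 'k) set \<Rightarrow> 'k) set"
  let ?C = "carrier (semigroup_ring S) :: (('v \<Rightarrow> real) \<Rightarrow>\<^sub>0 'k) set"
  note cl = sub_ring_closed[OF sub_ring_carrier[OF S, where 'k='k]]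
  have val: "value_at f x = ev \<gamma> f" if "monoid_hom S \<gamma>" "x = point S \<gamma>" "f \<in> ?C" for f x \<gamma>
    using value_at_point[OF S that(1,3)] that(2) by simp
  have const: "value_at (Poly_Mapping.single 0 c) x = c" if "x \<in> closed_points S" for c :: 'k and x
  proof -
    obtain \<gamma> where \<gamma>: "monoid_hom S \<gamma>" "x = point S \<gamma>" using \<open>x \<in> _\<close> closed by blast
    have "value_at (Poly_Mapping.single 0 c) x = c * \<gamma> 0"
      using val[OF \<gamma> single_mem_carrier[OF S0], of c] by simp
    then show ?thesis using \<gamma>(1) by (simp add: monoid_hom_def)
  qed
  have constA: "value_at (Poly_Mapping.single 0 c) \<in> ?A" for c
    using single_mem_carrier[OF S0] by blast
  show ?thesis
  proof
    show "\<exists>c\<in>?A. \<forall>x\<in>closed_points S. c x = 0" using const[of _ 0] by (intro bexI[OF _ constA[of 0]]) simp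
    show "\<exists>c\<in>?A. \<forall>x\<in>closed_points S. c x = 1" using const[of _ 1] by (intro bexI[OF _ constA[of 1]]) simp
    fix a b assume "a \<in> ?A" "b \<in> ?A"
    then obtain f g where fg: "f \<in> ?C" "g \<in> ?C" and ab: "a = value_at f" "b = value_at g" by blast
    have "value_at (f + g) x = a x + b x \<and> value_at (f * g) x = a x * b x"
      if x: "x \<in> closed_points S" for x
    proof -
      obtain \<gamma> where \<gamma>: "monoid_hom S \<gamma>" "x = point S \<gamma>" using x closed by blast
      show ?thesis
        unfolding ab val[OF \<gamma> fg(1)] val[OF \<gamma> fg(2)] val[OF \<gamma> cl(6)[OF fg]] val[OF \<gamma> cl(4)[OF fg]]
        using ev_mult[OF \<gamma>(1), of f g] fg by (simp add: ev_add mem_carrier_semigroup_ring)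
    qed
    then show "\<exists>c\<in>?A. \<forall>x\<in>closed_points S. c x = a x + b x"
      "\<exists>c\<in>?A. \<forall>x\<in>closed_points S. c x = a x * b x"
      using cl(6)[OF fg] cl(4)[OF fg] by blast+
  qed
qed

locale fan_in_lattice =
  fixes N :: "'v::real_vector set" and \<Delta> :: "'v set set"
  assumes N: "lattice_in N" and fan: "fan N \<Delta>"
begin

abbreviation S :: "'v set \<Rightarrow> ('v \<Rightarrow> real) set" where "S \<equiv> cone_semigroup N"

lemma closed_points_S:
  assumes "\<sigma> \<in> \<Delta>"
  shows "closed_points (S \<sigma>) =
    {point (S \<sigma>) \<gamma> |\<gamma> :: ('v \<Rightarrow> real) \<Rightarrow> 'k::alg_closed_field. monoid_hom (S \<sigma>) \<gamma>}"
proof -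
  obtain F where F: "cone_gens N \<sigma> F" using fan_gens[OF fan assms] .
  from gordan[OF N F] obtain G where "finite G" "G \<subseteq> S \<sigma>" "S \<sigma> \<subseteq> monoid_span G" by blast
  then show ?thesis by (rule closed_points_eq_points[OF submonoid_cone_semigroup])
qed

lemma closed_pointE:
  fixes x :: "(('v \<Rightarrow> real) \<Rightarrow>\<^sub>0 'k::alg_closed_field) set"
  assumes "\<sigma> \<in> \<Delta>" "x \<in> closed_points (S \<sigma>)"
  obtains \<gamma> where "monoid_hom (S \<sigma>) \<gamma>" "x = point (S \<sigma>) \<gamma>"
  using assms closed_points_S by blast

lemma function_algebra_chart:
  assumes "\<sigma> \<in> \<Delta>"
  shows "function_algebra (closed_points (S \<sigma>))
    (value_at ` carrier (semigroup_ring (S \<sigma>)) :: ((('v \<Rightarrow> real) \<Rightarrow>\<^sub>0 'k::alg_closed_field) set \<Rightarrow> 'k) set)"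
  by (rule function_algebra_Spec[OF submonoid_cone_semigroup closed_points_S[OF assms]])

lemma affine_chart_eq:
  "affine_chart N \<sigma> = fspace_of (closed_points (S \<sigma>)) (value_at ` carrier (semigroup_ring (S \<sigma>)))"
  by (simp add: affine_chart_def Spec_def)

lemma points_affine_chart:
  assumes "\<sigma> \<in> \<Delta>"
  shows "points (affine_chart N \<sigma> :: ((('v \<Rightarrow> real) \<Rightarrow>\<^sub>0 'k::alg_closed_field) set, 'k) fspace)
    = closed_points (S \<sigma>)"
  unfolding affine_chart_eq
  by (rule function_algebra.topspace_Z[OF function_algebra_chart[OF assms]])

lemma face_localizes:
  assumes "\<sigma> \<in> \<Delta>" "face_of_cone \<tau> \<sigma>"
  obtains u where "localizes (S \<sigma>) u (S \<tau>)" "\<tau> = \<sigma> \<inter> {v. u v = 0}"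
proof -
  obtain u where u: "u \<in> S \<sigma>" "\<tau> = \<sigma> \<inter> {v. u v = 0}"
    using face_integral_functional[OF N fan assms] .
  obtain F where F: "cone_gens N \<sigma> F" using fan_gens[OF fan assms(1)] .
  have "- u \<in> S \<tau>" using u
    using dual_lattice_linear[OF dual_lattice_uminus, of u N]
    by (auto simp: cone_semigroup_def dual_lattice_uminus dual_cone_def)
  moreover have "S \<sigma> \<subseteq> S \<tau>" using u(2) by (intro cone_semigroup_mono) blast
  ultimately have "localizes (S \<sigma>) u (S \<tau>)"
    using u face_semigroup_localization[OF F u(1)]
    by (simp add: localizes_def submonoid_cone_semigroup)
  then show ?thesis using u(2) that by blast
qed

text \<open>A point of the overlap is one homomorphism on the semigroup of the intersection, and its
  two contractions are the restrictions of that homomorphism.\<close>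

lemma gluing_iff:
  fixes x y :: "(('v \<Rightarrow> real) \<Rightarrow>\<^sub>0 'k::alg_closed_field) set"
  shows "((\<sigma>, x), (\<tau>, y)) \<in> gluing N \<Delta> \<longleftrightarrow> \<sigma> \<in> \<Delta> \<and> \<tau> \<in> \<Delta> \<and>
    (\<exists>\<gamma>. monoid_hom (S (\<sigma> \<inter> \<tau>)) \<gamma> \<and> x = point (S \<sigma>) \<gamma> \<and> y = point (S \<tau>) \<gamma>)"
proof -
  have sub: "S \<sigma> \<subseteq> S (\<sigma> \<inter> \<tau>)" "S \<tau> \<subseteq> S (\<sigma> \<inter> \<tau>)" by (intro cone_semigroup_mono; blast)+
  have closed: "point (S \<sigma>) \<gamma> \<in> closed_points (S \<sigma>)" "point (S \<tau>) \<gamma> \<in> closed_points (S \<tau>)"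
    if "monoid_hom (S (\<sigma> \<inter> \<tau>)) \<gamma>" for \<gamma> :: "('v \<Rightarrow> real) \<Rightarrow> 'k"
    using point_mem_closed_points[OF submonoid_cone_semigroup] monoid_hom_subset[OF that] sub by blast+
  show ?thesis
  proof
    assume "((\<sigma>, x), (\<tau>, y)) \<in> gluing N \<Delta>"
    then obtain z where st: "\<sigma> \<in> \<Delta>" "\<tau> \<in> \<Delta>" and z: "z \<in> closed_points (S (\<sigma> \<inter> \<tau>))"
      "x = contract (S \<sigma>) z" "y = contract (S \<tau>) z"
      unfolding gluing_def chart_points_def by blast
    obtain \<gamma> where \<gamma>: "monoid_hom (S (\<sigma> \<inter> \<tau>)) \<gamma>" "z = point (S (\<sigma> \<inter> \<tau>)) \<gamma>"
      using closed_pointE[OF fan_Int(1)[OF fan st] z(1)] .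
    show "\<sigma> \<in> \<Delta> \<and> \<tau> \<in> \<Delta> \<and>
        (\<exists>\<gamma>. monoid_hom (S (\<sigma> \<inter> \<tau>)) \<gamma> \<and> x = point (S \<sigma>) \<gamma> \<and> y = point (S \<tau>) \<gamma>)"
      using st \<gamma>(1) z(2,3) unfolding \<gamma>(2) contract_point[OF sub(1)] contract_point[OF sub(2)] by blast
  next
    assume "\<sigma> \<in> \<Delta> \<and> \<tau> \<in> \<Delta> \<and>
        (\<exists>\<gamma>. monoid_hom (S (\<sigma> \<inter> \<tau>)) \<gamma> \<and> x = point (S \<sigma>) \<gamma> \<and> y = point (S \<tau>) \<gamma>)"
    then obtain \<gamma> where st: "\<sigma> \<in> \<Delta>" "\<tau> \<in> \<Delta>" and \<gamma>: "monoid_hom (S (\<sigma> \<inter> \<tau>)) \<gamma>"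
      and xy: "x = point (S \<sigma>) \<gamma>" "y = point (S \<tau>) \<gamma>" by blast
    have con: "x = contract (S \<sigma>) (point (S (\<sigma> \<inter> \<tau>)) \<gamma>)" "y = contract (S \<tau>) (point (S (\<sigma> \<inter> \<tau>)) \<gamma>)"
      by (simp_all add: xy contract_point[OF sub(1)] contract_point[OF sub(2)])
    show "((\<sigma>, x), (\<tau>, y)) \<in> gluing N \<Delta>"
      unfolding gluing_def mem_Collect_eq
    proof (rule exI[of _ \<sigma>], rule exI[of _ x], rule exI[of _ \<tau>], rule exI[of _ y], intro conjI refl)
      show "(\<sigma>, x) \<in> chart_points N \<Delta>" "(\<tau>, y) \<in> chart_points N \<Delta>"
        using st closed[OF \<gamma>] xy by (auto simp: chart_points_def)
    qed (use con point_mem_closed_points[OF submonoid_cone_semigroup \<gamma>] in blast)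
  qed
qed

text \<open>In the chart of \<tau> both overlaps are principal open sets. The given point lies in
  both, hence in the chart of the triple intersection, and a homomorphism on that semigroup
  restricts to the semigroup of \<open>\<sigma> \<inter> \<rho>\<close>.\<close>

lemma gluing_trans:
  fixes x y z :: "(('v \<Rightarrow> real) \<Rightarrow>\<^sub>0 'k::alg_closed_field) set"
  assumes "((\<sigma>, x), (\<tau>, y)) \<in> gluing N \<Delta>" "((\<tau>, y), (\<rho>, z)) \<in> gluing N \<Delta>"
  shows "((\<sigma>, x), (\<rho>, z)) \<in> gluing N \<Delta>"
proof -
  obtain \<gamma> where fans: "\<sigma> \<in> \<Delta>" "\<tau> \<in> \<Delta>" and \<gamma>: "monoid_hom (S (\<sigma> \<inter> \<tau>)) \<gamma>"
    "x = point (S \<sigma>) \<gamma>" "y = point (S \<tau>) \<gamma>" using assms(1) unfolding gluing_iff by blast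
  obtain \<delta> where \<rho>: "\<rho> \<in> \<Delta>" and \<delta>: "monoid_hom (S (\<tau> \<inter> \<rho>)) \<delta>"
    "y = point (S \<tau>) \<delta>" "z = point (S \<rho>) \<delta>" using assms(2) unfolding gluing_iff by blast
  have sub: "S \<sigma> \<subseteq> S (\<sigma> \<inter> \<tau>)" "S \<tau> \<subseteq> S (\<sigma> \<inter> \<tau>)" "S \<tau> \<subseteq> S (\<tau> \<inter> \<rho>)" "S \<rho> \<subseteq> S (\<tau> \<inter> \<rho>)"
    by (intro cone_semigroup_mono; blast)+
  have hom\<tau>: "monoid_hom (S \<tau>) \<gamma>" "monoid_hom (S \<tau>) \<delta>"
    using monoid_hom_subset \<gamma>(1) \<delta>(1) sub by blast+
  have eq: "\<gamma> w = \<delta> w" if "w \<in> S \<tau>" for w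
    using point_eq_iff[OF submonoid_cone_semigroup hom\<tau>] \<gamma>(3) \<delta>(2) that by simp
  obtain u where u: "localizes (S \<tau>) u (S (\<sigma> \<inter> \<tau>))" "\<sigma> \<inter> \<tau> = \<tau> \<inter> {v. u v = 0}"
    using face_localizes[OF fans(2) fan_Int(3)[OF fan fans]] .
  obtain u' where u': "localizes (S \<tau>) u' (S (\<tau> \<inter> \<rho>))" "\<tau> \<inter> \<rho> = \<tau> \<inter> {v. u' v = 0}"
    using face_localizes[OF fans(2) fan_Int(2)[OF fan fans(2) \<rho>]] .
  have uS: "u \<in> S \<tau>" "u' \<in> S \<tau>" using u u' by (auto simp: localizes_def)
  \<comment> \<open>The triple intersection is the face of \<tau> cut out by \<open>u + u'\<close>,
    because both summands are nonnegative on \<tau>.\<close>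
  define \<kappa> where "\<kappa> = \<sigma> \<inter> \<tau> \<inter> \<rho>"
  have "\<kappa> = \<tau> \<inter> {v. (u + u') v = 0}"
  proof -
    have "(u + u') v = 0 \<longleftrightarrow> u v = 0 \<and> u' v = 0" if "v \<in> \<tau>" for v
      unfolding plus_fun_apply
      using uS that by (intro add_nonneg_eq_0_iff) (auto simp: cone_semigroup_def dual_cone_def)
    then show ?thesis using u(2) u'(2) unfolding \<kappa>_def by blast
  qed
  note \<kappa>_face = this
  have usum: "u + u' \<in> S \<tau>" by (rule cone_semigroup_add[OF uS])
  obtain F where F: "cone_gens N \<tau> F" using fan_gens[OF fan fans(2)] .
  have loc: "localizes (S \<tau>) (u + u') (S \<kappa>)"
    unfolding localizes_def
  proof (intro conjI submonoid_cone_semigroup usum)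
    show "S \<tau> \<subseteq> S \<kappa>" by (intro cone_semigroup_mono) (auto simp: \<kappa>_def)
    show "- (u + u') \<in> S \<kappa>" using usum \<kappa>_face
      using dual_lattice_linear[OF dual_lattice_uminus, of "u + u'" N]
      by (auto simp: cone_semigroup_def dual_lattice_uminus dual_cone_def simp del: minus_add_distrib)
    show "\<forall>w\<in>S \<kappa>. \<exists>n. w + of_nat n * (u + u') \<in> S \<tau>"
      using face_semigroup_localization[OF F usum] \<kappa>_face by simp
  qed
  have "\<gamma> u \<noteq> 0" by (rule localizes_hom_nonzero[OF u(1) \<gamma>(1)])
  moreover have "\<gamma> u' \<noteq> 0" using localizes_hom_nonzero[OF u'(1) \<delta>(1)] eq[OF uS(2)] by simp
  moreover have "\<gamma> (u + u') = \<gamma> u * \<gamma> u'" using hom\<tau>(1) uS by (simp add: monoid_hom_def)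
  ultimately have "\<gamma> (u + u') \<noteq> 0" by simp
  then obtain \<epsilon> where \<epsilon>: "monoid_hom (S \<kappa>) \<epsilon>" "\<And>w. w \<in> S \<tau> \<Longrightarrow> \<epsilon> w = \<gamma> w"
    using localizes_hom_extend[OF loc hom\<tau>(1)] by blast
  have sub\<kappa>: "S (\<sigma> \<inter> \<tau>) \<subseteq> S \<kappa>" "S (\<tau> \<inter> \<rho>) \<subseteq> S \<kappa>" "S (\<sigma> \<inter> \<rho>) \<subseteq> S \<kappa>"
    unfolding \<kappa>_def by (intro cone_semigroup_mono; blast)+
  \<comment> \<open>By construction \<epsilon> and \<gamma> agree only on \<open>S \<tau>\<close>;
    uniqueness of extensions to a localization carries this to the larger semigroup, and likewise
    for \<delta> below.\<close>
  have "\<epsilon> w = \<gamma> w" if "w \<in> S (\<sigma> \<inter> \<tau>)" for w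
    using localizes_hom_unique[OF u(1) monoid_hom_subset[OF \<epsilon>(1) sub\<kappa>(1)] \<gamma>(1) \<epsilon>(2) that] .
  then have "x = point (S \<sigma>) \<epsilon>" unfolding \<gamma>(2) using sub(1) by (intro point_cong) auto
  moreover have "\<epsilon> w = \<delta> w" if "w \<in> S (\<tau> \<inter> \<rho>)" for w
    using localizes_hom_unique[OF u'(1) monoid_hom_subset[OF \<epsilon>(1) sub\<kappa>(2)] \<delta>(1) _ that] \<epsilon>(2) eq by simp
  then have "z = point (S \<rho>) \<epsilon>" unfolding \<delta>(3) using sub(4) by (intro point_cong) auto
  ultimately show ?thesis
    unfolding gluing_iff using fans(1) \<rho> monoid_hom_subset[OF \<epsilon>(1) sub\<kappa>(3)] by blast
qed

lemma equiv_gluing: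
  "equiv (chart_points N \<Delta>) (gluing N \<Delta> :: ('v, 'k::alg_closed_field) chart_point rel)"
proof (rule equivI)
  show "gluing N \<Delta> \<subseteq> chart_points N \<Delta> \<times> (chart_points N \<Delta> :: ('v, 'k) chart_point set)"
    unfolding gluing_def by blast
  show "refl_on (chart_points N \<Delta>) (gluing N \<Delta> :: ('v, 'k) chart_point rel)"
  proof (rule refl_onI)
    fix a :: "('v, 'k) chart_point" assume "a \<in> chart_points N \<Delta>"
    then obtain \<sigma> x where a: "a = (\<sigma>, x)" "\<sigma> \<in> \<Delta>" "x \<in> closed_points (S \<sigma>)"
      by (auto simp: chart_points_def)
    obtain \<gamma> where "monoid_hom (S \<sigma>) \<gamma>" "x = point (S \<sigma>) \<gamma>" using closed_pointE[OF a(2,3)] .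
    then show "(a, a) \<in> gluing N \<Delta>" using a(2) by (auto simp: a(1) gluing_iff)
  qed
  show "sym (gluing N \<Delta> :: ('v, 'k) chart_point rel)"
    by (rule symI) (auto simp: gluing_iff Int_commute)
  show "trans (gluing N \<Delta> :: ('v, 'k) chart_point rel)"
  proof (rule transI)
    fix a b c :: "('v, 'k) chart_point"
    assume "(a, b) \<in> gluing N \<Delta>" "(b, c) \<in> gluing N \<Delta>"
    then show "(a, c) \<in> gluing N \<Delta>"
      using gluing_trans by (cases a, cases b, cases c) blast
  qed
qed

lemma chart_map_eq_iff:
  fixes x y :: "(('v \<Rightarrow> real) \<Rightarrow>\<^sub>0 'k::alg_closed_field) set"
  assumes "\<sigma> \<in> \<Delta>" "x \<in> closed_points (S \<sigma>)" "\<tau> \<in> \<Delta>" "y \<in> closed_points (S \<tau>)"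
  shows "chart_map N \<Delta> \<sigma> x = chart_map N \<Delta> \<tau> y \<longleftrightarrow> ((\<sigma>, x), (\<tau>, y)) \<in> gluing N \<Delta>"
  unfolding chart_map_def using assms
  by (intro eq_equiv_class_iff[OF equiv_gluing]) (auto simp: chart_points_def)

lemma chart_map_inj:
  fixes \<rho> shows "\<rho> \<in> \<Delta> \<Longrightarrow> inj_on (chart_map N \<Delta> \<rho> :: _ \<Rightarrow> ('v, 'k::alg_closed_field) toric_point) (closed_points (S \<rho>))"
  by (rule inj_onI) (auto simp: chart_map_eq_iff gluing_iff)

section \<open>Topology and regular functions of the toric variety\<close>

abbreviation X :: "(('v, 'k::alg_closed_field) toric_point, 'k) fspace" where
  "X \<equiv> toric_variety N \<Delta>"

lemma openin_X: "openin (top_of X) W \<longleftrightarrow> W \<subseteq> chart_points N \<Delta> // gluing N \<Delta> \<and>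
    (\<forall>\<sigma>\<in>\<Delta>. openin (top_of (affine_chart N \<sigma>)) (chart_preimage N \<Delta> W \<sigma>))"
  unfolding toric_variety_def fspace.select_convs
  by (subst topology_inverse'[OF istopology_toric]) (rule refl)

lemma regular_X: "f \<in> regular X W \<longleftrightarrow> (\<forall>\<sigma>\<in>\<Delta>. f \<circ> chart_map N \<Delta> \<sigma> \<in>
    regular (affine_chart N \<sigma>) (chart_preimage N \<Delta> W \<sigma>))"
  by (simp add: toric_variety_def)

lemma chart_map_mem: "\<sigma> \<in> \<Delta> \<Longrightarrow> x \<in> closed_points (S \<sigma>) \<Longrightarrow>
    chart_map N \<Delta> \<sigma> x \<in> chart_points N \<Delta> // gluing N \<Delta>"
  unfolding chart_map_def by (rule quotientI) (simp add: chart_points_def)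

lemma points_X: "points X = chart_points N \<Delta> // (gluing N \<Delta> :: ('v, 'k::alg_closed_field) chart_point rel)"
proof -
  let ?W = "chart_points N \<Delta> // (gluing N \<Delta> :: ('v, 'k) chart_point rel)"
  have "chart_preimage N \<Delta> ?W \<sigma> = points (affine_chart N \<sigma>)" if "\<sigma> \<in> \<Delta>" for \<sigma>
    using chart_map_mem[OF that] unfolding points_affine_chart[OF that] chart_preimage_def by blast
  then have "openin (top_of X) ?W" unfolding openin_X by simp
  moreover have "points X \<subseteq> ?W" using openin_topspace[of "top_of X"] unfolding openin_X by blast
  ultimately show ?thesis using openin_subset by blast
qed

lemma points_XE:
  fixes P :: "('v, 'k::alg_closed_field) toric_point"
  assumes "P \<in> points X"
  obtains \<sigma> x where "\<sigma> \<in> \<Delta>" "x \<in> closed_points (S \<sigma>)" "P = chart_map N \<Delta> \<sigma> x"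
  using assms unfolding points_X chart_map_def
  by (elim quotientE) (auto simp: chart_points_def)

lemma morphism_chart_map:
  assumes \<sigma>: "\<sigma> \<in> \<Delta>"
  shows "morphism (affine_chart N \<sigma>) (X :: (('v, 'k::alg_closed_field) toric_point, 'k) fspace) (chart_map N \<Delta> \<sigma>)"
proof -
  have pre: "{x \<in> points (affine_chart N \<sigma>). chart_map N \<Delta> \<sigma> x \<in> V} = chart_preimage N \<Delta> V \<sigma>"
    for V :: "('v, 'k) toric_point set"
    unfolding points_affine_chart[OF \<sigma>] chart_preimage_def ..
  show ?thesis
    unfolding morphism_def continuous_map_def pre
    using \<sigma> chart_map_mem[OF \<sigma>]
    by (auto simp: openin_X regular_X points_X points_affine_chart[OF \<sigma>])
qed

lemma regular_X_one: 
  "(\<lambda>_. 1) \<in> regular (X :: (('v, 'k::alg_closed_field) toric_point, 'k) fspace) (points X)"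
  unfolding regular_X
proof
  fix \<sigma> assume \<sigma>: "\<sigma> \<in> \<Delta>"
  interpret function_algebra "closed_points (S \<sigma>)"
    "value_at ` carrier (semigroup_ring (S \<sigma>)) :: ((('v \<Rightarrow> real) \<Rightarrow>\<^sub>0 'k) set \<Rightarrow> 'k) set"
    by (rule function_algebra_chart[OF \<sigma>])
  have "openin Z (chart_preimage N \<Delta> (points X) \<sigma>)"
    using openin_topspace[of "top_of X"] \<sigma> unfolding openin_X affine_chart_eq by blast
  then show "(\<lambda>_. 1 :: 'k) \<circ> chart_map N \<Delta> \<sigma> \<in> regular (affine_chart N \<sigma>) (chart_preimage N \<Delta> (points X) \<sigma>)"
    unfolding affine_chart_eq comp_def by (rule regular_one)
qed

definition chart_image :: "'v set \<Rightarrow> ('v, 'k::alg_closed_field) toric_point set" where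
  "chart_image \<rho> = chart_map N \<Delta> \<rho> ` closed_points (S \<rho>)"

text \<open>The character \<open>\<chi>\<^sup>w\<close> on the image of a chart; its values elsewhere are meaningless.\<close>

definition chart_char :: "'v set \<Rightarrow> ('v \<Rightarrow> real) \<Rightarrow> ('v, 'k::alg_closed_field) toric_point \<Rightarrow> 'k" where
  "chart_char \<rho> w P =
     value_at (Poly_Mapping.single w 1) (inv_into (closed_points (S \<rho>)) (chart_map N \<Delta> \<rho>) P)"

lemma chart_char_point:
  fixes \<gamma> :: "('v \<Rightarrow> real) \<Rightarrow> 'k::alg_closed_field"
  assumes "\<rho> \<in> \<Delta>" "monoid_hom (S \<rho>) \<gamma>" "w \<in> S \<rho>"
  shows "chart_char \<rho> w (chart_map N \<Delta> \<rho> (point (S \<rho>) \<gamma>)) = \<gamma> w"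
  unfolding chart_char_def
  using point_mem_closed_points[OF submonoid_cone_semigroup assms(2)]
  by (simp add: inv_into_f_f[OF chart_map_inj[OF assms(1)]]
      value_at_single_point[OF submonoid_cone_semigroup assms(2,3)])

lemma chart_map_restrict:
  fixes \<gamma> :: "('v \<Rightarrow> real) \<Rightarrow> 'k::alg_closed_field"
  assumes "\<sigma> \<in> \<Delta>" "\<tau> \<in> \<Delta>" "monoid_hom (S (\<sigma> \<inter> \<tau>)) \<gamma>"
  shows "chart_map N \<Delta> \<sigma> (point (S \<sigma>) \<gamma>) = chart_map N \<Delta> \<tau> (point (S \<tau>) \<gamma>)"
proof -
  have "monoid_hom (S \<sigma>) \<gamma>" "monoid_hom (S \<tau>) \<gamma>"
    by (intro monoid_hom_subset[OF assms(3)] cone_semigroup_mono; blast)+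
  then show ?thesis
    using assms by (subst chart_map_eq_iff)
      (auto simp: gluing_iff intro: point_mem_closed_points[OF submonoid_cone_semigroup])
qed

text \<open>In the chart of \<sigma>, the chart of \<rho> is the locus of one monomial, and the
  characters of \<rho> are quotients of monomials there. Openness of the chart images and regularity
  of the characters on them are read off from this.\<close>

lemma chart_transition:
  assumes \<sigma>: "\<sigma> \<in> \<Delta>" and \<rho>: "\<rho> \<in> \<Delta>"
  obtains u where "u \<in> S \<sigma>"
    "\<And>\<gamma> :: ('v \<Rightarrow> real) \<Rightarrow> 'k::alg_closed_field. monoid_hom (S \<sigma>) \<gamma> \<Longrightarrow>
       chart_map N \<Delta> \<sigma> (point (S \<sigma>) \<gamma>) \<in> chart_image \<rho> \<longleftrightarrow> \<gamma> u \<noteq> 0"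
    "\<And>w. w \<in> S \<rho> \<Longrightarrow> \<exists>n. w + of_nat n * u \<in> S \<sigma> \<and>
       (\<forall>\<gamma> :: ('v \<Rightarrow> real) \<Rightarrow> 'k. monoid_hom (S \<sigma>) \<gamma> \<longrightarrow> \<gamma> u \<noteq> 0 \<longrightarrow>
         chart_char \<rho> w (chart_map N \<Delta> \<sigma> (point (S \<sigma>) \<gamma>)) = \<gamma> (w + of_nat n * u) / \<gamma> u ^ n)"
proof -
  obtain u where u: "localizes (S \<sigma>) u (S (\<sigma> \<inter> \<rho>))"
    using face_localizes[OF \<sigma> fan_Int(2)[OF fan \<sigma> \<rho>]] by blast
  have uS: "u \<in> S \<sigma>" using u by (simp add: localizes_def)
  have sub: "S \<sigma> \<subseteq> S (\<sigma> \<inter> \<rho>)" "S \<rho> \<subseteq> S (\<sigma> \<inter> \<rho>)" by (intro cone_semigroup_mono; blast)+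
  have nonzero: "\<gamma> u \<noteq> 0"
    if \<gamma>: "monoid_hom (S \<sigma>) \<gamma>" and mem: "chart_map N \<Delta> \<sigma> (point (S \<sigma>) \<gamma>) \<in> chart_image \<rho>"
    for \<gamma> :: "('v \<Rightarrow> real) \<Rightarrow> 'k"
  proof -
    obtain y where y: "y \<in> closed_points (S \<rho>)"
      "chart_map N \<Delta> \<sigma> (point (S \<sigma>) \<gamma>) = chart_map N \<Delta> \<rho> y" using mem by (auto simp: chart_image_def)
    then have "((\<sigma>, point (S \<sigma>) \<gamma>), (\<rho>, y)) \<in> gluing N \<Delta>"
      using chart_map_eq_iff[OF \<sigma> point_mem_closed_points[OF submonoid_cone_semigroup \<gamma>] \<rho> y(1)] by simp
    then obtain \<delta> where \<delta>: "monoid_hom (S (\<sigma> \<inter> \<rho>)) \<delta>" "point (S \<sigma>) \<gamma> = point (S \<sigma>) \<delta>"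
      unfolding gluing_iff by blast
    then have "\<gamma> u = \<delta> u"
      using point_eq_iff[OF submonoid_cone_semigroup \<gamma> monoid_hom_subset[OF \<delta>(1) sub(1)]] uS by blast
    then show ?thesis using localizes_hom_nonzero[OF u \<delta>(1)] by simp
  qed
  have ext: "\<exists>\<epsilon>. monoid_hom (S (\<sigma> \<inter> \<rho>)) \<epsilon> \<and> (\<forall>w\<in>S \<sigma>. \<epsilon> w = \<gamma> w) \<and>
      chart_map N \<Delta> \<sigma> (point (S \<sigma>) \<gamma>) = chart_map N \<Delta> \<rho> (point (S \<rho>) \<epsilon>)"
    if \<gamma>: "monoid_hom (S \<sigma>) \<gamma>" "\<gamma> u \<noteq> 0" for \<gamma> :: "('v \<Rightarrow> real) \<Rightarrow> 'k"
  proof -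
    obtain \<epsilon> where \<epsilon>: "monoid_hom (S (\<sigma> \<inter> \<rho>)) \<epsilon>" "\<And>w. w \<in> S \<sigma> \<Longrightarrow> \<epsilon> w = \<gamma> w"
      using localizes_hom_extend[OF u \<gamma>] by blast
    have "point (S \<sigma>) \<gamma> = point (S \<sigma>) \<epsilon>" using \<epsilon>(2) by (intro point_cong) simp
    then show ?thesis using chart_map_restrict[OF \<sigma> \<rho> \<epsilon>(1)] \<epsilon> by auto
  qed
  show ?thesis
  proof (rule that[OF uS])
    fix \<gamma> :: "('v \<Rightarrow> real) \<Rightarrow> 'k" assume \<gamma>: "monoid_hom (S \<sigma>) \<gamma>"
    show "chart_map N \<Delta> \<sigma> (point (S \<sigma>) \<gamma>) \<in> chart_image \<rho> \<longleftrightarrow> \<gamma> u \<noteq> 0"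
    proof
      assume "\<gamma> u \<noteq> 0"
      then obtain \<epsilon> where \<epsilon>: "monoid_hom (S (\<sigma> \<inter> \<rho>)) \<epsilon>"
        "chart_map N \<Delta> \<sigma> (point (S \<sigma>) \<gamma>) = chart_map N \<Delta> \<rho> (point (S \<rho>) \<epsilon>)" using ext[OF \<gamma>] by blast
      have "point (S \<rho>) \<epsilon> \<in> closed_points (S \<rho>)"
        by (rule point_mem_closed_points[OF submonoid_cone_semigroup monoid_hom_subset[OF \<epsilon>(1) sub(2)]])
      then show "chart_map N \<Delta> \<sigma> (point (S \<sigma>) \<gamma>) \<in> chart_image \<rho>"
        unfolding chart_image_def \<epsilon>(2) by (rule imageI)
    qed (rule nonzero[OF \<gamma>])
  next
    fix w assume w: "w \<in> S \<rho>"
    then have w': "w \<in> S (\<sigma> \<inter> \<rho>)" using sub(2) by blast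
    then obtain n where n: "w + of_nat n * u \<in> S \<sigma>" using u by (auto simp: localizes_def)
    have "chart_char \<rho> w (chart_map N \<Delta> \<sigma> (point (S \<sigma>) \<gamma>)) = \<gamma> (w + of_nat n * u) / \<gamma> u ^ n"
      if \<gamma>: "monoid_hom (S \<sigma>) \<gamma>" "\<gamma> u \<noteq> 0" for \<gamma> :: "('v \<Rightarrow> real) \<Rightarrow> 'k"
    proof -
      obtain \<epsilon> where \<epsilon>: "monoid_hom (S (\<sigma> \<inter> \<rho>)) \<epsilon>" "\<forall>w\<in>S \<sigma>. \<epsilon> w = \<gamma> w"
        "chart_map N \<Delta> \<sigma> (point (S \<sigma>) \<gamma>) = chart_map N \<Delta> \<rho> (point (S \<rho>) \<epsilon>)" using ext[OF \<gamma>] by blast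
      show ?thesis
        unfolding \<epsilon>(3) chart_char_point[OF \<rho> monoid_hom_subset[OF \<epsilon>(1) sub(2)] w]
        using localizes_hom_formula[OF u \<epsilon>(1) w', of n] \<epsilon>(2) n uS by simp
    qed
    then show "\<exists>n. w + of_nat n * u \<in> S \<sigma> \<and>
       (\<forall>\<gamma> :: ('v \<Rightarrow> real) \<Rightarrow> 'k. monoid_hom (S \<sigma>) \<gamma> \<longrightarrow> \<gamma> u \<noteq> 0 \<longrightarrow>
         chart_char \<rho> w (chart_map N \<Delta> \<sigma> (point (S \<sigma>) \<gamma>)) = \<gamma> (w + of_nat n * u) / \<gamma> u ^ n)"
      using n by blast
  qed
qed

lemma chart_preimage_chart_image:
  assumes \<sigma>: "\<sigma> \<in> \<Delta>" and u: "u \<in> S \<sigma>"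
    and iff: "\<And>\<gamma> :: ('v \<Rightarrow> real) \<Rightarrow> 'k::alg_closed_field. monoid_hom (S \<sigma>) \<gamma> \<Longrightarrow>
       chart_map N \<Delta> \<sigma> (point (S \<sigma>) \<gamma>) \<in> chart_image \<rho> \<longleftrightarrow> \<gamma> u \<noteq> 0"
  shows "chart_preimage N \<Delta> (chart_image \<rho> :: ('v, 'k) toric_point set) \<sigma> =
    {x \<in> closed_points (S \<sigma>). value_at (Poly_Mapping.single u 1) x \<noteq> 0}"
proof -
  have "chart_map N \<Delta> \<sigma> x \<in> chart_image \<rho> \<longleftrightarrow> value_at (Poly_Mapping.single u 1) x \<noteq> 0"
    if x: "x \<in> closed_points (S \<sigma>)" for x :: "(('v \<Rightarrow> real) \<Rightarrow>\<^sub>0 'k) set"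
  proof -
    obtain \<gamma> where \<gamma>: "monoid_hom (S \<sigma>) \<gamma>" "x = point (S \<sigma>) \<gamma>" using closed_pointE[OF \<sigma> x] .
    then show ?thesis
      using iff value_at_single_point[OF submonoid_cone_semigroup \<gamma>(1) u] by simp
  qed
  then show ?thesis unfolding chart_preimage_def by blast
qed

lemma openin_chart_image:
  assumes \<rho>: "\<rho> \<in> \<Delta>"
  shows "openin (top_of X) (chart_image \<rho> :: ('v, 'k::alg_closed_field) toric_point set)"
  unfolding openin_X
proof (intro conjI ballI)
  show "chart_image \<rho> \<subseteq> chart_points N \<Delta> // (gluing N \<Delta> :: ('v, 'k) chart_point rel)"
    using chart_map_mem[OF \<rho>] by (auto simp: chart_image_def)
  fix \<sigma> assume \<sigma>: "\<sigma> \<in> \<Delta>"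
  interpret function_algebra "closed_points (S \<sigma>)"
    "value_at ` carrier (semigroup_ring (S \<sigma>)) :: ((('v \<Rightarrow> real) \<Rightarrow>\<^sub>0 'k) set \<Rightarrow> 'k) set"
    by (rule function_algebra_chart[OF \<sigma>])
  obtain u where u: "u \<in> S \<sigma>"
    "\<And>\<gamma> :: ('v \<Rightarrow> real) \<Rightarrow> 'k. monoid_hom (S \<sigma>) \<gamma> \<Longrightarrow>
       chart_map N \<Delta> \<sigma> (point (S \<sigma>) \<gamma>) \<in> chart_image \<rho> \<longleftrightarrow> \<gamma> u \<noteq> 0"
    using chart_transition[OF \<sigma> \<rho>] by metis
  have pre: "chart_preimage N \<Delta> (chart_image \<rho> :: ('v, 'k) toric_point set) \<sigma> =
      {x \<in> closed_points (S \<sigma>). value_at (Poly_Mapping.single u 1) x \<noteq> 0}"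
    by (rule chart_preimage_chart_image[OF \<sigma> u])
  show "openin (top_of (affine_chart N \<sigma>)) (chart_preimage N \<Delta> (chart_image \<rho> :: ('v, 'k) toric_point set) \<sigma>)"
    unfolding pre affine_chart_eq
    by (rule openin_nonzero) (rule imageI[OF single_mem_carrier[OF u(1)]])
qed

lemma regular_chart_char:
  assumes \<rho>: "\<rho> \<in> \<Delta>" and w: "w \<in> S \<rho>"
  shows "chart_char \<rho> w \<in> regular X (chart_image \<rho> :: ('v, 'k::alg_closed_field) toric_point set)"
  unfolding regular_X
proof
  fix \<sigma> assume \<sigma>: "\<sigma> \<in> \<Delta>"
  interpret function_algebra "closed_points (S \<sigma>)"
    "value_at ` carrier (semigroup_ring (S \<sigma>)) :: ((('v \<Rightarrow> real) \<Rightarrow>\<^sub>0 'k) set \<Rightarrow> 'k) set"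
    by (rule function_algebra_chart[OF \<sigma>])
  obtain u where u: "u \<in> S \<sigma>"
    "\<And>\<gamma> :: ('v \<Rightarrow> real) \<Rightarrow> 'k. monoid_hom (S \<sigma>) \<gamma> \<Longrightarrow>
       chart_map N \<Delta> \<sigma> (point (S \<sigma>) \<gamma>) \<in> chart_image \<rho> \<longleftrightarrow> \<gamma> u \<noteq> 0"
    "\<exists>n. w + of_nat n * u \<in> S \<sigma> \<and>
       (\<forall>\<gamma> :: ('v \<Rightarrow> real) \<Rightarrow> 'k. monoid_hom (S \<sigma>) \<gamma> \<longrightarrow> \<gamma> u \<noteq> 0 \<longrightarrow>
         chart_char \<rho> w (chart_map N \<Delta> \<sigma> (point (S \<sigma>) \<gamma>)) = \<gamma> (w + of_nat n * u) / \<gamma> u ^ n)"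
    using chart_transition[OF \<sigma> \<rho>] w by metis
  obtain n where n: "w + of_nat n * u \<in> S \<sigma>"
    "\<And>\<gamma> :: ('v \<Rightarrow> real) \<Rightarrow> 'k. monoid_hom (S \<sigma>) \<gamma> \<Longrightarrow> \<gamma> u \<noteq> 0 \<Longrightarrow>
         chart_char \<rho> w (chart_map N \<Delta> \<sigma> (point (S \<sigma>) \<gamma>)) = \<gamma> (w + of_nat n * u) / \<gamma> u ^ n"
    using u(3) by blast
  let ?D = "{x \<in> closed_points (S \<sigma>). value_at (Poly_Mapping.single u (1 :: 'k)) x \<noteq> 0}"
  have oD: "openin Z ?D" by (rule openin_nonzero) (rule imageI[OF single_mem_carrier[OF u(1)]])
  have nu: "of_nat n * u \<in> S \<sigma>" by (rule cone_semigroup_of_nat_mult[OF u(1)])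
  have "chart_char \<rho> w \<circ> chart_map N \<Delta> \<sigma> \<in> R ?D"
  proof (rule regular_quotient[OF oD imageI[OF single_mem_carrier[OF n(1)]] imageI[OF single_mem_carrier[OF nu]]])
    fix x assume x: "x \<in> ?D"
    then have "x \<in> closed_points (S \<sigma>)" by simp
    then obtain \<gamma> where \<gamma>: "monoid_hom (S \<sigma>) \<gamma>" "x = point (S \<sigma>) \<gamma>" using closed_pointE[OF \<sigma>] by blast
    note val = value_at_single_point[OF submonoid_cone_semigroup \<gamma>(1)]
    have nz: "\<gamma> u \<noteq> 0" using x val[OF u(1)] \<gamma>(2) by simp
    have "\<gamma> (of_nat n * u) = \<gamma> u ^ n" by (rule monoid_hom_of_nat_mult[OF submonoid_cone_semigroup u(1) \<gamma>(1)])
    then show "value_at (Poly_Mapping.single (of_nat n * u) 1) x \<noteq> 0 \<and>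
        (chart_char \<rho> w \<circ> chart_map N \<Delta> \<sigma>) x =
          value_at (Poly_Mapping.single (w + of_nat n * u) 1) x / value_at (Poly_Mapping.single (of_nat n * u) 1) x"
      unfolding \<gamma>(2) val[OF n(1)] val[OF nu] using n(2)[OF \<gamma>(1) nz] nz by simp
  qed
  moreover have "chart_preimage N \<Delta> (chart_image \<rho> :: ('v, 'k) toric_point set) \<sigma> = ?D"
    by (rule chart_preimage_chart_image[OF \<sigma> u(1,2)])
  ultimately show "chart_char \<rho> w \<circ> chart_map N \<Delta> \<sigma> \<in>
      regular (affine_chart N \<sigma>) (chart_preimage N \<Delta> (chart_image \<rho> :: ('v, 'k) toric_point set) \<sigma>)"
    unfolding affine_chart_eq by simp
qed

end

section \<open>Limits of one-parameter subgroups\<close>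

definition affine_line :: "('k::field, 'k) fspace" where
  "affine_line = fspace_of UNIV (range poly)"

lemma function_algebra_affine_line: "function_algebra UNIV (range (poly :: 'k::field poly \<Rightarrow> 'k \<Rightarrow> 'k))"
proof
  show "\<exists>c\<in>range (poly :: 'k poly \<Rightarrow> _). \<forall>x\<in>UNIV. c x = 0" by (intro bexI[of _ "poly 0"]) auto
  show "\<exists>c\<in>range (poly :: 'k poly \<Rightarrow> _). \<forall>x\<in>UNIV. c x = 1" by (intro bexI[of _ "poly 1"]) auto
  fix a b :: "'k \<Rightarrow> 'k" assume "a \<in> range poly" "b \<in> range poly"
  then obtain p q where ab: "a = poly p" "b = poly q" by blast
  show "\<exists>c\<in>range poly. \<forall>x\<in>UNIV. c x = a x + b x"
    by (intro bexI[of _ "poly (p + q)"]) (auto simp: ab)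
  show "\<exists>c\<in>range poly. \<forall>x\<in>UNIV. c x = a x * b x"
    by (intro bexI[of _ "poly (p * q)"]) (auto simp: ab)
qed

text \<open>A negative power has a pole at 0. With denominators cleared, the equation becomes one
  between polynomials, since a polynomial that vanishes on all of \<open>k\<close> is zero, and
  evaluating at 0 contradicts \<open>poly b 0 \<noteq> 0\<close>.\<close>

lemma power_eq_quotient_imp_nonneg:
  fixes a b :: "'k::alg_closed_field poly"
  assumes b: "poly b 0 \<noteq> 0" and eq: "\<And>s. s \<noteq> 0 \<Longrightarrow> poly b s \<noteq> 0 \<Longrightarrow> s powi k = poly a s / poly b s"
  shows "0 \<le> k"
proof (rule ccontr)
  assume k: "\<not> 0 \<le> k"
  define n where "n = nat (- k)"
  have n: "0 < n" "k = - int n" using k by (auto simp: n_def)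
  \<comment> \<open>The factors X and \<open>b\<close> make \<open>h\<close> vanish also at the
    points where the hypothesis says nothing.\<close>
  define h where "h = [:0, 1:] * b * (monom 1 n * a - b)"
  have "poly h s = 0" for s
  proof (cases "s = 0 \<or> poly b s = 0")
    case False
    then have "inverse (s ^ n) = poly a s / poly b s"
      using eq[of s] by (simp add: n(2) power_int_minus)
    then show ?thesis using False by (simp add: h_def poly_monom field_simps)
  qed (auto simp: h_def)
  then have "h = 0" using alg_closed_poly_nonroot by metis
  moreover have "b \<noteq> 0" using b by auto
  ultimately have "monom 1 n * a = b" by (simp add: h_def)
  then have "poly b 0 = 0 ^ n * poly a 0" by (metis mult_1 poly_monom Polynomial.poly_mult)
  then show False using b n(1) by simp
qed

context fan_in_lattice
begin

lemma semigroup_value: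
  assumes "u \<in> S \<sigma>" "v \<in> \<sigma>" "v \<in> N" shows "u v = of_int \<lfloor>u v\<rfloor>" "0 \<le> \<lfloor>u v\<rfloor>"
  using assms by (auto simp: cone_semigroup_def dual_cone_def dual_lattice_def elim!: Ints_cases)

lemma lattice_value: "u \<in> dual_lattice N \<Longrightarrow> v \<in> N \<Longrightarrow> u v = of_int \<lfloor>u v\<rfloor>"
  by (auto simp: dual_lattice_def elim!: Ints_cases)

text \<open>The one-parameter subgroup of \<open>v\<close>, extended over s = 0 in a chart where all
  exponents are nonnegative. As \<open>0 ^ 0 = 1\<close>, its value at 0 is the point whose
  homomorphism is 1 where u(v) = 0 and 0 elsewhere.\<close>

definition curve :: "'v set \<Rightarrow> 'v \<Rightarrow> 'k::alg_closed_field \<Rightarrow> ('v, 'k) toric_point" where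
  "curve \<sigma> v s = chart_map N \<Delta> \<sigma> (point (S \<sigma>) (\<lambda>u. s ^ nat \<lfloor>u v\<rfloor>))"

lemma monoid_hom_curve:
  assumes "v \<in> \<sigma>" "v \<in> N"
  shows "monoid_hom (S \<sigma>) (\<lambda>u. (s :: 'k::field) ^ nat \<lfloor>u v\<rfloor>)"
  unfolding monoid_hom_def
proof (intro conjI ballI)
  show "s ^ nat \<lfloor>(0 :: 'v \<Rightarrow> real) v\<rfloor> = 1" by (simp add: zero_fun_apply)
  fix a b assume ab: "a \<in> S \<sigma>" "b \<in> S \<sigma>"
  obtain i j where "a v = of_int i" "b v = of_int j" "0 \<le> i" "0 \<le> j"
    using semigroup_value[OF ab(1) assms] semigroup_value[OF ab(2) assms] by blast
  then show "s ^ nat \<lfloor>(a + b) v\<rfloor> = s ^ nat \<lfloor>a v\<rfloor> * s ^ nat \<lfloor>b v\<rfloor>"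
    by (simp add: plus_fun_apply nat_add_distrib power_add flip: of_int_add)
qed

lemma morphism_curve:
  assumes \<sigma>: "\<sigma> \<in> \<Delta>" and v: "v \<in> \<sigma>" "v \<in> N"
  shows "morphism affine_line X (curve \<sigma> v :: 'k::alg_closed_field \<Rightarrow> _)"
proof -
  let ?c = "\<lambda>s :: 'k. point (S \<sigma>) (\<lambda>u. s ^ nat \<lfloor>u v\<rfloor>)"
  have "morphism affine_line (affine_chart N \<sigma>) ?c"
    unfolding affine_line_def affine_chart_eq
  proof (rule morphism_fspace_of[OF function_algebra_affine_line function_algebra_chart[OF \<sigma>]])
    show "?c s \<in> closed_points (S \<sigma>)" for s
      by (rule point_mem_closed_points[OF submonoid_cone_semigroup monoid_hom_curve[OF v]])
    fix b :: "(('v \<Rightarrow> real) \<Rightarrow>\<^sub>0 'k) set \<Rightarrow> 'k"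
    assume "b \<in> value_at ` carrier (semigroup_ring (S \<sigma>))"
    then obtain f :: "('v \<Rightarrow> real) \<Rightarrow>\<^sub>0 'k"
      where f: "f \<in> carrier (semigroup_ring (S \<sigma>))" "b = value_at f" by blast
    \<comment> \<open>The character \<open>\<chi>\<^sup>u\<close> pulls back to s to the power u(v),
      so a finite combination of characters becomes a polynomial in s.\<close>
    define p where "p = (\<Sum>u\<in>Poly_Mapping.keys f. monom (Poly_Mapping.lookup f u) (nat \<lfloor>u v\<rfloor>))"
    have "poly p s = b (?c s)" for s
      unfolding f(2) value_at_point[OF submonoid_cone_semigroup monoid_hom_curve[OF v] f(1)]
      by (simp add: p_def poly_sum poly_monom ev_def)
    then show "\<exists>a\<in>range poly. \<forall>s\<in>UNIV. a s = b (?c s)" by blast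
  qed
  from morphism_comp[OF this morphism_chart_map[OF \<sigma>]] show ?thesis
    by (simp add: comp_def curve_def[abs_def])
qed

lemma monoid_hom_torus:
  assumes "v \<in> N" "(s :: 'k::field) \<noteq> 0"
  shows "monoid_hom (S {0}) (\<lambda>u. s powi \<lfloor>u v\<rfloor>)"
  unfolding monoid_hom_def cone_semigroup_zero_cone
proof (intro conjI ballI)
  show "s powi \<lfloor>(0 :: 'v \<Rightarrow> real) v\<rfloor> = 1" by (simp add: zero_fun_apply)
  fix a b assume ab: "a \<in> dual_lattice N" "b \<in> dual_lattice N"
  obtain i j where "a v = of_int i" "b v = of_int j"
    using lattice_value[OF ab(1) assms(1)] lattice_value[OF ab(2) assms(1)] by blast
  then show "s powi \<lfloor>(a + b) v\<rfloor> = s powi \<lfloor>a v\<rfloor> * s powi \<lfloor>b v\<rfloor>"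
    using assms(2) by (simp add: plus_fun_apply power_int_add flip: of_int_add)
qed

lemma chart_map_zero_cone:
  fixes \<gamma> :: "('v \<Rightarrow> real) \<Rightarrow> 'k::alg_closed_field"
  assumes "\<sigma> \<in> \<Delta>" "monoid_hom (S {0}) \<gamma>"
  shows "chart_map N \<Delta> \<sigma> (point (S \<sigma>) \<gamma>) = chart_map N \<Delta> {0} (point (S {0}) \<gamma>)"
proof -
  have "\<sigma> \<inter> {0} = {0}" using fan_cone_nonempty[OF fan assms(1)] by blast
  then show ?thesis using assms by (intro chart_map_restrict zero_cone_in_fan[OF fan]) auto
qed

text \<open>Away from 0 the curve runs in the torus, where the multiplication is prescribed. The two
  kinds of power agree on \<open>S \<sigma>\<close>, as the exponents are nonnegative there.\<close>

lemma curve_nonzero: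
  fixes s :: "'k::alg_closed_field"
  assumes "\<sigma> \<in> \<Delta>" "v \<in> \<sigma>" "v \<in> N" "s \<noteq> 0"
  shows "curve \<sigma> v s = chart_map N \<Delta> {0} (point (S {0}) (\<lambda>u. s powi \<lfloor>u v\<rfloor>))"
proof -
  have "point (S \<sigma>) (\<lambda>u. s ^ nat \<lfloor>u v\<rfloor>) = point (S \<sigma>) (\<lambda>u. s powi \<lfloor>u v\<rfloor>)"
    using semigroup_value(2)[OF _ assms(2,3)] by (intro point_cong) (simp add: power_int_def)
  then show ?thesis
    unfolding curve_def using chart_map_zero_cone[OF assms(1) monoid_hom_torus[OF assms(3,4)]] by simp
qed

text \<open>In terms of homomorphisms the group law is the pointwise product, as the values of the
  monomials at a point are those of its homomorphism.\<close>

lemma torus_mult_point: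
  fixes \<gamma> \<delta> :: "('v \<Rightarrow> real) \<Rightarrow> 'k::field"
  assumes "monoid_hom (S {0}) \<gamma>" "monoid_hom (S {0}) \<delta>"
  shows "torus_mult N (point (S {0}) \<gamma>) (point (S {0}) \<delta>) = point (S {0}) (\<lambda>u. \<gamma> u * \<delta> u)"
proof -
  have "(\<Sum>u\<in>Poly_Mapping.keys f. Poly_Mapping.lookup f u *
         (value_at (Poly_Mapping.single u 1) (point (S {0}) \<gamma>) *
          value_at (Poly_Mapping.single u 1) (point (S {0}) \<delta>))) = ev (\<lambda>u. \<gamma> u * \<delta> u) f"
    if "f \<in> carrier (semigroup_ring (S {0}))" for f :: "('v \<Rightarrow> real) \<Rightarrow>\<^sub>0 'k"
    unfolding ev_def using that
    by (intro sum.cong refl)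
      (auto simp: mem_carrier_semigroup_ring subset_iff
        value_at_single_point[OF submonoid_cone_semigroup assms(1)]
        value_at_single_point[OF submonoid_cone_semigroup assms(2)])
  then show ?thesis
    unfolding torus_mult_def point_def[of _ "\<lambda>u. \<gamma> u * \<delta> u"] cone_semigroup_zero_cone
    by (intro Collect_cong) auto
qed

lemma monoid_hom_mult:
  "monoid_hom T \<gamma> \<Longrightarrow> monoid_hom T \<delta> \<Longrightarrow> monoid_hom T (\<lambda>u. \<gamma> u * \<delta> u)"
  by (simp add: monoid_hom_def)

text \<open>
  Near the product of the two limit points the function \<open>\<chi>\<^sup>u\<close> is regular; along the product of
  the two curves it is \<open>s\<close> to the power \<open>u (v + w)\<close>, which therefore has no pole at \<open>s = 0\<close>.
\<close>

lemma product_limit_nonneg: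
  fixes \<mu> :: "('v, 'k::alg_closed_field) toric_point \<times> ('v, 'k) toric_point \<Rightarrow> ('v, 'k) toric_point"
  assumes sg: "toric_semigroup N \<Delta> \<mu>"
    and v: "\<sigma> \<in> \<Delta>" "v \<in> \<sigma>" "v \<in> N" and w: "\<tau> \<in> \<Delta>" "w \<in> \<tau>" "w \<in> N"
    and \<rho>: "\<rho> \<in> \<Delta>" and mem: "\<mu> (curve \<sigma> v 0, curve \<tau> w 0) \<in> chart_image \<rho>" and u: "u \<in> S \<rho>"
  shows "0 \<le> u v + u w"
proof -
  let ?C = "\<lambda>s :: 'k. (curve \<sigma> v s, curve \<tau> w s)"
  interpret function_algebra UNIV "range (poly :: 'k poly \<Rightarrow> 'k \<Rightarrow> 'k)"
    by (rule function_algebra_affine_line)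
  have mor\<mu>: "morphism (prod_fspace X X) X \<mu>"
    and tor: "\<And>s t. s \<in> closed_points (S {0}) \<Longrightarrow> t \<in> closed_points (S {0}) \<Longrightarrow>
      \<mu> (chart_map N \<Delta> {0} s, chart_map N \<Delta> {0} t) = chart_map N \<Delta> {0} (torus_mult N s t)"
    using sg by (auto simp: toric_semigroup_def semigroup_morphism_def)
  have "morphism affine_line (prod_fspace X X) ?C"
    using morphism_curve[OF v] morphism_curve[OF w] unfolding affine_line_def
    by (intro morphism_pair[OF function_algebra_affine_line] regular_X_one)
  then have mor: "morphism affine_line X (\<mu> \<circ> ?C)" by (rule morphism_comp[OF _ mor\<mu>])
  \<comment> \<open>The preimage of an open chart image. It contains 0, so regularity there yields a
    quotient whose denominator does not vanish at 0.\<close>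
  define U where "U = {s \<in> points affine_line. (\<mu> \<circ> ?C) s \<in> chart_image \<rho>}"
  have "chart_char \<rho> u \<circ> (\<mu> \<circ> ?C) \<in> R U"
    unfolding U_def using morphism_regular[OF mor openin_chart_image[OF \<rho>] regular_chart_char[OF \<rho> u]]
    by (simp add: affine_line_def)
  moreover have "0 \<in> U" using mem by (simp add: U_def affine_line_def)
  ultimately obtain a b :: "'k poly" where b: "poly b 0 \<noteq> 0"
    and ab: "\<And>s. poly b s \<noteq> 0 \<Longrightarrow> (chart_char \<rho> u \<circ> (\<mu> \<circ> ?C)) s = poly a s / poly b s"
    using regularD[of "chart_char \<rho> u \<circ> (\<mu> \<circ> ?C)" U 0] by auto
  have uM: "u \<in> dual_lattice N" using u by (simp add: cone_semigroup_def)
  have "s powi (\<lfloor>u v\<rfloor> + \<lfloor>u w\<rfloor>) = poly a s / poly b s" if s: "s \<noteq> 0" "poly b s \<noteq> 0" for s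
  proof -
    let ?g = "\<lambda>u. s powi \<lfloor>u v\<rfloor>" and ?h = "\<lambda>u. s powi \<lfloor>u w\<rfloor>"
    have g: "monoid_hom (S {0}) ?g" and h: "monoid_hom (S {0}) ?h"
      using monoid_hom_torus[OF v(3) s(1)] monoid_hom_torus[OF w(3) s(1)] .
    have gh: "monoid_hom (S {0}) (\<lambda>u. ?g u * ?h u)" by (rule monoid_hom_mult[OF g h])
    have "\<mu> (?C s) = chart_map N \<Delta> {0} (point (S {0}) (\<lambda>u. ?g u * ?h u))"
      unfolding curve_nonzero[OF v s(1)] curve_nonzero[OF w s(1)] torus_mult_point[OF g h, symmetric]
      by (intro tor point_mem_closed_points[OF submonoid_cone_semigroup] g h)
    also have "\<dots> = chart_map N \<Delta> \<rho> (point (S \<rho>) (\<lambda>u. ?g u * ?h u))"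
      by (rule chart_map_zero_cone[OF \<rho> gh, symmetric])
    finally have "chart_char \<rho> u (\<mu> (?C s)) = ?g u * ?h u"
    proof -
      assume *: "\<mu> (?C s) = chart_map N \<Delta> \<rho> (point (S \<rho>) (\<lambda>u. ?g u * ?h u))"
      have "monoid_hom (S \<rho>) (\<lambda>u. ?g u * ?h u)"
        using fan_cone_nonempty[OF fan \<rho>] by (intro monoid_hom_subset[OF gh] cone_semigroup_mono) blast
      from chart_char_point[OF \<rho> this u] show ?thesis unfolding * .
    qed
    then show ?thesis using ab[OF s(2)] s(1) by (simp add: power_int_add)
  qed
  then have "0 \<le> \<lfloor>u v\<rfloor> + \<lfloor>u w\<rfloor>" using power_eq_quotient_imp_nonneg[OF b] by blast
  then show ?thesis using lattice_value[OF uM v(3)] lattice_value[OF uM w(3)] by linarith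
qed

text \<open>A positive factor does not change whether an exponent is 0, and a power of 0 depends on
  nothing else.\<close>

lemma curve_0_scale:
  assumes "v \<in> \<sigma>" "v \<in> N" "0 < i"
  shows "curve \<sigma> (real i *\<^sub>R v) (0 :: 'k::alg_closed_field) = curve \<sigma> v 0"
proof -
  have "(0 :: 'k) ^ nat \<lfloor>u (real i *\<^sub>R v)\<rfloor> = 0 ^ nat \<lfloor>u v\<rfloor>" if u: "u \<in> S \<sigma>" for u
  proof -
    have "linear u" using u by (simp add: cone_semigroup_def dual_cone_def)
    then have uv: "u (real i *\<^sub>R v) = real i * u v" by (simp add: linear_cmul)
    obtain j where j: "u v = of_int j" "0 \<le> j" using semigroup_value[OF u assms(1,2)] by blast
    have "u (real i *\<^sub>R v) = of_int (int i * j)" by (simp add: uv j(1))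
    then have "\<lfloor>u (real i *\<^sub>R v)\<rfloor> = int i * j" by (metis floor_of_int)
    then show ?thesis using j assms(3) by (simp add: power_0_left nat_mult_distrib)
  qed
  then have "point (S \<sigma>) (\<lambda>u. (0 :: 'k) ^ nat \<lfloor>u (real i *\<^sub>R v)\<rfloor>) = point (S \<sigma>) (\<lambda>u. 0 ^ nat \<lfloor>u v\<rfloor>)"
    by (rule point_cong)
  then show ?thesis by (simp add: curve_def)
qed

lemma nonneg_if_multiples:
  fixes a b :: real
  assumes "\<And>i j :: nat. 0 < i \<Longrightarrow> 0 < j \<Longrightarrow> 0 \<le> real i * a + real j * b"
  shows "0 \<le> a"
proof (rule ccontr)
  assume a: "\<not> 0 \<le> a"
  \<comment> \<open>With \<open>j = 1\<close> fixed, \<open>i\<close> is so large that a negative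
    \<open>i * a\<close> outweighs \<open>b\<close>; the absolute value makes sure that
    \<open>i\<close> is positive.\<close>
  obtain i :: nat where i: "\<bar>b\<bar> / (- a) < real i" using reals_Archimedean2 by blast
  then have "b < real i * (- a)" using a by (simp add: field_simps)
  moreover have "0 \<le> \<bar>b\<bar> / (- a)" using a by (intro divide_nonneg_nonneg) auto
  then have "0 < i" using i by linarith
  ultimately show False using assms[of i 1] by simp
qed

lemma common_cone:
  fixes \<mu> :: "('v, 'k::alg_closed_field) toric_point \<times> ('v, 'k) toric_point \<Rightarrow> ('v, 'k) toric_point"
  assumes sg: "toric_semigroup N \<Delta> \<mu>" and \<sigma>: "\<sigma> \<in> \<Delta>" and \<tau>: "\<tau> \<in> \<Delta>"
  obtains \<rho> where "\<rho> \<in> \<Delta>" "\<sigma> \<subseteq> \<rho>" "\<tau> \<subseteq> \<rho>"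
proof -
  obtain F where F: "cone_gens N \<sigma> F" using fan_gens[OF fan \<sigma>] .
  obtain H where H: "cone_gens N \<tau> H" using fan_gens[OF fan \<tau>] .
  define v w where "v = \<Sum>F" and "w = \<Sum>H"
  have v: "v \<in> \<sigma>" "v \<in> N" using cone_gens_sumI[OF F, of "\<lambda>_. 1"] lattice_in_sum[OF N] F
    by (auto simp: v_def cone_gens_def)
  have w: "w \<in> \<tau>" "w \<in> N" using cone_gens_sumI[OF H, of "\<lambda>_. 1"] lattice_in_sum[OF N] H
    by (auto simp: w_def cone_gens_def)
  have cones: "cone \<sigma>" "cone \<tau>" using fan \<sigma> \<tau> by (auto simp: fan_def)
  define z where "z = \<mu> (curve \<sigma> v 0, curve \<tau> w 0)"
  have "z \<in> points X"
  proof -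
    have "morphism (prod_fspace X X) X \<mu>" using sg by (simp add: toric_semigroup_def semigroup_morphism_def)
    moreover have "morphism affine_line (prod_fspace X X) (\<lambda>s :: 'k. (curve \<sigma> v s, curve \<tau> w s))"
      using morphism_curve[OF \<sigma> v] morphism_curve[OF \<tau> w] unfolding affine_line_def
      by (intro morphism_pair[OF function_algebra_affine_line] regular_X_one)
    ultimately have "morphism affine_line X (\<mu> \<circ> (\<lambda>s :: 'k. (curve \<sigma> v s, curve \<tau> w s)))"
      by (rule morphism_comp[rotated])
    moreover have "(0 :: 'k) \<in> points affine_line"
      unfolding affine_line_def function_algebra.topspace_Z[OF function_algebra_affine_line] by simp
    ultimately have "(\<mu> \<circ> (\<lambda>s :: 'k. (curve \<sigma> v s, curve \<tau> w s))) 0 \<in> points X"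
      by (rule morphism_points)
    then show ?thesis by (simp add: z_def)
  qed
  then obtain \<rho> y where \<rho>: "\<rho> \<in> \<Delta>" "y \<in> closed_points (S \<rho>)" "z = chart_map N \<Delta> \<rho> y"
    by (rule points_XE)
  then have z: "z \<in> chart_image \<rho>" by (simp add: chart_image_def)
  have nn: "0 \<le> real i * u v + real j * u w" if u: "u \<in> S \<rho>" and ij: "0 < i" "0 < j" for u i j
  proof -
    have "linear u" using u by (simp add: cone_semigroup_def dual_cone_def)
    moreover have "0 \<le> u (real i *\<^sub>R v) + u (real j *\<^sub>R w)"
      using z u unfolding z_def
      by (intro product_limit_nonneg[OF sg \<sigma> _ _ \<tau> _ _ \<rho>(1)])
        (auto simp: curve_0_scale[OF v ij(1)] curve_0_scale[OF w ij(2)] mem_cone cones v w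
          lattice_in_scale[OF N])
    ultimately show ?thesis by (simp add: linear_cmul)
  qed
  have "v \<in> \<rho>"
    using nn nonneg_if_multiples by (intro mem_cone_if_semigroup_nonneg[OF N fan \<rho>(1) v(2)]) blast
  then have "\<sigma> \<inter> \<rho> = \<sigma>"
    using face_contains_interior[OF F fan_Int(2)[OF fan \<sigma> \<rho>(1)]] v(1) by (simp add: v_def)
  moreover have "w \<in> \<rho>"
  proof (rule mem_cone_if_semigroup_nonneg[OF N fan \<rho>(1) w(2)])
    fix u assume u: "u \<in> S \<rho>"
    show "0 \<le> u w"
    proof (rule nonneg_if_multiples[of _ "u v"])
      fix i j :: nat assume "0 < i" "0 < j"
      then show "0 \<le> real i * u w + real j * u v" using nn[OF u, of j i] by simp
    qed
  qed
  then have "\<tau> \<inter> \<rho> = \<tau>"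
    using face_contains_interior[OF H fan_Int(2)[OF fan \<tau> \<rho>(1)]] w(1) by (simp add: w_def)
  ultimately show ?thesis using that \<rho>(1) by blast
qed

text \<open>Any two cones have an upper bound in the fan, so a maximal cone is the largest
  one.\<close>

lemma largest_cone:
  fixes \<mu> :: "('v, 'k::alg_closed_field) toric_point \<times> ('v, 'k) toric_point \<Rightarrow> ('v, 'k) toric_point"
  assumes sg: "toric_semigroup N \<Delta> \<mu>"
  obtains \<sigma> where "\<sigma> \<in> \<Delta>" "\<And>\<tau>. \<tau> \<in> \<Delta> \<Longrightarrow> \<tau> \<subseteq> \<sigma>"
proof -
  have "finite \<Delta>" "\<Delta> \<noteq> {}" using fan by (auto simp: fan_def)
  then obtain \<sigma> where \<sigma>: "\<sigma> \<in> \<Delta>" "\<And>\<rho>. \<rho> \<in> \<Delta> \<Longrightarrow> \<sigma> \<subseteq> \<rho> \<Longrightarrow> \<sigma> = \<rho>"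
    using finite_has_maximal[of \<Delta>] by blast
  have "\<tau> \<subseteq> \<sigma>" if \<tau>: "\<tau> \<in> \<Delta>" for \<tau>
  proof -
    obtain \<rho> where "\<rho> \<in> \<Delta>" "\<sigma> \<subseteq> \<rho>" "\<tau> \<subseteq> \<rho>" using common_cone[OF sg \<sigma>(1) \<tau>] .
    then show ?thesis using \<sigma>(2) by blast
  qed
  then show ?thesis using that \<sigma>(1) by blast
qed

end

section \<open>Affine charts as zero loci\<close>

lemma monoid_hom_sum:
  assumes T: "submonoid_set T" and \<gamma>: "monoid_hom T \<gamma>" and f: "\<And>i. i \<in> I \<Longrightarrow> f i \<in> T"
  shows "sum f I \<in> T" "\<gamma> (sum f I) = (\<Prod>i\<in>I. \<gamma> (f i))"
proof -
  have "sum f I \<in> T \<and> \<gamma> (sum f I) = (\<Prod>i\<in>I. \<gamma> (f i))"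
    using f
  proof (induct I rule: infinite_finite_induct)
    case (insert i I)
    then show ?case using T \<gamma> by (simp add: submonoid_set_def monoid_hom_def)
  qed (use T \<gamma> in \<open>auto simp: submonoid_set_def monoid_hom_def\<close>)
  then show "sum f I \<in> T" "\<gamma> (sum f I) = (\<Prod>i\<in>I. \<gamma> (f i))" by blast+
qed

lemma poly_fun_sum:
  assumes "\<And>i. i \<in> I \<Longrightarrow> f i \<in> poly_fun m" shows "(\<lambda>x. \<Sum>i\<in>I. f i x) \<in> poly_fun m"
  using assms
  by (induct I rule: infinite_finite_induct) (auto intro: poly_fun.intros)

lemma poly_fun_prod:
  assumes "\<And>i. i \<in> I \<Longrightarrow> f i \<in> poly_fun m" shows "(\<lambda>x. \<Prod>i\<in>I. f i x) \<in> poly_fun m"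
  using assms
  by (induct I rule: infinite_finite_induct) (auto intro: poly_fun.intros)

lemma poly_fun_power: "p \<in> poly_fun m \<Longrightarrow> (\<lambda>x. p x ^ n) \<in> poly_fun m"
  by (induct n) (auto intro: poly_fun.intros)

lemma poly_fun_diff:
  assumes "p \<in> poly_fun m" "q \<in> poly_fun m" shows "(\<lambda>x. p x - q x) \<in> poly_fun m"
  using poly_fun.poly_add[OF assms(1) poly_fun.poly_mult[OF poly_fun.poly_const[of "- 1"] assms(2)]]
  by simp

lemma function_algebra_poly_fun: "function_algebra Y (poly_fun m)"
proof
  show "\<exists>c\<in>poly_fun m. \<forall>x\<in>Y. c x = 0" by (intro bexI[OF _ poly_fun.poly_const[of 0]]) simp
  show "\<exists>c\<in>poly_fun m. \<forall>x\<in>Y. c x = 1" by (intro bexI[OF _ poly_fun.poly_const[of 1]]) simp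
  fix a b :: "(nat \<Rightarrow> 'a) \<Rightarrow> 'a" assume ab: "a \<in> poly_fun m" "b \<in> poly_fun m"
  show "\<exists>c\<in>poly_fun m. \<forall>x\<in>Y. c x = a x + b x" by (intro bexI[OF _ poly_fun.poly_add[OF ab]]) simp
  show "\<exists>c\<in>poly_fun m. \<forall>x\<in>Y. c x = a x * b x" by (intro bexI[OF _ poly_fun.poly_mult[OF ab]]) simp
qed

definition monomial :: "nat \<Rightarrow> (nat \<Rightarrow> nat) \<Rightarrow> (nat \<Rightarrow> 'k::field) \<Rightarrow> 'k" where
  "monomial m a x = (\<Prod>i<m. x i ^ a i)"

lemma monomial_mem_poly_fun: "monomial m a \<in> poly_fun m"
  unfolding monomial_def[abs_def] by (intro poly_fun_prod poly_fun_power poly_fun.poly_coord) simp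

lemma monomial_add: "monomial m (\<lambda>i. a i + b i) x = monomial m a x * monomial m b x"
  by (simp add: monomial_def power_add prod.distrib)

text \<open>The embedding sends a homomorphism to its values on the generators. The equations are
  the binomials of the toric ideal, one for each pair of exponent vectors with the same sum in
  \<open>T\<close>; they make the monomials of a point of the zero locus a well-defined homomorphism
  on \<open>T\<close>.\<close>

lemma isomorphic_Spec_zero_locus:
  fixes T :: "('v \<Rightarrow> real) set"
  assumes T: "submonoid_set T" and G: "finite G" "G \<subseteq> T" "T \<subseteq> monoid_span G"
  shows "\<exists>m F. F \<subseteq> poly_fun m \<and>
    isomorphic_fspace (Spec T :: (_, 'k::alg_closed_field) fspace) (fspace_of (zero_locus m F) (poly_fun m))"
proof -
  have closed: "closed_points T = {point T \<gamma> |\<gamma> :: ('v \<Rightarrow> real) \<Rightarrow> 'k. monoid_hom T \<gamma>}"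
    by (rule closed_points_eq_points[OF T G])
  obtain us where us: "set us = G" using finite_list[OF G(1)] by blast
  define m where "m = length us"
  have usT: "us ! i \<in> T" if "i < m" for i using that us G(2) by (auto simp: m_def)
  \<comment> \<open>The surjection from exponent vectors onto the generated semigroup; entries with
    index \<open>m\<close> or larger are ignored.\<close>
  define comb where "comb a = (\<Sum>i<m. of_nat (a i) * us ! i)" for a :: "nat \<Rightarrow> nat"
  have comb_add: "comb (\<lambda>i. a i + b i) = comb a + comb b" for a b
    by (simp add: comb_def distrib_right sum.distrib)
  have unit: "comb (\<lambda>i. if i = j then 1 else 0) = us ! j" if "j < m" for j
  proof -
    have "(\<Sum>i<m. of_nat (if i = j then 1 else 0) * us ! i) = (\<Sum>i<m. if i = j then us ! i else 0)"
      by (intro sum.cong) auto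
    then show ?thesis using that by (simp add: comb_def)
  qed
  have comb_ex: "\<exists>a. comb a = u" if "u \<in> T" for u
  proof -
    have "u \<in> monoid_span G" using that G(3) by blast
    then show ?thesis
    proof induct
      case zero
      have "comb (\<lambda>_. 0) = 0" by (simp add: comb_def)
      then show ?case by blast
    next
      case (add g u)
      then obtain a where a: "comb a = u" by blast
      obtain j where j: "j < m" "g = us ! j" using add(1) us by (auto simp: in_set_conv_nth m_def)
      have "comb (\<lambda>i. (if i = j then 1 else 0) + a i) = g + u"
        unfolding comb_add unit[OF j(1)] a j(2) ..
      then show ?case by blast
    qed
  qed
  have hom_comb: "\<gamma> (comb a) = monomial m a (\<lambda>i. \<gamma> (us ! i))"
    if \<gamma>: "monoid_hom T \<gamma>" for \<gamma> :: "('v \<Rightarrow> real) \<Rightarrow> 'k" and a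
    unfolding comb_def monomial_def
    by (subst monoid_hom_sum(2)[OF T \<gamma>])
      (auto intro: submonoid_of_nat_mult[OF T usT] simp: monoid_hom_of_nat_mult[OF T usT \<gamma>])
  have monomial_cong: "monomial m a x = monomial m a y" if "\<And>i. i < m \<Longrightarrow> x i = y i"
    for a and x y :: "nat \<Rightarrow> 'k"
    unfolding monomial_def using that by (intro prod.cong) auto
  define F :: "((nat \<Rightarrow> 'k) \<Rightarrow> 'k) set"
    where "F = {\<lambda>x. monomial m a x - monomial m b x |a b. comb a = comb b}"
  have F: "F \<subseteq> poly_fun m"
    by (auto simp: F_def intro!: poly_fun_diff monomial_mem_poly_fun)
  define Y where "Y = zero_locus m F"
  have Y_eq: "monomial m a x = monomial m b x" if "x \<in> Y" "comb a = comb b" for x a b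
  proof -
    have "(\<lambda>x. monomial m a x - monomial m b x) \<in> F"
      unfolding F_def mem_Collect_eq by (rule exI[of _ a], rule exI[of _ b]) (simp add: that(2))
    moreover have "\<forall>p\<in>F. p x = 0" using that(1) by (simp add: Y_def zero_locus_def)
    ultimately have "monomial m a x - monomial m b x = 0" by (rule bspec[rotated])
    then show ?thesis by simp
  qed
  \<comment> \<open>An arbitrary exponent vector for each element of \<open>T\<close>; on
    \<open>Y\<close> the equations make the corresponding monomial independent of the
    choice.\<close>
  define expo where "expo u = (SOME a. comb a = u)" for u
  have expo: "comb (expo u) = u" if "u \<in> T" for u
    unfolding expo_def by (rule someI_ex[OF comb_ex[OF that]])
  define \<delta> :: "(nat \<Rightarrow> 'k) \<Rightarrow> ('v \<Rightarrow> real) \<Rightarrow> 'k" where "\<delta> x u = monomial m (expo u) x" for x u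
  have \<delta>: "\<delta> x u = monomial m a x" if "x \<in> Y" "u \<in> T" "comb a = u" for x u a
    unfolding \<delta>_def using that by (intro Y_eq) (auto simp: expo)
  have \<delta>_hom: "monoid_hom T (\<delta> x)" if x: "x \<in> Y" for x
    unfolding monoid_hom_def
  proof (intro conjI ballI)
    have "\<delta> x 0 = monomial m (\<lambda>_. 0) x"
      using T by (intro \<delta>[OF x]) (auto simp: submonoid_set_def comb_def)
    then show "\<delta> x 0 = 1" by (simp add: monomial_def)
    fix u w assume uw: "u \<in> T" "w \<in> T"
    have "\<delta> x (u + w) = monomial m (\<lambda>i. expo u i + expo w i) x"
      using T uw by (intro \<delta>[OF x]) (auto simp: submonoid_set_def comb_add expo)
    then show "\<delta> x (u + w) = \<delta> x u * \<delta> x w" by (simp add: monomial_add \<delta>_def)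
  qed
  have \<delta>_gen: "\<delta> x (us ! j) = x j" if "x \<in> Y" "j < m" for x j
  proof -
    have "\<delta> x (us ! j) = monomial m (\<lambda>i. if i = j then 1 else 0) x"
      using that by (intro \<delta> usT unit)
    also have "\<dots> = (\<Prod>i<m. if i = j then x i else 1)"
      unfolding monomial_def by (intro prod.cong) auto
    finally show ?thesis using that(2) by simp
  qed
  \<comment> \<open>The restriction to indices below \<open>m\<close> is essential: points of affine
    space are \<open>undefined\<close> at all other indices.\<close>
  define \<phi> where "\<phi> z = (\<lambda>i\<in>{..<m}. value_at (Poly_Mapping.single (us ! i) (1 :: 'k)) z)"
    for z :: "(('v \<Rightarrow> real) \<Rightarrow>\<^sub>0 'k) set"
  define \<psi> where "\<psi> x = point T (\<delta> x)" for x
  have \<phi>_point: "\<phi> (point T \<gamma>) i = \<gamma> (us ! i)" if "monoid_hom T \<gamma>" "i < m" for \<gamma> :: "('v \<Rightarrow> real) \<Rightarrow> 'k" and i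
    using that value_at_single_point[OF T that(1) usT[OF that(2)]] by (simp add: \<phi>_def)
  have \<phi>_monomial: "monomial m a (\<phi> (point T \<gamma>)) = \<gamma> (comb a)" if "monoid_hom T \<gamma>"
    for \<gamma> :: "('v \<Rightarrow> real) \<Rightarrow> 'k" and a
    unfolding hom_comb[OF that] by (rule monomial_cong) (rule \<phi>_point[OF that])
  have \<phi>_Y: "\<phi> z \<in> Y" if z: "z \<in> closed_points T" for z
  proof -
    obtain \<gamma> where \<gamma>: "monoid_hom T \<gamma>" "z = point T \<gamma>" using z closed by blast
    have "\<phi> z \<in> {..<m} \<rightarrow>\<^sub>E UNIV" by (simp add: \<phi>_def)
    moreover have "p (\<phi> z) = 0" if p: "p \<in> F" for p
    proof -
      obtain a b where "p = (\<lambda>x. monomial m a x - monomial m b x)" "comb a = comb b"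
        using p unfolding F_def by auto
      then show ?thesis by (simp add: \<gamma>(2) \<phi>_monomial[OF \<gamma>(1)])
    qed
    ultimately show ?thesis by (simp add: Y_def zero_locus_def)
  qed
  have \<psi>_closed: "\<psi> x \<in> closed_points T" if "x \<in> Y" for x
    unfolding \<psi>_def by (rule point_mem_closed_points[OF T \<delta>_hom[OF that]])
  have \<psi>\<phi>: "\<psi> (\<phi> z) = z" if z: "z \<in> closed_points T" for z
  proof -
    obtain \<gamma> where \<gamma>: "monoid_hom T \<gamma>" "z = point T \<gamma>" using z closed by blast
    have "\<delta> (\<phi> z) u = \<gamma> u" if "u \<in> T" for u
      using \<phi>_monomial[OF \<gamma>(1)] expo[OF that] by (simp add: \<delta>_def \<gamma>(2))
    then show ?thesis unfolding \<psi>_def \<gamma>(2) by (intro point_cong) (simp add: \<gamma>(2))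
  qed
  have \<phi>\<psi>: "\<phi> (\<psi> x) = x" if x: "x \<in> Y" for x
  proof
    fix i
    show "\<phi> (\<psi> x) i = x i"
    proof (cases "i < m")
      case True
      then show ?thesis by (simp add: \<psi>_def \<phi>_point[OF \<delta>_hom[OF x]] \<delta>_gen[OF x])
    next
      case False
      have "x \<in> {..<m} \<rightarrow>\<^sub>E UNIV" using x by (simp add: Y_def zero_locus_def)
      then have "x i = undefined" using False PiE_arb[of x "{..<m}" "\<lambda>_. UNIV" i] by simp
      then show ?thesis using False by (simp add: \<phi>_def)
    qed
  qed
  have fa: "function_algebra (closed_points T)
      (value_at ` carrier (semigroup_ring T) :: ((('v \<Rightarrow> real) \<Rightarrow>\<^sub>0 'k) set \<Rightarrow> 'k) set)"
    by (rule function_algebra_Spec[OF T closed])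
  interpret S: function_algebra "closed_points T"
    "value_at ` carrier (semigroup_ring T) :: ((('v \<Rightarrow> real) \<Rightarrow>\<^sub>0 'k) set \<Rightarrow> 'k) set" by (rule fa)
  interpret Y: function_algebra Y "poly_fun m :: ((nat \<Rightarrow> 'k) \<Rightarrow> 'k) set"
    by (rule function_algebra_poly_fun)
  have mor\<phi>: "morphism (Spec T) (fspace_of Y (poly_fun m)) \<phi>"
    unfolding Spec_def
  proof (rule morphism_fspace_of[OF fa Y.function_algebra_axioms \<phi>_Y])
    fix p :: "(nat \<Rightarrow> 'k) \<Rightarrow> 'k" assume "p \<in> poly_fun m"
    then show "\<exists>a\<in>value_at ` carrier (semigroup_ring T). \<forall>z\<in>closed_points T. a z = p (\<phi> z)"
    proof induct
      case (poly_const c)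
      have 0: "0 \<in> T" using T by (simp add: submonoid_set_def)
      have "value_at (Poly_Mapping.single 0 c) z = c" if z: "z \<in> closed_points T" for z
      proof -
        obtain \<gamma> where \<gamma>: "monoid_hom T \<gamma>" "z = point T \<gamma>" using z closed by auto
        have "\<gamma> 0 = 1" using \<gamma>(1) by (simp add: monoid_hom_def)
        then show ?thesis
          using value_at_point[OF T \<gamma>(1) single_mem_carrier[OF 0, of c]] by (simp add: \<gamma>(2))
      qed
      then show ?case by (intro bexI[OF _ imageI[OF single_mem_carrier[OF 0, of c]]] ballI)
    next
      case (poly_coord i)
      show ?case
        using poly_coord by (intro bexI[OF _ imageI[OF single_mem_carrier[OF usT[OF poly_coord], of 1]]])
          (simp add: \<phi>_def)
    next
      case (poly_add p q)
      then obtain a b where ab: "a \<in> value_at ` carrier (semigroup_ring T)" "b \<in> value_at ` carrier (semigroup_ring T)"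
        "\<forall>z\<in>closed_points T. a z = p (\<phi> z)" "\<forall>z\<in>closed_points T. b z = q (\<phi> z)" by blast
      from S.add[OF ab(1,2)] show ?case using ab(3,4) by auto
    next
      case (poly_mult p q)
      then obtain a b where ab: "a \<in> value_at ` carrier (semigroup_ring T)" "b \<in> value_at ` carrier (semigroup_ring T)"
        "\<forall>z\<in>closed_points T. a z = p (\<phi> z)" "\<forall>z\<in>closed_points T. b z = q (\<phi> z)" by blast
      from S.mult[OF ab(1,2)] show ?case using ab(3,4) by auto
    qed
  qed
  have mor\<psi>: "morphism (fspace_of Y (poly_fun m)) (Spec T) \<psi>"
    unfolding Spec_def
  proof (rule morphism_fspace_of[OF Y.function_algebra_axioms fa \<psi>_closed])
    fix b :: "(('v \<Rightarrow> real) \<Rightarrow>\<^sub>0 'k) set \<Rightarrow> 'k"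
    assume "b \<in> value_at ` carrier (semigroup_ring T)"
    then obtain f :: "('v \<Rightarrow> real) \<Rightarrow>\<^sub>0 'k"
      where f: "f \<in> carrier (semigroup_ring T)" "b = value_at f" by blast
    define p where "p = (\<lambda>x. \<Sum>u\<in>Poly_Mapping.keys f. Poly_Mapping.lookup f u * monomial m (expo u) x)"
    have "p \<in> poly_fun m"
      unfolding p_def
      by (intro poly_fun_sum poly_fun.poly_mult poly_fun.poly_const monomial_mem_poly_fun)
    moreover have "p x = b (\<psi> x)" if "x \<in> Y" for x
      unfolding f(2) \<psi>_def value_at_point[OF T \<delta>_hom[OF that] f(1)] by (simp add: p_def ev_def \<delta>_def)
    ultimately show "\<exists>a\<in>poly_fun m. \<forall>x\<in>Y. a x = b (\<psi> x)" by blast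
  qed
  have "isomorphic_fspace (Spec T) (fspace_of Y (poly_fun m))"
    unfolding isomorphic_fspace_def
  proof (intro exI conjI ballI)
    show "morphism (Spec T) (fspace_of Y (poly_fun m)) \<phi>" by (rule mor\<phi>)
    show "morphism (fspace_of Y (poly_fun m)) (Spec T) \<psi>" by (rule mor\<psi>)
    show "\<psi> (\<phi> z) = z" if "z \<in> points (Spec T)" for z
      using that \<psi>\<phi> by (simp add: Spec_def)
    show "\<phi> (\<psi> x) = x" if "x \<in> points (fspace_of Y (poly_fun m :: ((nat \<Rightarrow> 'k) \<Rightarrow> 'k) set))" for x
      using that \<phi>\<psi> by simp
  qed
  then show ?thesis using F unfolding Y_def by blast
qed

context fan_in_lattice
begin

text \<open>For \<open>\<tau> \<subseteq> \<sigma>\<close> the overlap with the chart of \<sigma> is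
  the whole chart of \<tau>, so the chart map of \<sigma> is onto. In each chart its inverse is a
  contraction, hence a morphism.\<close>

lemma isomorphic_largest_chart:
  assumes \<sigma>: "\<sigma> \<in> \<Delta>" and largest: "\<And>\<tau>. \<tau> \<in> \<Delta> \<Longrightarrow> \<tau> \<subseteq> \<sigma>"
  shows "isomorphic_fspace (X :: (('v, 'k::alg_closed_field) toric_point, 'k) fspace) (affine_chart N \<sigma>)"
proof -
  let ?c = "chart_map N \<Delta> \<sigma> :: _ \<Rightarrow> ('v, 'k) toric_point"
  define \<phi> where "\<phi> = inv_into (closed_points (S \<sigma>)) ?c"
  have \<phi>c: "\<phi> (?c x) = x" if "x \<in> closed_points (S \<sigma>)" for x
    unfolding \<phi>_def by (rule inv_into_f_f[OF chart_map_inj[OF \<sigma>] that])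
  have sub: "S \<sigma> \<subseteq> S \<tau>" if "\<tau> \<in> \<Delta>" for \<tau>
    by (rule cone_semigroup_mono[OF largest[OF that]])
  have glue: "chart_map N \<Delta> \<tau> x = ?c (contract (S \<sigma>) x) \<and> contract (S \<sigma>) x \<in> closed_points (S \<sigma>)"
    if \<tau>: "\<tau> \<in> \<Delta>" and x: "x \<in> closed_points (S \<tau>)" for \<tau> x
  proof -
    obtain \<gamma> where \<gamma>: "monoid_hom (S \<tau>) \<gamma>" "x = point (S \<tau>) \<gamma>" using closed_pointE[OF \<tau> x] .
    have "\<tau> \<inter> \<sigma> = \<tau>" using largest[OF \<tau>] by blast
    then have "chart_map N \<Delta> \<tau> (point (S \<tau>) \<gamma>) = ?c (point (S \<sigma>) \<gamma>)"
      using \<gamma>(1) by (intro chart_map_restrict[OF \<tau> \<sigma>]) simp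
    moreover have "point (S \<sigma>) \<gamma> \<in> closed_points (S \<sigma>)"
      by (rule point_mem_closed_points[OF submonoid_cone_semigroup monoid_hom_subset[OF \<gamma>(1) sub[OF \<tau>]]])
    ultimately show ?thesis by (simp add: \<gamma>(2) contract_point[OF sub[OF \<tau>]])
  qed
  have \<phi>_chart: "\<phi> (chart_map N \<Delta> \<tau> x) = contract (S \<sigma>) x"
    if "\<tau> \<in> \<Delta>" "x \<in> closed_points (S \<tau>)" for \<tau> x
    using glue[OF that] \<phi>c by simp
  have c\<phi>: "?c (\<phi> P) = P \<and> \<phi> P \<in> closed_points (S \<sigma>)" if P: "P \<in> points X" for P
  proof -
    obtain \<tau> x where *: "\<tau> \<in> \<Delta>" "x \<in> closed_points (S \<tau>)" "P = chart_map N \<Delta> \<tau> x"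
      using points_XE[OF P] .
    show ?thesis using glue[OF *(1,2)] \<phi>_chart[OF *(1,2)] *(3) by simp
  qed
  have mor: "morphism (affine_chart N \<tau> :: (_, 'k) fspace) (affine_chart N \<sigma>) (contract (S \<sigma>))"
    if \<tau>: "\<tau> \<in> \<Delta>" for \<tau>
    unfolding affine_chart_eq
  proof (rule morphism_fspace_of[OF function_algebra_chart[OF \<tau>] function_algebra_chart[OF \<sigma>]])
    show "contract (S \<sigma>) x \<in> closed_points (S \<sigma>)" if "x \<in> closed_points (S \<tau>)"
      for x :: "(('v \<Rightarrow> real) \<Rightarrow>\<^sub>0 'k) set" using glue[OF \<tau> that] by blast
    fix b :: "(('v \<Rightarrow> real) \<Rightarrow>\<^sub>0 'k) set \<Rightarrow> 'k" assume "b \<in> value_at ` carrier (semigroup_ring (S \<sigma>))"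
    then obtain f :: "('v \<Rightarrow> real) \<Rightarrow>\<^sub>0 'k"
      where f: "f \<in> carrier (semigroup_ring (S \<sigma>))" "b = value_at f" by blast
    have f': "f \<in> carrier (semigroup_ring (S \<tau>))"
      using f(1) sub[OF \<tau>] by (auto simp: mem_carrier_semigroup_ring)
    have "value_at f x = b (contract (S \<sigma>) x)" if x: "x \<in> closed_points (S \<tau>)" for x
    proof -
      obtain \<gamma> where \<gamma>: "monoid_hom (S \<tau>) \<gamma>" "x = point (S \<tau>) \<gamma>" using closed_pointE[OF \<tau> x] .
      show ?thesis
        unfolding f(2) \<gamma>(2) contract_point[OF sub[OF \<tau>]]
          value_at_point[OF submonoid_cone_semigroup \<gamma>(1) f']
          value_at_point[OF submonoid_cone_semigroup monoid_hom_subset[OF \<gamma>(1) sub[OF \<tau>]] f(1)] ..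
    qed
    then show "\<exists>a\<in>value_at ` carrier (semigroup_ring (S \<tau>)).
        \<forall>x\<in>closed_points (S \<tau>). a x = b (contract (S \<sigma>) x)" using f' by blast
  qed
  \<comment> \<open>Openness and regularity on \<open>X\<close> are tested chart by chart, and there
    \<open>\<phi>\<close> may be replaced by the contraction.\<close>
  have pre: "chart_preimage N \<Delta> {P \<in> points X. \<phi> P \<in> V} \<tau> =
      {x \<in> points (affine_chart N \<tau>). contract (S \<sigma>) x \<in> V}"
    if \<tau>: "\<tau> \<in> \<Delta>" for V \<tau>
    unfolding chart_preimage_def points_affine_chart[OF \<tau>] points_X
    using chart_map_mem[OF \<tau>] \<phi>_chart[OF \<tau>] by auto
  have mor\<phi>: "morphism X (affine_chart N \<sigma>) \<phi>"
    unfolding morphism_def continuous_map_def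
  proof (intro conjI allI impI)
    show "\<phi> \<in> points X \<rightarrow> points (affine_chart N \<sigma>)"
      using c\<phi> by (auto simp: points_affine_chart[OF \<sigma>])
  next
    fix V :: "(('v \<Rightarrow> real) \<Rightarrow>\<^sub>0 'k) set set" assume V: "openin (top_of (affine_chart N \<sigma>)) V"
    show "openin (top_of X) {P \<in> points X. \<phi> P \<in> V}"
      unfolding openin_X
    proof (intro conjI ballI)
      show "{P \<in> points X. \<phi> P \<in> V} \<subseteq> chart_points N \<Delta> // gluing N \<Delta>" by (auto simp: points_X)
      fix \<tau> assume \<tau>: "\<tau> \<in> \<Delta>"
      show "openin (top_of (affine_chart N \<tau>)) (chart_preimage N \<Delta> {P \<in> points X. \<phi> P \<in> V} \<tau>)"
        unfolding pre[OF \<tau>] by (rule morphism_openin[OF mor[OF \<tau>] V])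
    qed
  next
    fix V :: "(('v \<Rightarrow> real) \<Rightarrow>\<^sub>0 'k) set set" and f :: "(('v \<Rightarrow> real) \<Rightarrow>\<^sub>0 'k) set \<Rightarrow> 'k"
    assume V: "openin (top_of (affine_chart N \<sigma>)) V" and f: "f \<in> regular (affine_chart N \<sigma>) V"
    show "f \<circ> \<phi> \<in> regular X {P \<in> points X. \<phi> P \<in> V}"
      unfolding regular_X
    proof
      fix \<tau> assume \<tau>: "\<tau> \<in> \<Delta>"
      have "f \<circ> contract (S \<sigma>) \<in> regular (affine_chart N \<tau>)
          {x \<in> points (affine_chart N \<tau>). contract (S \<sigma>) x \<in> V}"
        by (rule morphism_regular[OF mor[OF \<tau>] V f])
      then have "f \<circ> \<phi> \<circ> chart_map N \<Delta> \<tau> \<in> regular (affine_chart N \<tau>)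
          {x \<in> points (affine_chart N \<tau>). contract (S \<sigma>) x \<in> V}"
        unfolding affine_chart_eq[of \<tau>]
      proof (rule function_algebra.regular_cong[OF function_algebra_chart[OF \<tau>]])
        fix x :: "(('v \<Rightarrow> real) \<Rightarrow>\<^sub>0 'k) set"
        assume "x \<in> {x \<in> points (fspace_of (closed_points (S \<tau>))
          (value_at ` carrier (semigroup_ring (S \<tau>)) :: ((('v \<Rightarrow> real) \<Rightarrow>\<^sub>0 'k) set \<Rightarrow> 'k) set)).
            contract (S \<sigma>) x \<in> V}"
        then have "x \<in> closed_points (S \<tau>)"
          using points_affine_chart[OF \<tau>, where 'k='k] unfolding affine_chart_eq by blast
        then show "(f \<circ> contract (S \<sigma>)) x = (f \<circ> \<phi> \<circ> chart_map N \<Delta> \<tau>) x"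
          using \<phi>_chart[OF \<tau>] by simp
      qed
      then show "f \<circ> \<phi> \<circ> chart_map N \<Delta> \<tau> \<in>
          regular (affine_chart N \<tau>) (chart_preimage N \<Delta> {P \<in> points X. \<phi> P \<in> V} \<tau>)"
        unfolding pre[OF \<tau>] .
    qed
  qed
  show ?thesis
    unfolding isomorphic_fspace_def
  proof (intro exI conjI ballI)
    show "morphism X (affine_chart N \<sigma>) \<phi>" by (rule mor\<phi>)
    show "morphism (affine_chart N \<sigma>) X ?c" by (rule morphism_chart_map[OF \<sigma>])
  qed (use c\<phi> \<phi>c in \<open>auto simp: points_affine_chart[OF \<sigma>]\<close>)
qed

lemma affine_variety_largest_chart:
  assumes \<sigma>: "\<sigma> \<in> \<Delta>" and largest: "\<And>\<tau>. \<tau> \<in> \<Delta> \<Longrightarrow> \<tau> \<subseteq> \<sigma>"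
  shows "affine_variety (X :: (('v, 'k::alg_closed_field) toric_point, 'k) fspace)"
proof -
  obtain F where F: "cone_gens N \<sigma> F" using fan_gens[OF fan \<sigma>] .
  from gordan[OF N F] obtain G where G: "finite G" "G \<subseteq> S \<sigma>" "S \<sigma> \<subseteq> monoid_span G" by blast
  from isomorphic_Spec_zero_locus[OF submonoid_cone_semigroup G, where 'k = 'k]
  obtain m and E :: "((nat \<Rightarrow> 'k) \<Rightarrow> 'k) set" where E: "E \<subseteq> poly_fun m"
    "isomorphic_fspace (affine_chart N \<sigma> :: (_, 'k) fspace) (fspace_of (zero_locus m E) (poly_fun m))"
    unfolding affine_chart_def by blast
  show ?thesis
    unfolding affine_variety_def
    using E(1) isomorphic_fspace_trans[OF isomorphic_largest_chart[OF \<sigma> largest] E(2)] by blast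
qed

text \<open>Each cone equals its intersection with \<sigma>, which is a face of \<sigma> by the
  second fan axiom; the converse is the first.\<close>

lemma fan_eq_faces_of_largest:
  assumes \<sigma>: "\<sigma> \<in> \<Delta>" and largest: "\<And>\<tau>. \<tau> \<in> \<Delta> \<Longrightarrow> \<tau> \<subseteq> \<sigma>"
  shows "\<Delta> = insert \<sigma> {\<tau>. face_of_cone \<tau> \<sigma>}"
proof (intro equalityI subsetI)
  fix \<tau> assume \<tau>: "\<tau> \<in> \<Delta>"
  have "\<sigma> \<inter> \<tau> = \<tau>" using largest[OF \<tau>] by blast
  then show "\<tau> \<in> insert \<sigma> {\<tau>. face_of_cone \<tau> \<sigma>}" using fan_Int(2)[OF fan \<sigma> \<tau>] by simp
next
  fix \<tau> assume "\<tau> \<in> insert \<sigma> {\<tau>. face_of_cone \<tau> \<sigma>}"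
  then show "\<tau> \<in> \<Delta>" using \<sigma> fan by (auto simp: fan_def)
qed

end

theorem theorem3p1:
  fixes N :: "'v::real_vector set"
    and \<Delta> :: "'v set set"
    and X :: "(('v, 'k::alg_closed_field) toric_point, 'k) fspace"
  assumes "lattice_in N"
    and "fan N \<Delta>"
    and "X = toric_variety N \<Delta>"
    and "\<exists>\<mu> :: ('v, 'k) toric_point \<times> ('v, 'k) toric_point \<Rightarrow> ('v, 'k) toric_point.
           toric_semigroup N \<Delta> \<mu>"
  shows "(\<exists>\<sigma>\<in>\<Delta>. \<Delta> = insert \<sigma> {\<tau>. face_of_cone \<tau> \<sigma>}) \<and> affine_variety X"
proof -
  interpret fan_in_lattice N \<Delta> using assms(1,2) by unfold_locales
  obtain \<mu> :: "('v, 'k) toric_point \<times> ('v, 'k) toric_point \<Rightarrow> ('v, 'k) toric_point"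
    where \<mu>: "toric_semigroup N \<Delta> \<mu>" using assms(4) by blast
  obtain \<sigma> where \<sigma>: "\<sigma> \<in> \<Delta>" "\<And>\<tau>. \<tau> \<in> \<Delta> \<Longrightarrow> \<tau> \<subseteq> \<sigma>" using largest_cone[OF \<mu>] by blast
  show ?thesis
    using fan_eq_faces_of_largest[OF \<sigma>] affine_variety_largest_chart[OF \<sigma>] \<sigma>(1) assms(3) by blast
qed

end
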